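(* Let $(G,H)$ be a reduced discrete Hecke pair and let $(\bar G,\bar H)$ be its Schlichting completion. The following are equivalent: (i) the Hecke pair $(G,H)$ has property (RD); (ii) the Hecke pair $(\bar G,\bar H)$ has property (RD); (iii) the totally disconnected locally compact group $\bar G$ has property (RD).
   Context: A discrete Hecke pair is a group $G$ with a subgroup $H$ such that $[H:H\cap xHx^{-1}]<\infty$ for all $x\in G$; it is reduced if $\bigcap_{x\in G}xHx^{-1}=\{e\}$. Schlichting completion: $G$ acts faithfully (by reducedness) on the set $G/H$ by left multiplication, so $G$ embeds in the group of permutations of $G/H$; endow that group with the topology of pointwise convergence ($G/H$ discrete), let $\bar G$ be the closure of $G$ and $\bar H$ the closure of $H$. Then $\bar G$ is a totally disconnected locally compact group in which $G$ is dense and $\bar H$ is a compact open subgroup. For a locally compact group $G$ with closed subgroup $H$ and $H\backslash G$ discrete or $H$ compact, equip $H\backslash G$ with a right $G$-invariant measure $\nu$ (counting measure in the discrete case) and let $\mathcal H(G,H)$ be the compactly supported continuous right $H$-invariant functions on $H\backslash G$ with product $f*g(Hx)=\int_{H\backslash G}f(Hxy^{-1})g(Hy)\,d\nu(Hy)$ and left regular representation $\lambda(f)\xi=f*\xi$ on $L^2(H\backslash G,\nu)$. A length function on $(G,H)$ is a Borel $l:G\to[0,\infty)$ with $l(e)=0$, $l(g)=l(g^{-1})$, $l(gh)\le l(g)+l(h)$, $l|_H=0$; locally bounded means the induced function on $H\backslash G$ is bounded on compact sets. $(G,H)$ has property (RD) if there exist a locally bounded length function $l$ on $(G,H)$ and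 $s,c>0$ with $\|\lambda(f)\|\le c\big(\int_{H\backslash G}|f(Hx)|^2(1+l(x))^{2s}d\nu(Hx)\big)^{1/2}$ for all $f\in\mathcal H(G,H)$; a locally compact group $G$ has property (RD) if $(G,\{e\})$ does (with right Haar measure). *)

theory Defs
  imports "HOL-Analysis.Analysis" "HOL-Algebra.Left_Coset" "HOL-Algebra.Bij"
begin

definition hecke_pair :: "'a monoid \<Rightarrow> 'a set \<Rightarrow> bool" where
  "hecke_pair G H \<longleftrightarrow> group G \<and> subgroup H G \<and>
     (\<forall>x\<in>carrier G.
        finite (lcosets\<^bsub>G\<lparr>carrier := H\<rparr>\<^esub> (H \<inter> ((x <#\<^bsub>G\<^esub> H) #>\<^bsub>G\<^esub> inv\<^bsub>G\<^esub> x))))"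

definition reduced_hecke_pair :: "'a monoid \<Rightarrow> 'a set \<Rightarrow> bool" where
  "reduced_hecke_pair G H \<longleftrightarrow> hecke_pair G H \<and>
     (\<Inter>x\<in>carrier G. (x <#\<^bsub>G\<^esub> H) #>\<^bsub>G\<^esub> inv\<^bsub>G\<^esub> x) = {\<one>\<^bsub>G\<^esub>}"

text \<open>Topology of pointwise convergence on the permutation group of a discrete set X
  (permutations are extensional, i.e. elements of Bij X).\<close>
definition perm_top :: "'x set \<Rightarrow> ('x \<Rightarrow> 'x) topology" where
  "perm_top X = subtopology (product_topology (\<lambda>_. discrete_topology X) X) (Bij X)"

definition sch_emb :: "'a monoid \<Rightarrow> 'a set \<Rightarrow> 'a \<Rightarrow> ('a set \<Rightarrow> 'a set)" where
  "sch_emb G H g = (\<lambda>C\<in>lcosets\<^bsub>G\<^esub> H. g <#\<^bsub>G\<^esub> C)"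

definition sch_carrier :: "'a monoid \<Rightarrow> 'a set \<Rightarrow> ('a set \<Rightarrow> 'a set) set" where
  "sch_carrier G H = perm_top (lcosets\<^bsub>G\<^esub> H) closure_of (sch_emb G H ` carrier G)"

definition sch_sub :: "'a monoid \<Rightarrow> 'a set \<Rightarrow> ('a set \<Rightarrow> 'a set) set" where
  "sch_sub G H = perm_top (lcosets\<^bsub>G\<^esub> H) closure_of (sch_emb G H ` H)"

definition sch_group :: "'a monoid \<Rightarrow> 'a set \<Rightarrow> ('a set \<Rightarrow> 'a set) monoid" where
  "sch_group G H = (BijGroup (lcosets\<^bsub>G\<^esub> H))\<lparr>carrier := sch_carrier G H\<rparr>"

definition sch_top :: "'a monoid \<Rightarrow> 'a set \<Rightarrow> ('a set \<Rightarrow> 'a set) topology" where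
  "sch_top G H = subtopology (perm_top (lcosets\<^bsub>G\<^esub> H)) (sch_carrier G H)"

definition borel_of :: "'b topology \<Rightarrow> 'b measure" where
  "borel_of T = sigma (topspace T) {U. openin T U}"

definition quot_top :: "'b monoid \<Rightarrow> 'b topology \<Rightarrow> 'b set \<Rightarrow> 'b set topology" where
  "quot_top L T K = topology (\<lambda>U. U \<subseteq> rcosets\<^bsub>L\<^esub> K \<and>
       openin T {x \<in> carrier L. K #>\<^bsub>L\<^esub> x \<in> U})"

lemma istopology_quot_top:
  "istopology (\<lambda>U. U \<subseteq> rcosets\<^bsub>L\<^esub> K \<and> openin T {x \<in> carrier L. K #>\<^bsub>L\<^esub> x \<in> U})"
proof -
  have i: "{x \<in> carrier L. K #>\<^bsub>L\<^esub> x \<in> U \<inter> V} =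
        {x \<in> carrier L. K #>\<^bsub>L\<^esub> x \<in> U} \<inter> {x \<in> carrier L. K #>\<^bsub>L\<^esub> x \<in> V}" for U V
    by auto
  have u: "{x \<in> carrier L. K #>\<^bsub>L\<^esub> x \<in> \<Union>\<K>} =
        \<Union>((\<lambda>U. {x \<in> carrier L. K #>\<^bsub>L\<^esub> x \<in> U}) ` \<K>)" for \<K>
    by auto
  show ?thesis
    unfolding istopology_def
    by (auto simp only: i u intro!: openin_Int openin_Union)
qed

definition coset_rep :: "'b monoid \<Rightarrow> 'b set \<Rightarrow> 'b set \<Rightarrow> 'b" where
  "coset_rep L K D = (SOME y. y \<in> carrier L \<and> D = K #>\<^bsub>L\<^esub> y)"

definition length_function :: "'b monoid \<Rightarrow> 'b topology \<Rightarrow> 'b set \<Rightarrow> ('b \<Rightarrow> real) \<Rightarrow> bool" where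
  "length_function L T K l \<longleftrightarrow>
     l \<in> borel_measurable (borel_of T) \<and>
     (\<forall>x\<in>carrier L. 0 \<le> l x) \<and> l \<one>\<^bsub>L\<^esub> = 0 \<and>
     (\<forall>x\<in>carrier L. l (inv\<^bsub>L\<^esub> x) = l x) \<and>
     (\<forall>x\<in>carrier L. \<forall>y\<in>carrier L. l (x \<otimes>\<^bsub>L\<^esub> y) \<le> l x + l y) \<and>
     (\<forall>h\<in>K. l h = 0)"

definition locally_bounded :: "'b monoid \<Rightarrow> 'b topology \<Rightarrow> 'b set \<Rightarrow> ('b \<Rightarrow> real) \<Rightarrow> bool" where
  "locally_bounded L T K l \<longleftrightarrow>
     (\<forall>C. compactin (quot_top L T K) C \<longrightarrow>
        (\<exists>B. \<forall>x\<in>carrier L. K #>\<^bsub>L\<^esub> x \<in> C \<longrightarrow> l x \<le> B))"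

definition hecke_fun :: "'b monoid \<Rightarrow> 'b topology \<Rightarrow> 'b set \<Rightarrow> ('b set \<Rightarrow> complex) \<Rightarrow> bool" where
  "hecke_fun L T K f \<longleftrightarrow>
     continuous_map (quot_top L T K) euclidean f \<and>
     (\<exists>C. compactin (quot_top L T K) C \<and> (\<forall>D \<in> rcosets\<^bsub>L\<^esub> K - C. f D = 0)) \<and>
     (\<forall>x\<in>carrier L. \<forall>h\<in>K. f (K #>\<^bsub>L\<^esub> (x \<otimes>\<^bsub>L\<^esub> h)) = f (K #>\<^bsub>L\<^esub> x))"

definition hecke_conv :: "'b monoid \<Rightarrow> 'b set \<Rightarrow> 'b set measure \<Rightarrow>
    ('b set \<Rightarrow> complex) \<Rightarrow> ('b set \<Rightarrow> complex) \<Rightarrow> 'b set \<Rightarrow> complex" where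
  "hecke_conv L K \<nu> f \<xi> D =
     (LINT C|\<nu>. f (K #>\<^bsub>L\<^esub> (coset_rep L K D \<otimes>\<^bsub>L\<^esub> inv\<^bsub>L\<^esub> (coset_rep L K C))) * \<xi> C)"

definition l2sq :: "'c measure \<Rightarrow> ('c \<Rightarrow> complex) \<Rightarrow> ennreal" where
  "l2sq \<nu> \<xi> = (\<integral>\<^sup>+ C. ennreal ((cmod (\<xi> C))\<^sup>2) \<partial>\<nu>)"

definition rd_weight_sq :: "'b monoid \<Rightarrow> 'b set \<Rightarrow> 'b set measure \<Rightarrow> ('b \<Rightarrow> real) \<Rightarrow> real \<Rightarrow>
    ('b set \<Rightarrow> complex) \<Rightarrow> ennreal" where
  "rd_weight_sq L K \<nu> l s f =
     (\<integral>\<^sup>+ C. ennreal ((cmod (f C))\<^sup>2 * (1 + l (coset_rep L K C)) powr (2 * s)) \<partial>\<nu>)"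

text \<open>Property (RD) for the pair (L,K) with measure nu on K\L. The operator-norm bound
  ||lambda(f)|| <= c ||f||_{l,s} is written out as: for every xi in L2(K\L,nu),
  ||f * xi||_2 <= c ||f||_{l,s} ||xi||_2 (squared).\<close>
definition pair_RD :: "'b monoid \<Rightarrow> 'b topology \<Rightarrow> 'b set \<Rightarrow> 'b set measure \<Rightarrow> bool" where
  "pair_RD L T K \<nu> \<longleftrightarrow>
     (\<exists>l s c. length_function L T K l \<and> locally_bounded L T K l \<and> 0 < s \<and> 0 < c \<and>
        (\<forall>f. hecke_fun L T K f \<longrightarrow>
           (\<forall>\<xi> \<in> borel_measurable \<nu>. l2sq \<nu> \<xi> < \<infinity> \<longrightarrow>
              l2sq \<nu> (hecke_conv L K \<nu> f \<xi>) \<le> ennreal (c\<^sup>2) * rd_weight_sq L K \<nu> l s f * l2sq \<nu> \<xi>)))"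

definition right_haar :: "'b monoid \<Rightarrow> 'b topology \<Rightarrow> 'b measure \<Rightarrow> bool" where
  "right_haar L T \<mu> \<longleftrightarrow>
     space \<mu> = space (borel_of T) \<and> sets \<mu> = sets (borel_of T) \<and>
     (\<forall>C. compactin T C \<longrightarrow> emeasure \<mu> C < \<infinity>) \<and>
     (\<forall>A\<in>sets \<mu>. emeasure \<mu> A = (INF U\<in>{U. openin T U \<and> A \<subseteq> U}. emeasure \<mu> U)) \<and>
     (\<forall>U. openin T U \<longrightarrow> emeasure \<mu> U = (SUP C\<in>{C. compactin T C \<and> C \<subseteq> U}. emeasure \<mu> C)) \<and>
     emeasure \<mu> (carrier L) \<noteq> 0 \<and>
     (\<forall>A\<in>sets \<mu>. \<forall>g\<in>carrier L. A #>\<^bsub>L\<^esub> g \<in> sets \<mu> \<and> emeasure \<mu> (A #>\<^bsub>L\<^esub> g) = emeasure \<mu> A)"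

text \<open>G has (RD) iff the pair (G,{e}) has (RD), with a right Haar measure transported to
  {e}\G (the space of singletons).\<close>
definition group_RD :: "'b monoid \<Rightarrow> 'b topology \<Rightarrow> bool" where
  "group_RD L T \<longleftrightarrow>
     (\<exists>\<mu>. right_haar L T \<mu> \<and>
        pair_RD L T {\<one>\<^bsub>L\<^esub>}
          (distr \<mu> (borel_of (quot_top L T {\<one>\<^bsub>L\<^esub>})) (\<lambda>x. {\<one>\<^bsub>L\<^esub>} #>\<^bsub>L\<^esub> x)))"

end

theory Submission
  imports Defs
begin

text \<open>
  All three conditions are equivalent to one inequality for non-negative functions on right
  cosets, \<open>disc_RD\<close>. For (i) and (ii) this is clear from \<open>|f * \<xi>| \<le> |f| * |\<xi>|\<close>. The inequality
  passes between the two pairs because the embedding of \<open>G\<close> identifies \<open>H\G\<close> with its completed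
  counterpart, compatibly with convolution.

  For (iii), write \<open>L\<close> for the completion and \<open>K\<close> for its compact open subgroup. A compactly
  supported continuous function on \<open>L\<close> is approximated from above by functions bi-invariant under
  a small open subgroup \<open>U\<close> of \<open>K\<close>. Convolution by such a function is a block matrix
  indexed by \<open>K\L\<close> with blocks of size \<open>[K:U]\<close>, and replacing the blocks by their
  Hilbert--Schmidt norms reduces the estimate to the one for \<open>(L,K)\<close>. Conversely, \<open>K\<close>-bi-invariant
  functions are compactly supported continuous functions on \<open>L\<close>, and a locally bounded length
  function is dominated by one vanishing on \<open>K\<close>. A right Haar measure on \<open>L\<close> is constructed
  by counting the cosets of small open subgroups, normalised by their index in \<open>K\<close>.
\<close>

section \<open>Sums over cosets\<close>

text \<open>Refining the inequality from \<open>K\<close> to \<open>U\<close> costs a factor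
  \<open>[K:U]\<close>, because a Hilbert-Schmidt norm sums over both indices of a block. The loss
  is harmless: a right Haar measure satisfies \<open>[K:U] \<mu>(U) = \<mu>(K)\<close>, and passing
  from \<open>L\<close> to \<open>U\<close>-cosets leaves exactly one spare factor
  \<open>\<mu>(U)\<close>. So the constant does not depend on \<open>U\<close>, and \<open>U\<close>
  may shrink with the quality of the approximation. The weight survives the passage to blocks
  because a length that vanishes on \<open>K\<close> is \<open>K\<close>-bi-invariant.

  Two obstacles shape the details. A coset space may be uncountable, so coset sums are
  \<open>ennreal\<close> integrals over counting measure, and they are exchanged with Haar integrals
  only after cutting down to a countable or finite support. A non-integrable Bochner integral is 0
  by default: this is harmless for upper bounds, but to recover the inequality from (RD)
  integrability has to be checked, and it comes from finiteness of supports modulo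
  \<open>K\<close>.\<close>

lemma nn_integral_count_space_pairs:
  "(\<integral>\<^sup>+x. \<integral>\<^sup>+y. f (x, y) \<partial>count_space B \<partial>count_space A) = (\<integral>\<^sup>+p. f p \<partial>count_space (A \<times> B))"
proof -
  have "(\<integral>\<^sup>+x. \<integral>\<^sup>+y. f (x, y) \<partial>count_space B \<partial>count_space A) =
    (\<integral>\<^sup>+x. \<integral>\<^sup>+y. (\<lambda>p. f p * indicator (A \<times> B) p) (x, y) \<partial>count_space UNIV \<partial>count_space UNIV)"
    by (subst (1 2) nn_integral_count_space_indicator)
       (auto intro!: nn_integral_cong simp: indicator_def)
  also have "\<dots> = (\<integral>\<^sup>+p. f p \<partial>count_space (A \<times> B))"
    by (subst nn_integral_fst_count_space) (simp add: nn_integral_count_space_indicator)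
  finally show ?thesis .
qed

text \<open>Markov's inequality leaves only finitely many points with value at least
  \<open>1/(n+1)\<close>. This is what permits exchanging a coset sum with a Haar integral when
  there are uncountably many cosets.\<close>

lemma countable_support_count_space:
  fixes f :: "'a \<Rightarrow> ennreal"
  assumes "(\<integral>\<^sup>+x. f x \<partial>count_space A) < \<infinity>"
  shows "countable {a \<in> A. f a \<noteq> 0}"
proof -
  have fin: "finite {a \<in> A. 1 \<le> of_nat (Suc n) * f a}" for n
  proof -
    have "emeasure (count_space A) {a \<in> space (count_space A). 1 \<le> of_nat (Suc n) * f a}
        \<le> of_nat (Suc n) * (\<integral>\<^sup>+x. f x * indicator (space (count_space A)) x \<partial>count_space A)"
      by (rule nn_integral_Markov_inequality) auto
    also have "\<dots> = of_nat (Suc n) * (\<integral>\<^sup>+x. f x \<partial>count_space A)"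
      by (auto intro!: arg_cong2[where f="(*)"] nn_integral_cong)
    also have "\<dots> < \<infinity>"
      using assms by (simp add: ennreal_mult_less_top of_nat_less_top)
    finally show ?thesis
      by (auto simp: emeasure_count_space split: if_splits)
  qed
  have "{a \<in> A. f a \<noteq> 0} \<subseteq> (\<Union>n. {a \<in> A. 1 \<le> of_nat (Suc n) * f a})"
  proof safe
    fix a assume "a \<in> A" "f a \<noteq> 0"
    have "\<exists>n. 1 \<le> of_nat (Suc n) * f a"
    proof (cases "f a")
      case (real r)
      with \<open>f a \<noteq> 0\<close> have "0 < r" by auto
      then obtain n where "1 / r < real n" using reals_Archimedean2 by blast
      with \<open>0 < r\<close> have "1 \<le> real (Suc n) * r" by (simp add: field_simps)
      then have "ennreal 1 \<le> ennreal (real (Suc n)) * ennreal r"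
        using \<open>0 < r\<close> by (subst ennreal_mult[symmetric]) (auto intro!: ennreal_leI)
      then show ?thesis using real by (auto simp flip: ennreal_of_nat_eq_real_of_nat)
    next
      case top
      then show ?thesis by (auto simp: ennreal_mult_top)
    qed
    then show "a \<in> (\<Union>n. {a \<in> A. 1 \<le> of_nat (Suc n) * f a})"
      using \<open>a \<in> A\<close> by blast
  qed
  then show ?thesis
    by (rule countable_subset) (intro countable_UN countableI_type countable_finite fin)
qed

text \<open>Finite partial sums control a counting integral even over an uncountable set; it is
  enough to test the simple functions below \<open>f\<close>.\<close>

lemma nn_integral_count_space_leI:
  fixes f :: "'a \<Rightarrow> ennreal"
  assumes le: "\<And>F. finite F \<Longrightarrow> F \<subseteq> A \<Longrightarrow> sum f F \<le> B"
  shows "(\<integral>\<^sup>+x. f x \<partial>count_space A) \<le> B"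
  unfolding nn_integral_def
proof (safe intro!: SUP_least)
  fix g assume g: "simple_function (count_space A) g" "g \<le> f"
  let ?P = "{a \<in> A. 0 < g a}"
  have fing: "finite (g ` A)" using g by simp
  have "(\<integral>\<^sup>+x. g x \<partial>count_space A) \<le> B"
  proof (cases "finite ?P")
    case True
    then have "(\<integral>\<^sup>+x. g x \<partial>count_space A) = sum g ?P"
      by (subst nn_integral_count_space) auto
    also have "\<dots> \<le> sum f ?P" using g by (intro sum_mono) (auto simp: le_fun_def)
    also have "\<dots> \<le> B" using True by (intro le) auto
    finally show ?thesis .
  next
    case False
    \<comment> \<open>A simple function has a least positive value \<open>m\<close>. If it is
      positive on an infinite set, finite subsets of growing size force \<open>B\<close> to be
      infinite.\<close>
    define m where "m = Min (g ` ?P)"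
    have fin: "finite (g ` ?P)" by (rule finite_subset[OF _ fing]) auto
    have m: "0 < m" unfolding m_def using fin False infinite_imp_nonempty[OF False] by (subst Min_gr_iff) auto
    have "of_nat n * m \<le> B" for n
    proof -
      obtain F where F: "F \<subseteq> ?P" "card F = n" "finite F"
        using infinite_arbitrarily_large[OF False, of n] by auto
      have "of_nat n * m = (\<Sum>a\<in>F. m)" using F by simp
      also have "\<dots> \<le> sum f F"
      proof (rule sum_mono)
        fix a assume "a \<in> F"
        then have "m \<le> g a" unfolding m_def using F fin by (intro Min_le) auto
        also have "\<dots> \<le> f a" using g by (auto simp: le_fun_def)
        finally show "m \<le> f a" .
      qed
      also have "\<dots> \<le> B" using F by (intro le) auto
      finally show ?thesis .
    qed
    then have "(SUP n. of_nat n * m) \<le> B" by (auto intro: SUP_least)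
    moreover have "(SUP n. of_nat n * m) = (\<infinity>::ennreal)"
      using m by (subst SUP_mult_right_ennreal[symmetric])
        (simp add: ennreal_SUP_of_nat_eq_top ennreal_top_mult del: SUP_eq_top_iff)
    ultimately show ?thesis by (simp add: top_unique)
  qed
  then show "integral\<^sup>S (count_space A) g \<le> B"
    using g nn_integral_eq_simple_integral[OF g(1)] by simp
qed

lemma sum_le_nn_integral_count_space:
  fixes f :: "'a \<Rightarrow> ennreal"
  assumes "finite F" "F \<subseteq> A"
  shows "sum f F \<le> (\<integral>\<^sup>+x. f x \<partial>count_space A)"
proof -
  have "sum f F = (\<integral>\<^sup>+x. f x * indicator F x \<partial>count_space A)"
    using assms by (subst nn_integral_count_space'[of F]) auto
  also have "\<dots> \<le> (\<integral>\<^sup>+x. f x \<partial>count_space A)"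
    by (intro nn_integral_mono) (auto simp: indicator_def)
  finally show ?thesis .
qed

text \<open>Meant for left \<open>U\<close>-invariant functions, where the chosen representatives do
  not matter. It uses the same \<open>coset_rep\<close> as the definition of (RD), so integrals over
  counting measure unfold to it directly.\<close>

definition csum :: "'b monoid \<Rightarrow> 'b set \<Rightarrow> ('b \<Rightarrow> ennreal) \<Rightarrow> ennreal" where
  "csum L U \<phi> = (\<integral>\<^sup>+D. \<phi> (coset_rep L U D) \<partial>count_space (rcosets\<^bsub>L\<^esub> U))"

definition left_inv :: "'b monoid \<Rightarrow> 'b set \<Rightarrow> ('b \<Rightarrow> 'c) \<Rightarrow> bool" where
  "left_inv L U \<phi> \<longleftrightarrow> (\<forall>u\<in>U. \<forall>x\<in>carrier L. \<phi> (u \<otimes>\<^bsub>L\<^esub> x) = \<phi> x)"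

definition right_inv :: "'b monoid \<Rightarrow> 'b set \<Rightarrow> ('b \<Rightarrow> 'c) \<Rightarrow> bool" where
  "right_inv L U \<phi> \<longleftrightarrow> (\<forall>u\<in>U. \<forall>x\<in>carrier L. \<phi> (x \<otimes>\<^bsub>L\<^esub> u) = \<phi> x)"

text \<open>For left \<open>U\<close>-invariant functions and compact open \<open>U\<close> this is
  compact support, phrased without a topology so that it serves \<open>G\<close> and its completion
  alike.\<close>

definition fin_supp_mod :: "'b monoid \<Rightarrow> 'b set \<Rightarrow> ('b \<Rightarrow> 'c::zero) \<Rightarrow> bool" where
  "fin_supp_mod L U f \<longleftrightarrow> (\<exists>F. finite F \<and> F \<subseteq> carrier L \<and>
     (\<forall>x\<in>carrier L. f x \<noteq> 0 \<longrightarrow> (\<exists>a\<in>F. x \<in> U #>\<^bsub>L\<^esub> a)))"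

locale plain_group = group G for G :: "'a monoid" (structure)
begin

lemma rcosetE:
  assumes "D \<in> rcosets U" obtains x where "x \<in> carrier G" "D = U #> x"
  using assms by (auto simp: RCOSETS_def)

lemma coset_rep:
  assumes "D \<in> rcosets U"
  shows "coset_rep G U D \<in> carrier G" "U #> coset_rep G U D = D"
proof -
  have "\<exists>y. y \<in> carrier G \<and> D = U #> y" using assms by (auto elim: rcosetE)
  from someI_ex[OF this] show "coset_rep G U D \<in> carrier G" "U #> coset_rep G U D = D"
    unfolding coset_rep_def by auto
qed

lemma rcosets_memI: "x \<in> carrier G \<Longrightarrow> U #> x \<in> rcosets U"
  by (auto simp: RCOSETS_def)

lemma mem_r_coset_iff: "x \<in> U #> a \<longleftrightarrow> (\<exists>u\<in>U. x = u \<otimes> a)"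
  by (auto simp: r_coset_def)

lemma r_coset_eq_iff:
  assumes "subgroup U G" "x \<in> carrier G" "y \<in> carrier G"
  shows "U #> x = U #> y \<longleftrightarrow> x \<in> U #> y"
  using assms by (metis repr_independence rcos_self)

lemma mem_r_coset_iff_inv:
  assumes "subgroup U G" "x \<in> carrier G" "y \<in> carrier G"
  shows "x \<in> U #> y \<longleftrightarrow> x \<otimes> inv y \<in> U"
proof
  assume "x \<in> U #> y"
  then obtain u where "u \<in> U" "x = u \<otimes> y" by (auto simp: mem_r_coset_iff)
  then show "x \<otimes> inv y \<in> U" using assms
    by (simp add: inv_solve_right' subgroup.mem_carrier[OF assms(1)] m_assoc)
next
  assume "x \<otimes> inv y \<in> U"
  moreover have "x = x \<otimes> inv y \<otimes> y" using assms by (simp add: m_assoc)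
  ultimately show "x \<in> U #> y" by (auto simp: mem_r_coset_iff)
qed

text \<open>Makes the arbitrary choice inside \<open>coset_rep\<close> harmless for invariant
  functions.\<close>

lemma left_inv_rep:
  assumes "subgroup U G" "left_inv G U \<phi>" "x \<in> carrier G"
  shows "\<phi> (coset_rep G U (U #> x)) = \<phi> x"
proof -
  have r: "coset_rep G U (U #> x) \<in> carrier G" "U #> coset_rep G U (U #> x) = U #> x"
    using coset_rep[OF rcosets_memI[OF assms(3)]] by auto
  then have "coset_rep G U (U #> x) \<in> U #> x"
    using assms by (metis rcos_self)
  then show ?thesis using assms by (auto simp: mem_r_coset_iff left_inv_def)
qed

lemma left_inv_rep_mult:
  assumes "subgroup U G" "left_inv G U \<phi>" "D \<in> rcosets U" "g \<in> carrier G"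
  shows "\<phi> (coset_rep G U (D #> g)) = \<phi> (coset_rep G U D \<otimes> g)"
proof -
  have "D #> g = U #> (coset_rep G U D \<otimes> g)"
    using coset_rep[OF assms(3)] assms subgroup.subset[OF assms(1)]
    by (metis coset_mult_assoc)
  then show ?thesis using left_inv_rep[OF assms(1,2)] coset_rep[OF assms(3)] assms by simp
qed

lemma csum_cong:
  assumes "\<And>x. x \<in> carrier G \<Longrightarrow> \<phi> x = \<psi> x"
  shows "csum G U \<phi> = csum G U \<psi>"
  unfolding csum_def using assms coset_rep(1) by (auto intro!: nn_integral_cong)

lemma csum_mono:
  assumes "\<And>x. x \<in> carrier G \<Longrightarrow> \<phi> x \<le> \<psi> x"
  shows "csum G U \<phi> \<le> csum G U \<psi>"
  unfolding csum_def using assms coset_rep(1) by (auto intro!: nn_integral_mono)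

lemma csum_cmult: "csum G U (\<lambda>x. c * \<phi> x) = c * csum G U \<phi>"
  unfolding csum_def by (rule nn_integral_cmult) auto

lemma csum_sum: "csum G U (\<lambda>x. \<Sum>i\<in>I. \<phi> i x) = (\<Sum>i\<in>I. csum G U (\<phi> i))"
  unfolding csum_def by (rule nn_integral_sum) auto

lemma bij_betw_rcosets_translate:
  assumes "subgroup U G" "g \<in> carrier G"
  shows "bij_betw (\<lambda>D. D #> g) (rcosets U) (rcosets U)"
proof (rule bij_betw_byWitness[where f'="\<lambda>D. D #> inv g"])
  have U: "U \<subseteq> carrier G" using assms subgroup.subset by blast
  show "\<forall>D\<in>rcosets U. D #> g #> inv g = D" "\<forall>D\<in>rcosets U. D #> inv g #> g = D"
    using U assms by (auto simp: RCOSETS_def coset_mult_assoc m_assoc)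
  show "(\<lambda>D. D #> g) ` (rcosets U) \<subseteq> rcosets U" "(\<lambda>D. D #> inv g) ` (rcosets U) \<subseteq> rcosets U"
    using U assms by (auto simp: coset_mult_assoc intro!: rcosets_memI elim!: rcosetE)
qed

text \<open>Right translation permutes the right cosets, so no modular function appears.\<close>

lemma csum_translate:
  assumes "subgroup U G" "left_inv G U \<phi>" "g \<in> carrier G"
  shows "csum G U (\<lambda>x. \<phi> (x \<otimes> g)) = csum G U \<phi>"
  unfolding csum_def
  by (subst nn_integral_bij_count_space[OF bij_betw_rcosets_translate[OF assms(1,3)], symmetric])
     (auto intro!: nn_integral_cong simp: left_inv_rep_mult[OF assms(1,2) _ assms(3)])

text \<open>For a subgroup \<open>U\<close> of \<open>K\<close>, uniqueness makes
  \<open>card R\<close> the index \<open>[K:U]\<close>.\<close>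

definition transversal :: "'a set \<Rightarrow> 'a set \<Rightarrow> 'a set \<Rightarrow> bool" where
  "transversal U K R \<longleftrightarrow> finite R \<and> R \<subseteq> K \<and> (\<forall>k\<in>K. \<exists>!r. r \<in> R \<and> k \<in> U #> r)"

lemma ex_transversal:
  assumes U: "subgroup U G" and K: "subgroup K G" "U \<subseteq> K" and fin: "finite ((\<lambda>k. U #> k) ` K)"
  shows "\<exists>R. transversal U K R"
proof -
  have Kc: "K \<subseteq> carrier G" using K subgroup.subset by blast
  define R where "R = coset_rep G U ` ((\<lambda>k. U #> k) ` K)"
  have rep: "coset_rep G U (U #> k) \<in> carrier G" "U #> coset_rep G U (U #> k) = U #> k"
    if "k \<in> K" for k
    using coset_rep[OF rcosets_memI] that Kc by auto
  have "coset_rep G U (U #> k) \<in> K" if "k \<in> K" for k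
  proof -
    have "coset_rep G U (U #> k) \<in> U #> k" using rep[OF that] U by (metis rcos_self)
    then show ?thesis using K that by (auto simp: mem_r_coset_iff intro!: subgroup.m_closed)
  qed
  then have RK: "R \<subseteq> K" by (auto simp: R_def)
  have "\<exists>!r. r \<in> R \<and> k \<in> U #> r" if "k \<in> K" for k
  proof (rule ex1I[of _ "coset_rep G U (U #> k)"])
    show "coset_rep G U (U #> k) \<in> R \<and> k \<in> U #> coset_rep G U (U #> k)"
      using that rep[OF that] U Kc rcos_self[OF _ U] by (auto simp: R_def)
    fix r assume "r \<in> R \<and> k \<in> U #> r"
    then obtain k' where k': "k' \<in> K" "r = coset_rep G U (U #> k')" "k \<in> U #> r"
      by (auto simp: R_def)
    then have "U #> k = U #> k'" using rep[OF k'(1)] r_coset_eq_iff[OF U, of k r] that Kc by auto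
    then show "r = coset_rep G U (U #> k)" using k' by simp
  qed
  moreover have "finite R" unfolding R_def using fin by (rule finite_imageI)
  ultimately have "transversal U K R" using RK unfolding transversal_def by simp
  then show ?thesis ..
qed

text \<open>A coset \<open>K c\<close> is the disjoint union of the cosets \<open>U (r c)\<close>
  with \<open>r\<close> in \<open>R\<close>, so the pairs \<open>(C, r)\<close> enumerate the
  \<open>U\<close>-cosets exactly once.\<close>

lemma csum_refine:
  assumes U: "subgroup U G" and K: "subgroup K G" "U \<subseteq> K" and R: "transversal U K R"
    and \<phi>: "left_inv G U \<phi>"
  shows "csum G U \<phi> = csum G K (\<lambda>x. \<Sum>r\<in>R. \<phi> (r \<otimes> x))"
proof -
  have Kc: "K \<subseteq> carrier G" using K subgroup.subset by blast
  have RK: "R \<subseteq> K" using R by (simp add: transversal_def)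
  have Rc: "R \<subseteq> carrier G" using RK Kc by blast
  let ?j = "\<lambda>(C, r). U #> (r \<otimes> coset_rep G K C)"
  have bij: "bij_betw ?j ((rcosets K) \<times> R) (rcosets U)"
    unfolding bij_betw_def
  proof
    show "inj_on ?j ((rcosets K) \<times> R)"
    proof (rule inj_onI, clarify)
      fix C r C' r'
      assume C: "C \<in> rcosets K" "C' \<in> rcosets K" and r: "r \<in> R" "r' \<in> R"
        and eq: "U #> (r \<otimes> coset_rep G K C) = U #> (r' \<otimes> coset_rep G K C')"
      let ?c = "coset_rep G K C" let ?c' = "coset_rep G K C'"
      have c: "?c \<in> carrier G" "?c' \<in> carrier G" using coset_rep C by auto
      have rc: "r \<in> carrier G" "r' \<in> carrier G" "r \<in> K" "r' \<in> K" using r Rc RK by auto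
      obtain u where u: "u \<in> U" "r \<otimes> ?c = u \<otimes> (r' \<otimes> ?c')"
        using eq r_coset_eq_iff[OF U, of "r \<otimes> ?c" "r' \<otimes> ?c'"] rc c by (auto simp: mem_r_coset_iff)
      then have uc: "u \<in> carrier G" "u \<in> K" using K Kc by auto
      have "?c = inv r \<otimes> (r \<otimes> ?c)" using rc c by (simp add: m_assoc[symmetric])
      also have "\<dots> = (inv r \<otimes> u \<otimes> r') \<otimes> ?c'" using u rc c uc by (simp add: m_assoc)
      finally have "?c \<in> K #> ?c'"
        using uc rc K by (auto simp: mem_r_coset_iff subgroup.m_closed subgroup.m_inv_closed)
      then have "C = C'" using r_coset_eq_iff[OF K(1) c] coset_rep(2) C by metis
      then have "r = u \<otimes> r'" using u rc c uc by (metis m_assoc m_closed right_cancel)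
      then have "r \<in> U #> r'" "r \<in> U #> r" using u U rc rcos_self by (auto simp: mem_r_coset_iff)
      then have "r = r'" using R r rc unfolding transversal_def by blast
      with \<open>C = C'\<close> show "C = C' \<and> r = r'" by simp
    qed
    show "?j ` ((rcosets K) \<times> R) = rcosets U"
    proof (intro equalityI subsetI)
      fix D assume "D \<in> ?j ` ((rcosets K) \<times> R)"
      then show "D \<in> rcosets U" using Rc coset_rep(1) by (auto intro!: rcosets_memI)
    next
      fix D assume "D \<in> rcosets U"
      then obtain x where x: "x \<in> carrier G" "D = U #> x" by (auto elim: rcosetE)
      let ?c = "coset_rep G K (K #> x)"
      have c: "?c \<in> carrier G" "K #> ?c = K #> x" using coset_rep[OF rcosets_memI[OF x(1)]] by auto
      then have "x \<in> K #> ?c" using r_coset_eq_iff[OF K(1) x(1) c(1)] by simp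
      then obtain k where k: "k \<in> K" "x = k \<otimes> ?c" unfolding mem_r_coset_iff by blast
      then obtain r where r: "r \<in> R" "k \<in> U #> r" using R unfolding transversal_def by blast
      then obtain u where u: "u \<in> U" "k = u \<otimes> r" by (auto simp: mem_r_coset_iff)
      have uc: "u \<in> carrier G" "r \<in> carrier G" using u r Rc K Kc by blast+
      have "x = u \<otimes> r \<otimes> ?c" using k(2) unfolding u(2) .
      then have "x = u \<otimes> (r \<otimes> ?c)" using uc c by (simp only: m_assoc)
      then have "x \<in> U #> (r \<otimes> ?c)" using u(1) unfolding mem_r_coset_iff by blast
      then have "D = U #> (r \<otimes> ?c)" using x(2) r_coset_eq_iff[OF U x(1), of "r \<otimes> ?c"] uc c
        by simp
      then show "D \<in> ?j ` ((rcosets K) \<times> R)" using r rcosets_memI[OF x(1)] by force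
    qed
  qed
  have "csum G U \<phi> = (\<integral>\<^sup>+p. \<phi> (coset_rep G U (?j p)) \<partial>count_space ((rcosets K) \<times> R))"
    unfolding csum_def by (rule nn_integral_bij_count_space[OF bij, symmetric])
  also have "\<dots> = (\<integral>\<^sup>+p. (\<lambda>(C, r). \<phi> (r \<otimes> coset_rep G K C)) p \<partial>count_space ((rcosets K) \<times> R))"
    using Rc coset_rep(1) by (intro nn_integral_cong) (auto intro!: left_inv_rep[OF U \<phi>])
  also have "\<dots> = (\<integral>\<^sup>+C. \<integral>\<^sup>+r. \<phi> (r \<otimes> coset_rep G K C) \<partial>count_space R \<partial>count_space (rcosets K))"
    by (subst nn_integral_count_space_pairs[symmetric]) simp
  also have "\<dots> = csum G K (\<lambda>x. \<Sum>r\<in>R. \<phi> (r \<otimes> x))"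
    using R by (simp add: csum_def nn_integral_count_space_finite transversal_def)
  finally show ?thesis .
qed

end

section \<open>The rapid decay inequality on cosets\<close>

text \<open>The algebraic part of \<open>length_function\<close>. Measurability comes back from
  openness of \<open>K\<close>, because such an \<open>l\<close> is constant on
  \<open>K\<close>-cosets.\<close>

definition alg_length :: "'b monoid \<Rightarrow> 'b set \<Rightarrow> ('b \<Rightarrow> real) \<Rightarrow> bool" where
  "alg_length L K l \<longleftrightarrow>
     (\<forall>x\<in>carrier L. 0 \<le> l x) \<and> l \<one>\<^bsub>L\<^esub> = 0 \<and>
     (\<forall>x\<in>carrier L. l (inv\<^bsub>L\<^esub> x) = l x) \<and>
     (\<forall>x\<in>carrier L. \<forall>y\<in>carrier L. l (x \<otimes>\<^bsub>L\<^esub> y) \<le> l x + l y) \<and>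
     (\<forall>h\<in>K. l h = 0)"

text \<open>The functions live on the group and not on cosets, so that
  \<open>x \<otimes> inv y\<close> can be formed. Right invariance of \<open>f\<close> is what makes
  the inner summand left invariant in \<open>y\<close>. Both sides are squared in order to stay
  inside \<open>ennreal\<close>, and \<open>l\<close>, \<open>s\<close>, \<open>c\<close> are
  explicit because a transfer changes them in a controlled way.\<close>

definition disc_RD :: "'b monoid \<Rightarrow> 'b set \<Rightarrow> ('b \<Rightarrow> real) \<Rightarrow> real \<Rightarrow> real \<Rightarrow> bool" where
  "disc_RD L K l s c \<longleftrightarrow> alg_length L K l \<and> 0 < s \<and> 0 < c \<and>
     (\<forall>(f::'b \<Rightarrow> real) \<xi>::'b \<Rightarrow> real.
        (\<forall>x\<in>carrier L. 0 \<le> f x) \<longrightarrow> left_inv L K f \<longrightarrow> right_inv L K f \<longrightarrow> fin_supp_mod L K f \<longrightarrow>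
        (\<forall>x\<in>carrier L. 0 \<le> \<xi> x) \<longrightarrow> left_inv L K \<xi> \<longrightarrow>
        csum L K (\<lambda>x. ennreal ((\<xi> x)\<^sup>2)) < \<infinity> \<longrightarrow>
        csum L K (\<lambda>x. (csum L K (\<lambda>y. ennreal (f (x \<otimes>\<^bsub>L\<^esub> inv\<^bsub>L\<^esub> y) * \<xi> y)))\<^sup>2)
          \<le> ennreal (c\<^sup>2) * csum L K (\<lambda>x. ennreal ((f x)\<^sup>2 * (1 + l x) powr (2 * s)))
             * csum L K (\<lambda>x. ennreal ((\<xi> x)\<^sup>2)))"

text \<open>The Hecke condition in the shape used by convolutions: a double coset
  \<open>K a K\<close> is a finite union of right cosets.\<close>

definition hecke_fin :: "'b monoid \<Rightarrow> 'b set \<Rightarrow> bool" where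
  "hecke_fin L K \<longleftrightarrow> (\<forall>a\<in>carrier L. \<exists>F. finite F \<and> F \<subseteq> carrier L \<and>
     (\<forall>k\<in>K. \<exists>b\<in>F. a \<otimes>\<^bsub>L\<^esub> k \<in> K #>\<^bsub>L\<^esub> b))"

lemma left_invD: "left_inv L U \<phi> \<Longrightarrow> u \<in> U \<Longrightarrow> x \<in> carrier L \<Longrightarrow> \<phi> (u \<otimes>\<^bsub>L\<^esub> x) = \<phi> x"
  by (simp add: left_inv_def)

lemma right_invD: "right_inv L U \<phi> \<Longrightarrow> u \<in> U \<Longrightarrow> x \<in> carrier L \<Longrightarrow> \<phi> (x \<otimes>\<^bsub>L\<^esub> u) = \<phi> x"
  by (simp add: right_inv_def)

text \<open>Multiplying by an element of length 0 cannot increase the length; undoing it with the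
  inverse, also of length 0, shows that it cannot decrease it either.\<close>

lemma (in plain_group) alg_length_inv:
  assumes K: "subgroup K G" and l: "alg_length G K l"
  shows "left_inv G K l" "right_inv G K l"
proof -
  have le: "l (k \<otimes> x) \<le> l x" "l (x \<otimes> k) \<le> l x" if "k \<in> K" "x \<in> carrier G" for k x
    using l that subgroup.mem_carrier[OF K] unfolding alg_length_def
    by (metis add_0, metis add.right_neutral)
  have "l (k \<otimes> x) = l x" "l (x \<otimes> k) = l x" if "k \<in> K" "x \<in> carrier G" for k x
  proof -
    have kc: "k \<in> carrier G" "inv k \<in> K"
      using that K by (auto simp: subgroup.mem_carrier subgroup.m_inv_closed)
    have "l (inv k \<otimes> (k \<otimes> x)) \<le> l (k \<otimes> x)" "l (x \<otimes> k \<otimes> inv k) \<le> l (x \<otimes> k)"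
      using le(1)[of "inv k" "k \<otimes> x"] le(2)[of "inv k" "x \<otimes> k"] kc that by auto
    moreover have "inv k \<otimes> (k \<otimes> x) = x" "x \<otimes> k \<otimes> inv k = x"
      using kc that by (simp_all add: m_assoc inv_solve_left')
    ultimately show "l (k \<otimes> x) = l x" "l (x \<otimes> k) = l x" using le[OF that] by auto
  qed
  then show "left_inv G K l" "right_inv G K l" by (auto simp: left_inv_def right_inv_def)
qed

lemma sum_L2_set_le:
  "finite S \<Longrightarrow> L2_set (\<lambda>j. \<Sum>C\<in>S. a j C) R \<le> (\<Sum>C\<in>S. L2_set (\<lambda>j. a j C) R)"
proof (induction S rule: finite_induct)
  case empty then show ?case by (simp add: L2_set_def)
next
  case (insert C S)
  then show ?case
    using L2_set_triangle_ineq[of "\<lambda>j. a j C" "\<lambda>j. \<Sum>C\<in>S. a j C" R] by simp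
qed

text \<open>Here \<open>g\<close> is one row of blocks, indexed by \<open>C\<close>, of a block matrix with block entries indexed by \<open>R\<close>.\<close>

lemma hilbert_schmidt_block_bound:
  fixes g :: "'i \<Rightarrow> 'i \<Rightarrow> 'c \<Rightarrow> real" and e :: "'i \<Rightarrow> 'c \<Rightarrow> real"
  assumes S: "finite S" and R: "finite R"
  shows "(\<Sum>j\<in>R. (\<Sum>C\<in>S. \<Sum>i\<in>R. g j i C * e i C)\<^sup>2)
     \<le> (\<Sum>C\<in>S. sqrt (\<Sum>j\<in>R. \<Sum>i\<in>R. (g j i C)\<^sup>2) * sqrt (\<Sum>i\<in>R. (e i C)\<^sup>2))\<^sup>2"
proof -
  let ?a = "\<lambda>j C. \<Sum>i\<in>R. g j i C * e i C"
  \<comment> \<open>Cauchy-Schwarz inside one block bounds its action by its Hilbert-Schmidt norm.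
    Minkowski's inequality then adds up the blocks of the row.\<close>
  have *: "L2_set (\<lambda>j. ?a j C) R \<le> sqrt (\<Sum>j\<in>R. \<Sum>i\<in>R. (g j i C)\<^sup>2) * sqrt (\<Sum>i\<in>R. (e i C)\<^sup>2)" for C
  proof -
    have "(?a j C)\<^sup>2 \<le> (\<Sum>i\<in>R. (g j i C)\<^sup>2) * (\<Sum>i\<in>R. (e i C)\<^sup>2)" for j
      by (rule Cauchy_Schwarz_ineq_sum)
    then have "(\<Sum>j\<in>R. (?a j C)\<^sup>2) \<le> (\<Sum>j\<in>R. \<Sum>i\<in>R. (g j i C)\<^sup>2) * (\<Sum>i\<in>R. (e i C)\<^sup>2)"
      by (simp add: sum_distrib_right sum_mono)
    then show ?thesis
      unfolding L2_set_def real_sqrt_mult[symmetric] by (rule real_sqrt_le_mono)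
  qed
  have "sqrt (\<Sum>j\<in>R. (\<Sum>C\<in>S. ?a j C)\<^sup>2) \<le> (\<Sum>C\<in>S. L2_set (\<lambda>j. ?a j C) R)"
    using sum_L2_set_le[OF S, of ?a R] by (simp add: L2_set_def)
  also have "\<dots> \<le> (\<Sum>C\<in>S. sqrt (\<Sum>j\<in>R. \<Sum>i\<in>R. (g j i C)\<^sup>2) * sqrt (\<Sum>i\<in>R. (e i C)\<^sup>2))"
    by (intro sum_mono *)
  finally show ?thesis by (rule sqrt_le_D)
qed

context plain_group
begin

lemma inv_cancel:
  assumes "x \<in> carrier G" "y \<in> carrier G"
  shows "x \<otimes> (inv x \<otimes> y) = y" "inv x \<otimes> (x \<otimes> y) = y"
  using assms by (simp_all add: m_assoc[symmetric])

lemma fin_supp_mod_finite: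
  assumes "subgroup K G" "fin_supp_mod G K f"
  shows "finite {D \<in> rcosets K. f (coset_rep G K D) \<noteq> 0}"
proof -
  obtain F where F: "finite F" "F \<subseteq> carrier G" "\<And>x. x \<in> carrier G \<Longrightarrow> f x \<noteq> 0 \<Longrightarrow> \<exists>a\<in>F. x \<in> K #> a"
    using assms by (auto simp: fin_supp_mod_def)
  have "{D \<in> rcosets K. f (coset_rep G K D) \<noteq> 0} \<subseteq> (\<lambda>a. K #> a) ` F"
  proof safe
    fix D assume D: "D \<in> rcosets K" "f (coset_rep G K D) \<noteq> 0"
    then obtain a where "a \<in> F" "coset_rep G K D \<in> K #> a" using F(3) coset_rep(1) by blast
    moreover have "K #> coset_rep G K D = D" "coset_rep G K D \<in> carrier G" using D coset_rep by auto
    ultimately show "D \<in> (\<lambda>a. K #> a) ` F"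
      using r_coset_eq_iff[OF assms(1)] F(2) by blast
  qed
  then show ?thesis using F(1) by (meson finite_imageI finite_subset)
qed

text \<open>If \<open>x \<otimes> inv y\<close> lies in \<open>K a\<close>, then \<open>y\<close>
  lies in \<open>inv a K x\<close>. The Hecke condition splits \<open>inv a K\<close> into finitely
  many cosets \<open>K b\<close>, so \<open>y\<close> lies in one of finitely many
  \<open>K (b x)\<close>. Hence each row of a convolution matrix has finitely many nonzero
  entries.\<close>

lemma fin_supp_mod_convolution:
  assumes K: "subgroup K G" and h: "hecke_fin G K" and f: "fin_supp_mod G K f" and x: "x \<in> carrier G"
  shows "fin_supp_mod G K (\<lambda>y. f (x \<otimes> inv y))"
proof -
  obtain F where F: "finite F" "F \<subseteq> carrier G" "\<And>x. x \<in> carrier G \<Longrightarrow> f x \<noteq> 0 \<Longrightarrow> \<exists>a\<in>F. x \<in> K #> a"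
    using f by (auto simp: fin_supp_mod_def)
  have "\<forall>a\<in>F. \<exists>B. finite B \<and> B \<subseteq> carrier G \<and> (\<forall>k\<in>K. \<exists>b\<in>B. inv a \<otimes> k \<in> K #> b)"
    using h F(2) unfolding hecke_fin_def by (meson inv_closed subsetD)
  then obtain B where B: "\<And>a. a \<in> F \<Longrightarrow> finite (B a) \<and> B a \<subseteq> carrier G \<and> (\<forall>k\<in>K. \<exists>b\<in>B a. inv a \<otimes> k \<in> K #> b)"
    by metis
  let ?F = "(\<lambda>b. b \<otimes> x) ` (\<Union>a\<in>F. B a)"
  have "\<exists>c\<in>?F. y \<in> K #> c" if y: "y \<in> carrier G" "f (x \<otimes> inv y) \<noteq> 0" for y
  proof -
    obtain a where a: "a \<in> F" "x \<otimes> inv y \<in> K #> a" using F(3)[of "x \<otimes> inv y"] x y by auto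
    then obtain k where k: "k \<in> K" "x \<otimes> inv y = k \<otimes> a" by (auto simp: mem_r_coset_iff)
    have c: "k \<in> carrier G" "a \<in> carrier G" "inv k \<in> K"
      using k a F K by (auto simp: subgroup.mem_carrier subgroup.m_inv_closed)
    obtain b where b: "b \<in> B a" "inv a \<otimes> inv k \<in> K #> b" using B[OF a(1)] c by blast
    then obtain k' where k': "k' \<in> K" "inv a \<otimes> inv k = k' \<otimes> b" by (auto simp: mem_r_coset_iff)
    have c': "k' \<in> carrier G" "b \<in> carrier G" using k' b B[OF a(1)] K by (auto simp: subgroup.mem_carrier)
    have "y \<otimes> inv x = inv (k \<otimes> a)" using x y by (simp add: k(2)[symmetric] inv_mult_group)
    also have "\<dots> = k' \<otimes> b" using c by (simp add: inv_mult_group k'(2))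
    finally have "y = k' \<otimes> (b \<otimes> x)" using x y c'
      by (metis inv_solve_right m_assoc m_closed)
    then show ?thesis using b a k' by (force simp: mem_r_coset_iff)
  qed
  moreover have "finite ?F" using F(1) B by auto
  moreover have "?F \<subseteq> carrier G" using B x by (auto dest!: B)
  ultimately show ?thesis unfolding fin_supp_mod_def by blast
qed

lemma csum_eq_sum:
  assumes "finite S" "S \<subseteq> rcosets K" "\<And>D. D \<in> rcosets K - S \<Longrightarrow> \<phi> (coset_rep G K D) = 0"
  shows "csum G K \<phi> = (\<Sum>D\<in>S. \<phi> (coset_rep G K D))"
  unfolding csum_def using assms by (intro nn_integral_count_space') auto

text \<open>Right multiplication by \<open>k\<close> permutes the \<open>U\<close>-cosets inside
  \<open>K\<close>. Composing it with the map \<open>\<rho>\<close> to representatives gives an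
  injective self-map of the finite set \<open>R\<close>, hence a permutation.\<close>

lemma transversal_sum_translate:
  assumes U: "subgroup U G" and K: "subgroup K G" and R: "transversal U K R"
    and \<psi>: "left_inv G U \<psi>" and k: "k \<in> K"
  shows "(\<Sum>r\<in>R. \<psi> (r \<otimes> k)) = (\<Sum>r\<in>R. \<psi> r)"
proof -
  have Kc: "K \<subseteq> carrier G" using K subgroup.subset by blast
  have RK: "R \<subseteq> K" and ex: "\<And>k. k \<in> K \<Longrightarrow> \<exists>!r. r \<in> R \<and> k \<in> U #> r" and fin: "finite R"
    using R by (simp_all add: transversal_def)
  define \<rho> where "\<rho> k = (THE r. r \<in> R \<and> k \<in> U #> r)" for k
  have \<rho>: "\<rho> k \<in> R" "k \<in> U #> \<rho> k" if "k \<in> K" for k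
    using theI'[OF ex[OF that]] by (auto simp: \<rho>_def)
  have \<rho>_eq: "\<rho> k = r" if "k \<in> K" "r \<in> R" "k \<in> U #> r" for k r
    using ex[OF that(1)] \<rho>[OF that(1)] that by blast
  have inj: "inj_on (\<lambda>r. \<rho> (r \<otimes> k)) R"
  proof (rule inj_onI)
    fix r r' assume r: "r \<in> R" "r' \<in> R" and eq: "\<rho> (r \<otimes> k) = \<rho> (r' \<otimes> k)"
    have rk: "r \<otimes> k \<in> K" "r' \<otimes> k \<in> K" using r RK k K by (auto intro: subgroup.m_closed)
    have c: "r \<in> carrier G" "r' \<in> carrier G" "k \<in> carrier G" using r RK k Kc by auto
    have "r \<otimes> k \<in> U #> (r' \<otimes> k)"
      using \<rho>(2)[OF rk(1)] \<rho>(2)[OF rk(2)] \<rho>(1)[OF rk(1)] eq RK Kc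
        r_coset_eq_iff[OF U] rk by (metis subsetD)
    then have "r \<in> U #> r'" using c
      by (auto simp: mem_r_coset_iff_inv[OF U] inv_mult_group m_assoc inv_cancel)
    then have "\<rho> r = r'" using r RK by (intro \<rho>_eq) auto
    moreover have "\<rho> r = r" using r RK c rcos_self[OF _ U] by (intro \<rho>_eq) auto
    ultimately show "r = r'" by simp
  qed
  have maps: "(\<lambda>r. \<rho> (r \<otimes> k)) ` R \<subseteq> R" using \<rho>(1) RK k K by (auto intro: subgroup.m_closed)
  then have im: "(\<lambda>r. \<rho> (r \<otimes> k)) ` R = R" using inj fin by (intro endo_inj_surj)
  have "(\<Sum>r\<in>R. \<psi> r) = (\<Sum>r\<in>R. \<psi> (\<rho> (r \<otimes> k)))"
    by (subst im[symmetric], subst sum.reindex[OF inj]) simp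
  also have "\<dots> = (\<Sum>r\<in>R. \<psi> (r \<otimes> k))"
  proof (rule sum.cong)
    fix r assume "r \<in> R"
    then have rk: "r \<otimes> k \<in> K" using RK k K by (auto intro: subgroup.m_closed)
    then obtain u where "u \<in> U" "r \<otimes> k = u \<otimes> \<rho> (r \<otimes> k)" using \<rho>(2) by (auto simp: mem_r_coset_iff)
    moreover have "\<rho> (r \<otimes> k) \<in> carrier G" using \<rho>(1)[OF rk] RK Kc by auto
    ultimately show "\<psi> (\<rho> (r \<otimes> k)) = \<psi> (r \<otimes> k)" using left_invD[OF \<psi>] by metis
  qed simp
  finally show ?thesis ..
qed

end

lemma disc_RD_D:
  assumes "disc_RD L K l s c" and "\<And>x. x \<in> carrier L \<Longrightarrow> 0 \<le> (f x::real)"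
    and "left_inv L K f" "right_inv L K f" "fin_supp_mod L K f"
    and "\<And>x. x \<in> carrier L \<Longrightarrow> 0 \<le> (\<xi> x::real)" and "left_inv L K \<xi>"
    and "csum L K (\<lambda>x. ennreal ((\<xi> x)\<^sup>2)) < \<infinity>"
  shows "csum L K (\<lambda>x. (csum L K (\<lambda>y. ennreal (f (x \<otimes>\<^bsub>L\<^esub> inv\<^bsub>L\<^esub> y) * \<xi> y)))\<^sup>2)
          \<le> ennreal (c\<^sup>2) * csum L K (\<lambda>x. ennreal ((f x)\<^sup>2 * (1 + l x) powr (2 * s)))
             * csum L K (\<lambda>x. ennreal ((\<xi> x)\<^sup>2))"
  using assms unfolding disc_RD_def by blast

context plain_group
begin

text \<open>Over \<open>U\<close>-cosets, convolution by \<open>g\<close> is a block matrix indexed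
  by \<open>K\<close>-cosets. Its block norms are the values of a \<open>K\<close>-bi-invariant
  function \<open>F\<close>, and the inequality for \<open>K\<close> applies to \<open>F\<close>.
  The factor \<open>card R\<close> pays for the second block index in the squared norm of
  \<open>F\<close>.\<close>

lemma disc_RD_refine:
  assumes RD: "disc_RD G K l s c" and K: "subgroup K G" and hecke: "hecke_fin G K"
    and U: "subgroup U G" "U \<subseteq> K" and R: "transversal U K R"
    and g0: "\<And>x. x \<in> carrier G \<Longrightarrow> 0 \<le> (g x::real)" and g: "left_inv G U g" "right_inv G U g"
    and supp: "fin_supp_mod G K g"
    and \<eta>0: "\<And>x. x \<in> carrier G \<Longrightarrow> 0 \<le> (\<eta> x::real)" and \<eta>: "left_inv G U \<eta>"
    and fin: "csum G U (\<lambda>x. ennreal ((\<eta> x)\<^sup>2)) < \<infinity>"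
  shows "csum G U (\<lambda>x. (csum G U (\<lambda>y. ennreal (g (x \<otimes> inv y) * \<eta> y)))\<^sup>2)
    \<le> ennreal (c\<^sup>2) * (of_nat (card R) * csum G U (\<lambda>x. ennreal ((g x)\<^sup>2 * (1 + l x) powr (2 * s))))
        * csum G U (\<lambda>x. ennreal ((\<eta> x)\<^sup>2))"
proof -
  have Kc: "K \<subseteq> carrier G" using K subgroup.subset by blast
  have RK: "R \<subseteq> K" and finR: "finite R" using R by (simp_all add: transversal_def)
  have Rc: "\<And>r. r \<in> R \<Longrightarrow> r \<in> carrier G" "\<And>r. r \<in> R \<Longrightarrow> inv r \<in> carrier G" using RK Kc by auto
  have Uc: "\<And>u. u \<in> U \<Longrightarrow> u \<in> carrier G" using U(2) Kc by blast
  have Kc': "\<And>k. k \<in> K \<Longrightarrow> k \<in> carrier G" using Kc by blast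
  have l: "alg_length G K l" using RD by (simp add: disc_RD_def)
  note linv = alg_length_inv[OF K l]
  \<comment> \<open>\<open>F z\<close> is the Hilbert-Schmidt norm of the block with entries
    \<open>g (j z inv i)\<close>, and \<open>E y\<close> is the Euclidean norm of the block of
    \<open>\<eta>\<close> at \<open>K y\<close>. Summing over a full transversal makes both
    invariant under \<open>K\<close>, although \<open>g\<close> and \<open>\<eta>\<close> are
    invariant only under \<open>U\<close>.\<close>
  define F where "F z = sqrt (\<Sum>j\<in>R. \<Sum>i\<in>R. (g (j \<otimes> z \<otimes> inv i))\<^sup>2)" for z
  define E where "E y = sqrt (\<Sum>i\<in>R. (\<eta> (i \<otimes> y))\<^sup>2)" for y
  have F0: "0 \<le> F z" and E0: "0 \<le> E z" for z by (simp_all add: F_def E_def sum_nonneg)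
  have Fl: "left_inv G K F"
    unfolding left_inv_def
  proof (intro ballI)
    fix k x assume k: "k \<in> K" and x: "x \<in> carrier G"
    have "(\<Sum>j\<in>R. (g (j \<otimes> (k \<otimes> x) \<otimes> inv i))\<^sup>2) = (\<Sum>j\<in>R. (g (j \<otimes> x \<otimes> inv i))\<^sup>2)" if i: "i \<in> R" for i
    proof -
      have "left_inv G U (\<lambda>y. (g (y \<otimes> x \<otimes> inv i))\<^sup>2)"
        using g(1) x Rc(2)[OF i] Uc by (auto simp: left_inv_def m_assoc)
      from transversal_sum_translate[OF U(1) K R this k] show ?thesis
        using x k Kc' Rc by (simp add: m_assoc)
    qed
    then show "F (k \<otimes> x) = F x"
      unfolding F_def by (subst (1 2) sum.swap) simp
  qed
  have Fr: "right_inv G K F"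
    unfolding right_inv_def
  proof (intro ballI)
    fix k x assume k: "k \<in> K" and x: "x \<in> carrier G"
    \<comment> \<open>Since \<open>x k inv i\<close> equals \<open>x inv (i inv k)\<close>, right
      translation of the argument acts on the index \<open>i\<close> through
      \<open>inv k\<close>.\<close>
    have k': "inv k \<in> K" using k K by (simp add: subgroup.m_inv_closed)
    have "(\<Sum>i\<in>R. (g (j \<otimes> (x \<otimes> k) \<otimes> inv i))\<^sup>2) = (\<Sum>i\<in>R. (g (j \<otimes> x \<otimes> inv i))\<^sup>2)" if j: "j \<in> R" for j
    proof -
      have "left_inv G U (\<lambda>y. (g (j \<otimes> x \<otimes> inv y))\<^sup>2)"
        unfolding left_inv_def
      proof (intro ballI)
        fix u y assume u: "u \<in> U" and y: "y \<in> carrier G"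
        have "inv u \<in> U" using u U by (simp add: subgroup.m_inv_closed)
        then have "g (j \<otimes> x \<otimes> inv y \<otimes> inv u) = g (j \<otimes> x \<otimes> inv y)"
          using g(2) y x Rc(1)[OF j] by (auto simp: right_inv_def)
        then show "(g (j \<otimes> x \<otimes> inv (u \<otimes> y)))\<^sup>2 = (g (j \<otimes> x \<otimes> inv y))\<^sup>2"
          using u Uc y x Rc(1)[OF j] by (simp add: inv_mult_group m_assoc)
      qed
      from transversal_sum_translate[OF U(1) K R this k'] show ?thesis
        using x k Kc' Rc j by (simp add: m_assoc inv_mult_group)
    qed
    then show "F (x \<otimes> k) = F x" unfolding F_def by simp
  qed
  have Fz: "g (j \<otimes> z \<otimes> inv i) = 0" if "F z = 0" "i \<in> R" "j \<in> R" for z i j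
  proof -
    have "(\<Sum>j\<in>R. \<Sum>i\<in>R. (g (j \<otimes> z \<otimes> inv i))\<^sup>2) = 0" using that by (simp add: F_def)
    then have "(\<Sum>i\<in>R. (g (j \<otimes> z \<otimes> inv i))\<^sup>2) = 0"
      using that finR by (subst (asm) sum_nonneg_eq_0_iff) (auto intro: sum_nonneg)
    then show ?thesis using that finR by (subst (asm) sum_nonneg_eq_0_iff) auto
  qed
  have Fsupp: "fin_supp_mod G K F"
  proof -
    obtain A where A: "finite A" "A \<subseteq> carrier G" "\<And>x. x \<in> carrier G \<Longrightarrow> g x \<noteq> 0 \<Longrightarrow> \<exists>a\<in>A. x \<in> K #> a"
      using supp by (auto simp: fin_supp_mod_def)
    let ?A = "(\<lambda>(a, i). a \<otimes> i) ` (A \<times> R)"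
    have "\<exists>b\<in>?A. z \<in> K #> b" if z: "z \<in> carrier G" "F z \<noteq> 0" for z
    proof -
      have "\<exists>j\<in>R. \<exists>i\<in>R. g (j \<otimes> z \<otimes> inv i) \<noteq> 0"
      proof (rule ccontr)
        assume "\<not> ?thesis"
        then have "F z = 0" by (simp add: F_def)
        then show False using z by simp
      qed
      then obtain j i where ij: "j \<in> R" "i \<in> R" "g (j \<otimes> z \<otimes> inv i) \<noteq> 0" by blast
      have "j \<otimes> z \<otimes> inv i \<in> carrier G" using ij Rc z by simp
      then obtain a where a: "a \<in> A" "j \<otimes> z \<otimes> inv i \<in> K #> a" using A(3) ij by blast
      then obtain k where k: "k \<in> K" "j \<otimes> z \<otimes> inv i = k \<otimes> a" by (auto simp: mem_r_coset_iff)
      have c: "k \<in> carrier G" "a \<in> carrier G" "i \<in> carrier G" "j \<in> carrier G"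
        using k a ij A(2) Rc Kc' by auto
      have "inv j \<otimes> (j \<otimes> z \<otimes> inv i) \<otimes> i = (inv j \<otimes> k) \<otimes> (a \<otimes> i)"
        using c by (simp add: k(2) m_assoc)
      moreover have "inv j \<otimes> (j \<otimes> z \<otimes> inv i) \<otimes> i = z" using c z by (simp add: m_assoc inv_cancel)
      moreover have "inv j \<otimes> k \<in> K" using k ij RK K by (auto intro: subgroup.m_closed subgroup.m_inv_closed)
      ultimately show ?thesis using a ij by (force simp: mem_r_coset_iff)
    qed
    moreover have "finite ?A" using A finR by auto
    moreover have "?A \<subseteq> carrier G" using A Rc by auto
    ultimately show ?thesis unfolding fin_supp_mod_def by blast
  qed
  have El: "left_inv G K E"
    unfolding left_inv_def
  proof (intro ballI)
    fix k x assume k: "k \<in> K" and x: "x \<in> carrier G"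
    have "left_inv G U (\<lambda>y. (\<eta> (y \<otimes> x))\<^sup>2)"
      using \<eta> x Uc by (auto simp: left_inv_def m_assoc)
    from transversal_sum_translate[OF U(1) K R this k] show "E (k \<otimes> x) = E x"
      using x k Kc' Rc by (simp add: E_def m_assoc)
  qed
  have EE: "csum G K (\<lambda>x. ennreal ((E x)\<^sup>2)) = csum G U (\<lambda>x. ennreal ((\<eta> x)\<^sup>2))"
  proof -
    have "left_inv G U (\<lambda>x. ennreal ((\<eta> x)\<^sup>2))" using \<eta> by (auto simp: left_inv_def)
    from csum_refine[OF U(1) K U(2) R this] show ?thesis
      by (simp add: E_def sum_nonneg sum_ennreal)
  qed
  \<comment> \<open>The sum over \<open>j\<close> refines \<open>K\<close>-cosets to
    \<open>U\<close>-cosets. For each of the \<open>card R\<close> values of \<open>i\<close>, what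
    remains is a right translate of the same sum. The weight passes through because \<open>l\<close>
    is \<open>K\<close>-bi-invariant.\<close>
  have FF: "csum G K (\<lambda>x. ennreal ((F x)\<^sup>2 * (1 + l x) powr (2 * s)))
     = of_nat (card R) * csum G U (\<lambda>x. ennreal ((g x)\<^sup>2 * (1 + l x) powr (2 * s)))"
  proof -
    let ?\<phi> = "\<lambda>x. ennreal ((g x)\<^sup>2 * (1 + l x) powr (2 * s))"
    have \<phi>: "left_inv G U ?\<phi>"
      using g(1) linv(1) U(2) by (auto simp: left_inv_def)
    have \<phi>i: "left_inv G U (\<lambda>x. ?\<phi> (x \<otimes> inv i))" if "i \<in> R" for i
      using \<phi> Rc(2)[OF that] Uc by (auto simp: left_inv_def m_assoc)
    have "csum G K (\<lambda>x. ennreal ((F x)\<^sup>2 * (1 + l x) powr (2 * s)))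
       = csum G K (\<lambda>x. \<Sum>i\<in>R. \<Sum>j\<in>R. ?\<phi> (j \<otimes> x \<otimes> inv i))"
    proof (rule csum_cong)
      fix x assume x: "x \<in> carrier G"
      have "l (j \<otimes> x \<otimes> inv i) = l x" if "i \<in> R" "j \<in> R" for i j
      proof -
        have "inv i \<in> K" using that RK K by (auto intro: subgroup.m_inv_closed)
        then show ?thesis
          using right_invD[OF linv(2), of "inv i" "j \<otimes> x"] left_invD[OF linv(1), of j x] that x Rc RK by auto
      qed
      then have "(\<Sum>i\<in>R. \<Sum>j\<in>R. ?\<phi> (j \<otimes> x \<otimes> inv i))
          = (\<Sum>i\<in>R. \<Sum>j\<in>R. ennreal ((g (j \<otimes> x \<otimes> inv i))\<^sup>2 * (1 + l x) powr (2 * s)))"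
        by simp
      also have "\<dots> = ennreal ((\<Sum>i\<in>R. \<Sum>j\<in>R. (g (j \<otimes> x \<otimes> inv i))\<^sup>2) * (1 + l x) powr (2 * s))"
        by (simp add: sum_distrib_right sum_ennreal sum_nonneg)
      also have "(\<Sum>i\<in>R. \<Sum>j\<in>R. (g (j \<otimes> x \<otimes> inv i))\<^sup>2) = (F x)\<^sup>2"
        unfolding F_def by (subst sum.swap) (simp add: sum_nonneg)
      finally show "ennreal ((F x)\<^sup>2 * (1 + l x) powr (2 * s)) = (\<Sum>i\<in>R. \<Sum>j\<in>R. ?\<phi> (j \<otimes> x \<otimes> inv i))" ..
    qed
    also have "\<dots> = (\<Sum>i\<in>R. csum G K (\<lambda>x. \<Sum>j\<in>R. ?\<phi> (j \<otimes> x \<otimes> inv i)))"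
      by (rule csum_sum)
    also have "\<dots> = (\<Sum>i\<in>R. csum G U (\<lambda>x. ?\<phi> (x \<otimes> inv i)))"
      using csum_refine[OF U(1) K U(2) R \<phi>i] by (intro sum.cong) auto
    also have "\<dots> = (\<Sum>i\<in>R. csum G U ?\<phi>)"
      using csum_translate[OF U(1) \<phi>] Rc(2) by (intro sum.cong) auto
    finally show ?thesis by simp
  qed
  define A where "A x = csum G U (\<lambda>y. ennreal (g (x \<otimes> inv y) * \<eta> y))" for x
  have A_eq: "A x = csum G K (\<lambda>y. \<Sum>i\<in>R. ennreal (g (x \<otimes> inv (i \<otimes> y)) * \<eta> (i \<otimes> y)))"
    if x: "x \<in> carrier G" for x
    unfolding A_def
  proof (rule csum_refine[OF U(1) K U(2) R])
    show "left_inv G U (\<lambda>y. ennreal (g (x \<otimes> inv y) * \<eta> y))"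
      unfolding left_inv_def
    proof (intro ballI)
      fix u y assume u: "u \<in> U" and y: "y \<in> carrier G"
      have "inv u \<in> U" using u U by (simp add: subgroup.m_inv_closed)
      then have "g (x \<otimes> inv y \<otimes> inv u) = g (x \<otimes> inv y)" using right_invD[OF g(2)] x y by simp
      then show "ennreal (g (x \<otimes> inv (u \<otimes> y)) * \<eta> (u \<otimes> y)) = ennreal (g (x \<otimes> inv y) * \<eta> y)"
        using left_invD[OF \<eta> u y] u Uc y x by (simp add: inv_mult_group m_assoc)
    qed
  qed
  have Al: "left_inv G U (\<lambda>x. (A x)\<^sup>2)"
    unfolding left_inv_def
  proof (intro ballI)
    fix u x assume u: "u \<in> U" and x: "x \<in> carrier G"
    have "g (u \<otimes> x \<otimes> inv y) = g (x \<otimes> inv y)" if "y \<in> carrier G" for y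
      using left_invD[OF g(1) u, of "x \<otimes> inv y"] u Uc x that by (simp add: m_assoc)
    then have "A (u \<otimes> x) = A x" unfolding A_def by (intro csum_cong) simp
    then show "(A (u \<otimes> x))\<^sup>2 = (A x)\<^sup>2" by simp
  qed
  have key: "(\<Sum>j\<in>R. (A (j \<otimes> x))\<^sup>2) \<le> (csum G K (\<lambda>y. ennreal (F (x \<otimes> inv y) * E y)))\<^sup>2"
    if x: "x \<in> carrier G" for x
  proof -
    \<comment> \<open>Only finitely many blocks of the row at \<open>x\<close> are nonzero, so the
      estimate reduces to a finite sum of real numbers, as the block bound requires.\<close>
    define S where "S = {C \<in> rcosets K. F (x \<otimes> inv (coset_rep G K C)) \<noteq> 0}"
    have S: "finite S" "S \<subseteq> rcosets K"
      unfolding S_def using fin_supp_mod_finite[OF K fin_supp_mod_convolution[OF K hecke Fsupp x]] by auto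
    let ?y = "coset_rep G K"
    have y: "?y C \<in> carrier G" if "C \<in> rcosets K" for C using coset_rep that by auto
    define gg where "gg j i C = g (j \<otimes> (x \<otimes> inv (?y C)) \<otimes> inv i)" for j i C
    have gg_eq: "g (j \<otimes> x \<otimes> inv (i \<otimes> ?y C)) = gg j i C" if "i \<in> R" "j \<in> R" "C \<in> rcosets K" for i j C
      using that y[OF that(3)] Rc x by (simp add: gg_def inv_mult_group m_assoc)
    have gg0: "0 \<le> gg j i C" "0 \<le> \<eta> (i \<otimes> ?y C)" if "i \<in> R" "j \<in> R" "C \<in> rcosets K" for i j C
      unfolding gg_def using that y[OF that(3)] Rc x by (auto intro!: g0 \<eta>0)
    have A_sum: "A (j \<otimes> x) = ennreal (\<Sum>C\<in>S. \<Sum>i\<in>R. gg j i C * \<eta> (i \<otimes> ?y C))" if j: "j \<in> R" for j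
    proof -
      have "A (j \<otimes> x) = (\<Sum>C\<in>S. \<Sum>i\<in>R. ennreal (g (j \<otimes> x \<otimes> inv (i \<otimes> ?y C)) * \<eta> (i \<otimes> ?y C)))"
      proof (subst A_eq)
        show "csum G K (\<lambda>y. \<Sum>i\<in>R. ennreal (g (j \<otimes> x \<otimes> inv (i \<otimes> y)) * \<eta> (i \<otimes> y)))
           = (\<Sum>C\<in>S. \<Sum>i\<in>R. ennreal (g (j \<otimes> x \<otimes> inv (i \<otimes> ?y C)) * \<eta> (i \<otimes> ?y C)))"
        proof (rule csum_eq_sum[OF S])
          fix D assume D: "D \<in> rcosets K - S"
          then have "gg j i D = 0" if "i \<in> R" for i
            unfolding gg_def using that j by (intro Fz) (auto simp: S_def)
          then show "(\<Sum>i\<in>R. ennreal (g (j \<otimes> x \<otimes> inv (i \<otimes> ?y D)) * \<eta> (i \<otimes> ?y D))) = 0"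
            using gg_eq j D by (intro sum.neutral) auto
        qed
      qed (use x j Rc in auto)
      also have "\<dots> = (\<Sum>C\<in>S. \<Sum>i\<in>R. ennreal (gg j i C * \<eta> (i \<otimes> ?y C)))"
        using gg_eq j S by (intro sum.cong) (auto dest!: subsetD)
      also have "\<dots> = ennreal (\<Sum>C\<in>S. \<Sum>i\<in>R. gg j i C * \<eta> (i \<otimes> ?y C))"
      proof -
        have "(\<Sum>i\<in>R. ennreal (gg j i C * \<eta> (i \<otimes> ?y C))) = ennreal (\<Sum>i\<in>R. gg j i C * \<eta> (i \<otimes> ?y C))
          \<and> 0 \<le> (\<Sum>i\<in>R. gg j i C * \<eta> (i \<otimes> ?y C))" if "C \<in> S" for C
          using gg0 that j S by (auto intro!: sum_ennreal sum_nonneg mult_nonneg_nonneg dest!: subsetD)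
        then show ?thesis by (simp add: sum_ennreal)
      qed
      finally show ?thesis .
    qed
    have pos: "0 \<le> (\<Sum>C\<in>S. \<Sum>i\<in>R. gg j i C * \<eta> (i \<otimes> ?y C))" if "j \<in> R" for j
      using gg0 that S by (auto intro!: sum_nonneg mult_nonneg_nonneg dest!: subsetD)
    have "(\<Sum>j\<in>R. (A (j \<otimes> x))\<^sup>2) = ennreal (\<Sum>j\<in>R. (\<Sum>C\<in>S. \<Sum>i\<in>R. gg j i C * \<eta> (i \<otimes> ?y C))\<^sup>2)"
      using pos by (simp add: A_sum ennreal_power sum_ennreal)
    also have "\<dots> \<le> ennreal ((\<Sum>C\<in>S. sqrt (\<Sum>j\<in>R. \<Sum>i\<in>R. (gg j i C)\<^sup>2) * sqrt (\<Sum>i\<in>R. (\<eta> (i \<otimes> ?y C))\<^sup>2))\<^sup>2)"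
      by (intro ennreal_leI hilbert_schmidt_block_bound S finR)
    also have "(\<Sum>C\<in>S. sqrt (\<Sum>j\<in>R. \<Sum>i\<in>R. (gg j i C)\<^sup>2) * sqrt (\<Sum>i\<in>R. (\<eta> (i \<otimes> ?y C))\<^sup>2))
        = (\<Sum>C\<in>S. F (x \<otimes> inv (?y C)) * E (?y C))"
      by (simp add: F_def E_def gg_def)
    also have "ennreal ((\<Sum>C\<in>S. F (x \<otimes> inv (?y C)) * E (?y C))\<^sup>2)
       = (\<Sum>C\<in>S. ennreal (F (x \<otimes> inv (?y C)) * E (?y C)))\<^sup>2"
      using F0 E0 by (simp add: ennreal_power sum_nonneg sum_ennreal)
    also have "(\<Sum>C\<in>S. ennreal (F (x \<otimes> inv (?y C)) * E (?y C))) = csum G K (\<lambda>y. ennreal (F (x \<otimes> inv y) * E y))"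
      by (rule csum_eq_sum[OF S, symmetric]) (auto simp: S_def)
    finally show ?thesis .
  qed
  have "csum G U (\<lambda>x. (A x)\<^sup>2) = csum G K (\<lambda>x. \<Sum>j\<in>R. (A (j \<otimes> x))\<^sup>2)"
    by (rule csum_refine[OF U(1) K U(2) R Al])
  also have "\<dots> \<le> csum G K (\<lambda>x. (csum G K (\<lambda>y. ennreal (F (x \<otimes> inv y) * E y)))\<^sup>2)"
    by (intro csum_mono key)
  also have "\<dots> \<le> ennreal (c\<^sup>2) * csum G K (\<lambda>x. ennreal ((F x)\<^sup>2 * (1 + l x) powr (2 * s)))
             * csum G K (\<lambda>x. ennreal ((E x)\<^sup>2))"
    using fin EE by (intro disc_RD_D[OF RD F0 Fl Fr Fsupp E0 El]) simp
  finally show ?thesis unfolding A_def EE FF .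
qed

end

section \<open>Open subgroups: property (RD) of a pair with counting measure\<close>

lemma openin_quot_top:
  "openin (quot_top L T K) U \<longleftrightarrow> U \<subseteq> rcosets\<^bsub>L\<^esub> K \<and> openin T {x \<in> carrier L. K #>\<^bsub>L\<^esub> x \<in> U}"
  unfolding quot_top_def by (subst topology_inverse'[OF istopology_quot_top]) simp

context plain_group
begin

lemma openin_left_inv:
  assumes K: "subgroup K G" and op: "\<And>x. x \<in> carrier G \<Longrightarrow> openin T (K #> x)"
    and A: "A \<subseteq> carrier G" "\<And>k x. k \<in> K \<Longrightarrow> x \<in> A \<Longrightarrow> k \<otimes> x \<in> A"
  shows "openin T A"
proof -
  have "A = (\<Union>x\<in>A. K #> x)"
  proof (intro equalityI subsetI)
    fix x assume "x \<in> A"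
    moreover from this have "x \<in> K #> x" using A(1) by (intro rcos_self[OF _ K]) auto
    ultimately show "x \<in> (\<Union>x\<in>A. K #> x)" by blast
  next
    fix y assume "y \<in> (\<Union>x\<in>A. K #> x)"
    then obtain x k where "x \<in> A" "k \<in> K" "y = k \<otimes> x" unfolding r_coset_def by blast
    then show "y \<in> A" using A(2) by simp
  qed
  also have "openin T \<dots>" using A(1) op by (intro openin_clauses(3)) auto
  finally show ?thesis .
qed

text \<open>Every union of open cosets is open. On such a quotient continuity is automatic and
  compact means finite.\<close>

lemma quot_top_discrete:
  assumes K: "subgroup K G" and op: "\<And>x. x \<in> carrier G \<Longrightarrow> openin T (K #> x)"
  shows "quot_top G T K = discrete_topology (rcosets K)"
proof -
  have Kc: "K \<subseteq> carrier G" using K subgroup.subset by blast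
  have "openin T {x \<in> carrier G. K #> x \<in> U}" for U
  proof (rule openin_left_inv[OF K op])
    fix k x assume k: "k \<in> K" and x: "x \<in> {x \<in> carrier G. K #> x \<in> U}"
    then have "k \<in> carrier G" using Kc by auto
    moreover from this have "K #> (k \<otimes> x) = K #> x"
      using r_coset_eq_iff[OF K, of "k \<otimes> x" x] k x by (auto simp: mem_r_coset_iff)
    ultimately show "k \<otimes> x \<in> {x \<in> carrier G. K #> x \<in> U}" using x by auto
  qed auto
  then show ?thesis by (auto simp: topology_eq openin_quot_top)
qed

text \<open>Every preimage is a union of open cosets, so it is open and in particular Borel,
  whatever the sigma-algebra of \<open>N\<close>.\<close>

lemma borel_of_left_inv:
  assumes K: "subgroup K G" and op: "\<And>x. x \<in> carrier G \<Longrightarrow> openin T (K #> x)"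
    and top: "topspace T = carrier G" and \<phi>: "left_inv G K \<phi>" and N: "space N = UNIV"
  shows "\<phi> \<in> measurable (borel_of T) N"
proof (rule measurableI)
  fix A
  have sp: "space (borel_of T) = carrier G" by (simp add: borel_of_def top space_measure_of_conv)
  have "openin T (\<phi> -` A \<inter> carrier G)"
    using \<phi> subgroup.mem_carrier[OF K] by (intro openin_left_inv[OF K op]) (auto simp: left_inv_def)
  then have "\<phi> -` A \<inter> carrier G \<in> sigma_sets (topspace T) {U. openin T U}" by (intro sigma_sets.Basic) simp
  moreover have "{U. openin T U} \<subseteq> Pow (topspace T)" using openin_subset by auto
  ultimately show "\<phi> -` A \<inter> space (borel_of T) \<in> sets (borel_of T)"
    by (simp add: borel_of_def sp[unfolded borel_of_def])
qed (use N in auto)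

lemma integrable_count_space_finite_support:
  fixes f :: "'c \<Rightarrow> real"
  assumes "finite S" "\<And>x. x \<in> A - S \<Longrightarrow> f x = 0"
  shows "integrable (count_space A) f"
proof (rule integrableI_bounded)
  have "(\<integral>\<^sup>+x. ennreal (norm (f x)) \<partial>count_space A) = (\<Sum>x\<in>S \<inter> A. ennreal (norm (f x)))"
    using assms by (intro nn_integral_count_space') auto
  then show "(\<integral>\<^sup>+x. ennreal (norm (f x)) \<partial>count_space A) < \<infinity>" by (simp add: sum_ennreal)
qed simp

text \<open>For non-negative data taking the modulus loses nothing: the Bochner integral defining
  the convolution is exactly the corresponding \<open>csum\<close>.\<close>

lemma pair_RD_imp_disc_RD:
  assumes K: "subgroup K G" and op: "\<And>x. x \<in> carrier G \<Longrightarrow> openin T (K #> x)"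
    and hecke: "hecke_fin G K" and RD: "pair_RD G T K (count_space (rcosets K))"
  shows "\<exists>l s c. disc_RD G K l s c"
proof -
  from RD obtain l s c where l: "length_function G T K l" and sc: "0 < s" "0 < c"
    and bound: "\<And>f \<xi>. hecke_fun G T K f \<Longrightarrow> l2sq (count_space (rcosets K)) \<xi> < \<infinity> \<Longrightarrow>
       l2sq (count_space (rcosets K)) (hecke_conv G K (count_space (rcosets K)) f \<xi>)
       \<le> ennreal (c\<^sup>2) * rd_weight_sq G K (count_space (rcosets K)) l s f * l2sq (count_space (rcosets K)) \<xi>"
    unfolding pair_RD_def by auto
  let ?N = "count_space (rcosets K)" and ?r = "coset_rep G K"
  have qd: "quot_top G T K = discrete_topology (rcosets K)" using K op by (rule quot_top_discrete)
  have "disc_RD G K l s c"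
    unfolding disc_RD_def
  proof (intro conjI allI impI)
    show "alg_length G K l" using l by (simp add: length_function_def alg_length_def)
    fix f \<xi> :: "'a \<Rightarrow> real"
    assume f0: "\<forall>x\<in>carrier G. 0 \<le> f x" and f: "left_inv G K f" "right_inv G K f"
      and supp: "fin_supp_mod G K f" and \<xi>0: "\<forall>x\<in>carrier G. 0 \<le> \<xi> x" and \<xi>: "left_inv G K \<xi>"
      and fin: "csum G K (\<lambda>x. ennreal ((\<xi> x)\<^sup>2)) < \<infinity>"
    define f' where "f' C = complex_of_real (f (?r C))" for C
    define \<xi>' where "\<xi>' C = complex_of_real (\<xi> (?r C))" for C
    have f'_eq: "f' (K #> x) = complex_of_real (f x)" if "x \<in> carrier G" for x
      using left_inv_rep[OF K f(1) that] by (simp add: f'_def)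
    have hf: "hecke_fun G T K f'"
      unfolding hecke_fun_def qd
    proof (intro conjI ballI)
      show "\<exists>C. compactin (discrete_topology (rcosets K)) C \<and> (\<forall>D\<in>rcosets K - C. f' D = 0)"
        using fin_supp_mod_finite[OF K supp]
        by (intro exI[of _ "{D \<in> rcosets K. f (?r D) \<noteq> 0}"]) (auto simp: compactin_discrete_topology f'_def)
      show "f' (K #> (x \<otimes> h)) = f' (K #> x)" if "x \<in> carrier G" "h \<in> K" for x h
        using that f(2) subgroup.mem_carrier[OF K] by (simp add: f'_eq right_inv_def)
    qed simp
    have l2: "l2sq ?N \<xi>' = csum G K (\<lambda>x. ennreal ((\<xi> x)\<^sup>2))"
      by (simp add: l2sq_def csum_def \<xi>'_def)
    have w: "rd_weight_sq G K ?N l s f' = csum G K (\<lambda>x. ennreal ((f x)\<^sup>2 * (1 + l x) powr (2 * s)))"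
      by (simp add: rd_weight_sq_def csum_def f'_def)
    have conv: "ennreal ((cmod (hecke_conv G K ?N f' \<xi>' D))\<^sup>2)
        = (csum G K (\<lambda>y. ennreal (f (?r D \<otimes> inv y) * \<xi> y)))\<^sup>2" if D: "D \<in> rcosets K" for D
    proof -
      have rD: "?r D \<in> carrier G" using D coset_rep by auto
      let ?a = "\<lambda>C. f (?r D \<otimes> inv (?r C)) * \<xi> (?r C)"
      have a0: "0 \<le> ?a C" if "C \<in> rcosets K" for C using coset_rep(1)[OF that] rD f0 \<xi>0 by simp
      \<comment> \<open>Finite support gives integrability. Without it the Bochner integral would
        take its default value 0, and its modulus could be smaller than the sum.\<close>
      let ?S = "{C \<in> rcosets K. f (?r D \<otimes> inv (?r C)) \<noteq> 0}"
      have "finite ?S" using fin_supp_mod_finite[OF K fin_supp_mod_convolution[OF K hecke supp rD]] .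
      then have int: "integrable ?N ?a"
        by (rule integrable_count_space_finite_support) auto
      have "hecke_conv G K ?N f' \<xi>' D = (LINT C|?N. complex_of_real (?a C))"
        unfolding hecke_conv_def using rD coset_rep(1)
        by (intro Bochner_Integration.integral_cong) (auto simp: f'_eq \<xi>'_def)
      also have "\<dots> = complex_of_real (LINT C|?N. ?a C)" by (rule integral_complex_of_real)
      finally have "cmod (hecke_conv G K ?N f' \<xi>' D) = (LINT C|?N. ?a C)"
        using a0 by (simp add: integral_nonneg_AE AE_count_space)
      then have "ennreal (cmod (hecke_conv G K ?N f' \<xi>' D)) = csum G K (\<lambda>y. ennreal (f (?r D \<otimes> inv y) * \<xi> y))"
        unfolding csum_def using nn_integral_eq_integral[OF int] a0 by (simp add: AE_count_space)
      then show ?thesis by (metis ennreal_power norm_ge_zero)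
    qed
    have "l2sq ?N (hecke_conv G K ?N f' \<xi>')
       = csum G K (\<lambda>x. (csum G K (\<lambda>y. ennreal (f (x \<otimes> inv y) * \<xi> y)))\<^sup>2)"
      unfolding l2sq_def by (subst csum_def) (intro nn_integral_cong, simp add: conv)
    then show "csum G K (\<lambda>x. (csum G K (\<lambda>y. ennreal (f (x \<otimes> inv y) * \<xi> y)))\<^sup>2)
       \<le> ennreal (c\<^sup>2) * csum G K (\<lambda>x. ennreal ((f x)\<^sup>2 * (1 + l x) powr (2 * s)))
             * csum G K (\<lambda>x. ennreal ((\<xi> x)\<^sup>2))"
      using bound[OF hf, of \<xi>'] fin by (simp add: l2 w)
  qed (fact sc)+
  then show ?thesis by blast
qed

text \<open>Holds also for a non-integrable \<open>f\<close>, because the left-hand side is then 0.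
  Upper bounds therefore need no integrability check.\<close>

lemma ennreal_norm_integral_le:
  fixes f :: "'c \<Rightarrow> 'd::{banach, second_countable_topology}"
  shows "ennreal (norm (integral\<^sup>L M f)) \<le> (\<integral>\<^sup>+x. ennreal (norm (f x)) \<partial>M)"
proof (cases "integrable M f")
  case False then show ?thesis by (simp add: not_integrable_integral_eq)
qed (rule integral_norm_bound_ennreal)

text \<open>Replacing \<open>f\<close> and \<open>\<xi>\<close> by their moduli does not change the
  two norms on the right and can only increase the convolution.\<close>

lemma disc_RD_imp_pair_RD:
  assumes K: "subgroup K G" and op: "\<And>x. x \<in> carrier G \<Longrightarrow> openin T (K #> x)"
    and top: "topspace T = carrier G" and RD: "disc_RD G K l s c"
  shows "pair_RD G T K (count_space (rcosets K))"
proof -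
  let ?N = "count_space (rcosets K)" and ?r = "coset_rep G K"
  have qd: "quot_top G T K = discrete_topology (rcosets K)" using K op by (rule quot_top_discrete)
  have l: "alg_length G K l" and sc: "0 < s" "0 < c" using RD by (auto simp: disc_RD_def)
  note linv = alg_length_inv[OF K l]
  have "length_function G T K l"
    using l borel_of_left_inv[OF K op top linv(1), of borel] by (simp add: length_function_def alg_length_def)
  moreover have "locally_bounded G T K l"
    unfolding locally_bounded_def qd compactin_discrete_topology
  proof (intro allI impI)
    fix C assume C: "C \<subseteq> rcosets K \<and> finite C"
    have "l x \<le> Max ((\<lambda>D. l (?r D)) ` C)" if "x \<in> carrier G" "K #> x \<in> C" for x
      using C that left_inv_rep[OF K linv(1) that(1)] by (intro Max_ge) (auto intro!: image_eqI[of _ _ "K #> x"])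
    then show "\<exists>B. \<forall>x\<in>carrier G. K #> x \<in> C \<longrightarrow> l x \<le> B" by blast
  qed
  moreover have "l2sq ?N (hecke_conv G K ?N f \<xi>) \<le> ennreal (c\<^sup>2) * rd_weight_sq G K ?N l s f * l2sq ?N \<xi>"
    if hf: "hecke_fun G T K f" and fin: "l2sq ?N \<xi> < \<infinity>" for f \<xi>
  proof -
    define f' where "f' x = cmod (f (K #> x))" for x
    define \<xi>' where "\<xi>' x = cmod (\<xi> (K #> x))" for x
    have coset: "K #> (k \<otimes> x) = K #> x" if "k \<in> K" "x \<in> carrier G" for k x
      using r_coset_eq_iff[OF K, of "k \<otimes> x" x] that subgroup.mem_carrier[OF K] by (auto simp: mem_r_coset_iff)
    have inv: "left_inv G K f'" "left_inv G K \<xi>'" "right_inv G K f'"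
      using coset hf by (auto simp: left_inv_def right_inv_def f'_def \<xi>'_def hecke_fun_def)
    have supp: "fin_supp_mod G K f'"
    proof -
      obtain C where C: "C \<subseteq> rcosets K" "finite C" "\<And>D. D \<in> rcosets K - C \<Longrightarrow> f D = 0"
        using hf unfolding hecke_fun_def qd compactin_discrete_topology by auto
      have "\<exists>a\<in>?r ` C. x \<in> K #> a" if x: "x \<in> carrier G" "f' x \<noteq> 0" for x
      proof -
        have "K #> x \<in> C" using C(3)[of "K #> x"] x rcosets_memI[OF x(1)] by (auto simp: f'_def)
        moreover have "x \<in> K #> ?r (K #> x)"
          using coset_rep(2)[OF rcosets_memI[OF x(1)], of K] rcos_self[OF x(1) K] by simp
        ultimately show ?thesis by blast
      qed
      moreover have "?r ` C \<subseteq> carrier G" using C(1) coset_rep(1) by auto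
      ultimately show ?thesis unfolding fin_supp_mod_def using C(2) by blast
    qed
    have r: "K #> ?r D = D" "?r D \<in> carrier G" if "D \<in> rcosets K" for D using coset_rep that by auto
    have l2: "l2sq ?N \<xi> = csum G K (\<lambda>x. ennreal ((\<xi>' x)\<^sup>2))"
      unfolding l2sq_def csum_def by (intro nn_integral_cong) (simp add: \<xi>'_def r)
    have w: "rd_weight_sq G K ?N l s f = csum G K (\<lambda>x. ennreal ((f' x)\<^sup>2 * (1 + l x) powr (2 * s)))"
      unfolding rd_weight_sq_def csum_def by (intro nn_integral_cong) (simp add: f'_def r)
    have "l2sq ?N (hecke_conv G K ?N f \<xi>)
      \<le> csum G K (\<lambda>x. (csum G K (\<lambda>y. ennreal (f' (x \<otimes> inv y) * \<xi>' y)))\<^sup>2)"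
      unfolding l2sq_def
    proof (subst csum_def, rule nn_integral_mono)
      fix D assume "D \<in> space ?N"
      have "ennreal (cmod (hecke_conv G K ?N f \<xi> D))
        \<le> (\<integral>\<^sup>+C. ennreal (cmod (f (K #> (?r D \<otimes> inv (?r C))) * \<xi> C)) \<partial>?N)"
        unfolding hecke_conv_def by (rule ennreal_norm_integral_le)
      also have "\<dots> = csum G K (\<lambda>y. ennreal (f' (?r D \<otimes> inv y) * \<xi>' y))"
        unfolding csum_def by (intro nn_integral_cong) (simp add: f'_def \<xi>'_def r norm_mult)
      finally show "ennreal ((cmod (hecke_conv G K ?N f \<xi> D))\<^sup>2)
         \<le> (csum G K (\<lambda>y. ennreal (f' (?r D \<otimes> inv y) * \<xi>' y)))\<^sup>2"
        by (simp add: power_mono flip: ennreal_power)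
    qed
    also have "\<dots> \<le> ennreal (c\<^sup>2) * rd_weight_sq G K ?N l s f * l2sq ?N \<xi>"
      unfolding l2 w using fin l2
      by (intro disc_RD_D[OF RD _ inv(1,3) supp _ inv(2)]) (auto simp: f'_def \<xi>'_def)
    finally show ?thesis .
  qed
  ultimately show ?thesis using sc unfolding pair_RD_def by blast
qed

end

section \<open>Transfer along dense homomorphisms\<close>

text \<open>What the transfer needs from the embedding into the completion. \<open>preimage\<close>
  and \<open>dense\<close> identify the right cosets of \<open>H\<close> with those of
  \<open>K\<close>. \<open>dense_sub\<close> says that moving a coset \<open>K (\<sigma> x)\<close>
  by \<open>K\<close> on the right reaches only cosets of elements \<open>\<sigma> (x h)\<close>;
  this carries right invariance across.\<close>

locale hecke_hom = G: plain_group G + L: plain_group L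
  for G :: "'a monoid" (structure) and L :: "'b monoid" (structure) +
  fixes H :: "'a set" and K :: "'b set" and \<sigma> :: "'a \<Rightarrow> 'b"
  assumes H: "subgroup H G" and K: "subgroup K L" and hom: "\<sigma> \<in> hom G L"
    and preimage: "\<And>x. x \<in> carrier G \<Longrightarrow> \<sigma> x \<in> K \<longleftrightarrow> x \<in> H"
    and dense: "\<And>y. y \<in> carrier L \<Longrightarrow> \<exists>x\<in>carrier G. y \<in> K #>\<^bsub>L\<^esub> \<sigma> x"
    and dense_sub: "\<And>x k. x \<in> carrier G \<Longrightarrow> k \<in> K \<Longrightarrow> \<exists>h\<in>H. \<sigma> x \<otimes>\<^bsub>L\<^esub> k \<in> K #>\<^bsub>L\<^esub> \<sigma> (x \<otimes>\<^bsub>G\<^esub> h)"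
begin

lemma \<sigma>_closed [simp]: "x \<in> carrier G \<Longrightarrow> \<sigma> x \<in> carrier L"
  using hom by (auto simp: hom_def)

lemma \<sigma>_mult [simp]: "x \<in> carrier G \<Longrightarrow> y \<in> carrier G \<Longrightarrow> \<sigma> (x \<otimes>\<^bsub>G\<^esub> y) = \<sigma> x \<otimes>\<^bsub>L\<^esub> \<sigma> y"
  using hom by (auto simp: hom_def)

lemma \<sigma>_inv [simp]: "x \<in> carrier G \<Longrightarrow> \<sigma> (inv\<^bsub>G\<^esub> x) = inv\<^bsub>L\<^esub> \<sigma> x"
  using group_hom.hom_inv[of G L \<sigma>] hom G.is_group L.is_group
  by (simp add: group_hom_def group_hom_axioms_def)

lemma \<sigma>_one [simp]: "\<sigma> \<one>\<^bsub>G\<^esub> = \<one>\<^bsub>L\<^esub>"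
  using group_hom.hom_one[of G L \<sigma>] hom G.is_group L.is_group
  by (simp add: group_hom_def group_hom_axioms_def)

lemma coset_eq_iff:
  assumes "x \<in> carrier G" "y \<in> carrier G"
  shows "\<sigma> x \<in> K #>\<^bsub>L\<^esub> \<sigma> y \<longleftrightarrow> x \<in> H #>\<^bsub>G\<^esub> y"
  using assms preimage[of "x \<otimes>\<^bsub>G\<^esub> inv\<^bsub>G\<^esub> y"]
  by (simp add: L.mem_r_coset_iff_inv[OF K] G.mem_r_coset_iff_inv[OF H])

text \<open>The coset map is injective by \<open>preimage\<close> and surjective by
  \<open>dense\<close>.\<close>

lemma csum_transfer:
  assumes \<phi>: "left_inv L K \<phi>"
  shows "csum G H (\<lambda>x. \<phi> (\<sigma> x)) = csum L K \<phi>"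
proof -
  let ?j = "\<lambda>D. K #>\<^bsub>L\<^esub> \<sigma> (coset_rep G H D)"
  have bij: "bij_betw ?j (rcosets\<^bsub>G\<^esub> H) (rcosets\<^bsub>L\<^esub> K)"
    unfolding bij_betw_def
  proof
    show "inj_on ?j (rcosets\<^bsub>G\<^esub> H)"
    proof (rule inj_onI)
      fix D D' assume D: "D \<in> rcosets\<^bsub>G\<^esub> H" "D' \<in> rcosets\<^bsub>G\<^esub> H" "?j D = ?j D'"
      note r = G.coset_rep[OF D(1)] G.coset_rep[OF D(2)]
      have "coset_rep G H D \<in> H #>\<^bsub>G\<^esub> coset_rep G H D'"
        using D(3) r(1,3) coset_eq_iff[OF r(1,3)] L.r_coset_eq_iff[OF K] \<sigma>_closed by blast
      then show "D = D'" using r G.r_coset_eq_iff[OF H r(1,3)] by simp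
    qed
    show "?j ` (rcosets\<^bsub>G\<^esub> H) = rcosets\<^bsub>L\<^esub> K"
    proof safe
      fix D assume "D \<in> rcosets\<^bsub>G\<^esub> H"
      then show "?j D \<in> rcosets\<^bsub>L\<^esub> K" using G.coset_rep(1) by (simp add: L.rcosets_memI)
    next
      fix C assume "C \<in> rcosets\<^bsub>L\<^esub> K"
      then obtain y where y: "y \<in> carrier L" "C = K #>\<^bsub>L\<^esub> y" by (rule L.rcosetE)
      then obtain x where x: "x \<in> carrier G" "y \<in> K #>\<^bsub>L\<^esub> \<sigma> x" using dense by blast
      note r = G.coset_rep[OF G.rcosets_memI[OF x(1)], of H]
      have "\<sigma> x \<in> K #>\<^bsub>L\<^esub> \<sigma> (coset_rep G H (H #>\<^bsub>G\<^esub> x))"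
        using r x G.rcos_self[OF x(1) H] by (simp add: coset_eq_iff)
      then have "?j (H #>\<^bsub>G\<^esub> x) = C"
        using x y r(1) L.r_coset_eq_iff[OF K] by (metis \<sigma>_closed)
      then show "C \<in> ?j ` (rcosets\<^bsub>G\<^esub> H)" using G.rcosets_memI[OF x(1)] by blast
    qed
  qed
  have "csum L K \<phi> = (\<integral>\<^sup>+D. \<phi> (coset_rep L K (?j D)) \<partial>count_space (rcosets\<^bsub>G\<^esub> H))"
    unfolding csum_def by (rule nn_integral_bij_count_space[OF bij, symmetric])
  also have "\<dots> = csum G H (\<lambda>x. \<phi> (\<sigma> x))"
    unfolding csum_def using G.coset_rep(1) by (intro nn_integral_cong) (simp add: L.left_inv_rep[OF K \<phi>])
  finally show ?thesis ..
qed

lemma csum_conv_transfer: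
  fixes f \<xi> :: "'b \<Rightarrow> real"
  assumes f: "left_inv L K f" "right_inv L K f" and \<xi>: "left_inv L K \<xi>"
  shows "csum L K (\<lambda>x. (csum L K (\<lambda>y. ennreal (f (x \<otimes>\<^bsub>L\<^esub> inv\<^bsub>L\<^esub> y) * \<xi> y)))\<^sup>2)
    = csum G H (\<lambda>x. (csum G H (\<lambda>y. ennreal (f (\<sigma> (x \<otimes>\<^bsub>G\<^esub> inv\<^bsub>G\<^esub> y)) * \<xi> (\<sigma> y))))\<^sup>2)"
proof -
  have Kc: "\<And>k. k \<in> K \<Longrightarrow> k \<in> carrier L" using subgroup.mem_carrier[OF K] .
  have y: "left_inv L K (\<lambda>y. ennreal (f (x \<otimes>\<^bsub>L\<^esub> inv\<^bsub>L\<^esub> y) * \<xi> y))" if x: "x \<in> carrier L" for x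
    unfolding left_inv_def
  proof (intro ballI)
    fix k y assume k: "k \<in> K" and y: "y \<in> carrier L"
    have "inv\<^bsub>L\<^esub> k \<in> K" using k K by (simp add: subgroup.m_inv_closed)
    then have "f (x \<otimes>\<^bsub>L\<^esub> inv\<^bsub>L\<^esub> y \<otimes>\<^bsub>L\<^esub> inv\<^bsub>L\<^esub> k) = f (x \<otimes>\<^bsub>L\<^esub> inv\<^bsub>L\<^esub> y)"
      using right_invD[OF f(2)] x y by simp
    then show "ennreal (f (x \<otimes>\<^bsub>L\<^esub> inv\<^bsub>L\<^esub> (k \<otimes>\<^bsub>L\<^esub> y)) * \<xi> (k \<otimes>\<^bsub>L\<^esub> y)) = ennreal (f (x \<otimes>\<^bsub>L\<^esub> inv\<^bsub>L\<^esub> y) * \<xi> y)"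
      using left_invD[OF \<xi> k y] k Kc y x by (simp add: L.inv_mult_group L.m_assoc)
  qed
  have x: "left_inv L K (\<lambda>x. (csum L K (\<lambda>y. ennreal (f (x \<otimes>\<^bsub>L\<^esub> inv\<^bsub>L\<^esub> y) * \<xi> y)))\<^sup>2)"
    unfolding left_inv_def
  proof (intro ballI arg_cong[where f="\<lambda>a. a\<^sup>2"] L.csum_cong)
    fix k x y assume "k \<in> K" "x \<in> carrier L" "y \<in> carrier L"
    then show "ennreal (f (k \<otimes>\<^bsub>L\<^esub> x \<otimes>\<^bsub>L\<^esub> inv\<^bsub>L\<^esub> y) * \<xi> y) = ennreal (f (x \<otimes>\<^bsub>L\<^esub> inv\<^bsub>L\<^esub> y) * \<xi> y)"
      using left_invD[OF f(1), of k "x \<otimes>\<^bsub>L\<^esub> inv\<^bsub>L\<^esub> y"] Kc by (simp add: L.m_assoc)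
  qed
  show ?thesis
  proof (subst csum_transfer[OF x, symmetric], intro G.csum_cong arg_cong[where f="\<lambda>a. a\<^sup>2"])
    fix x assume x: "x \<in> carrier G"
    show "csum L K (\<lambda>y. ennreal (f (\<sigma> x \<otimes>\<^bsub>L\<^esub> inv\<^bsub>L\<^esub> y) * \<xi> y)) =
       csum G H (\<lambda>y. ennreal (f (\<sigma> (x \<otimes>\<^bsub>G\<^esub> inv\<^bsub>G\<^esub> y)) * \<xi> (\<sigma> y)))"
      using x by (subst csum_transfer[OF y, symmetric]) (auto intro!: G.csum_cong)
  qed
qed

text \<open>For left \<open>H\<close>-invariant \<open>\<phi>\<close> this is the unique left
  \<open>K\<close>-invariant function on \<open>L\<close> that restricts to \<open>\<phi>\<close>
  along \<open>\<sigma>\<close>; the choice of \<open>x\<close> is then immaterial.\<close>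

definition extend :: "('a \<Rightarrow> 'c) \<Rightarrow> 'b \<Rightarrow> 'c" where
  "extend \<phi> y = \<phi> (SOME x. x \<in> carrier G \<and> y \<in> K #>\<^bsub>L\<^esub> \<sigma> x)"

lemma extend_eq:
  assumes "left_inv G H \<phi>" "x \<in> carrier G" "y \<in> K #>\<^bsub>L\<^esub> \<sigma> x"
  shows "extend \<phi> y = \<phi> x"
proof -
  define x' where "x' = (SOME x. x \<in> carrier G \<and> y \<in> K #>\<^bsub>L\<^esub> \<sigma> x)"
  have x': "x' \<in> carrier G" "y \<in> K #>\<^bsub>L\<^esub> \<sigma> x'"
    unfolding x'_def using assms someI_ex[of "\<lambda>x. x \<in> carrier G \<and> y \<in> K #>\<^bsub>L\<^esub> \<sigma> x"] by blast+
  then have y: "y \<in> carrier L" using L.r_coset_subset_G[of K "\<sigma> x'"] subgroup.subset[OF K] by auto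
  have "\<sigma> x' \<in> K #>\<^bsub>L\<^esub> \<sigma> x"
    using L.r_coset_eq_iff[OF K] y x' assms(2,3) by (metis \<sigma>_closed)
  then have "x' \<in> H #>\<^bsub>G\<^esub> x" using x' assms(2) by (simp add: coset_eq_iff)
  then show ?thesis using assms(1,2) unfolding extend_def x'_def[symmetric]
    by (auto simp: G.mem_r_coset_iff left_inv_def)
qed

lemma extend_\<sigma> [simp]: "left_inv G H \<phi> \<Longrightarrow> x \<in> carrier G \<Longrightarrow> extend \<phi> (\<sigma> x) = \<phi> x"
  using L.rcos_self[OF _ K] by (intro extend_eq) auto

lemma extend_left_inv:
  assumes "left_inv G H \<phi>" shows "left_inv L K (extend \<phi>)"
  unfolding left_inv_def
proof (intro ballI)
  fix k y assume k: "k \<in> K" and y: "y \<in> carrier L"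
  obtain x where x: "x \<in> carrier G" "y \<in> K #>\<^bsub>L\<^esub> \<sigma> x" using dense y by blast
  then obtain k' where "k' \<in> K" "y = k' \<otimes>\<^bsub>L\<^esub> \<sigma> x" by (auto simp: L.mem_r_coset_iff)
  then have "k \<otimes>\<^bsub>L\<^esub> y = (k \<otimes>\<^bsub>L\<^esub> k') \<otimes>\<^bsub>L\<^esub> \<sigma> x" "k \<otimes>\<^bsub>L\<^esub> k' \<in> K"
    using k x subgroup.mem_carrier[OF K] subgroup.m_closed[OF K] by (auto simp: L.m_assoc)
  then have "k \<otimes>\<^bsub>L\<^esub> y \<in> K #>\<^bsub>L\<^esub> \<sigma> x" by (auto simp: L.mem_r_coset_iff)
  then show "extend \<phi> (k \<otimes>\<^bsub>L\<^esub> y) = extend \<phi> y" using x extend_eq[OF assms x(1)] by simp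
qed

lemma mult_\<sigma>_in_coset:
  assumes "x \<in> carrier G" "y \<in> K #>\<^bsub>L\<^esub> \<sigma> x" "k \<in> K"
  shows "\<exists>h\<in>H. y \<otimes>\<^bsub>L\<^esub> k \<in> K #>\<^bsub>L\<^esub> \<sigma> (x \<otimes>\<^bsub>G\<^esub> h)"
proof -
  obtain k1 where k1: "k1 \<in> K" "y = k1 \<otimes>\<^bsub>L\<^esub> \<sigma> x" using assms by (auto simp: L.mem_r_coset_iff)
  obtain h where h: "h \<in> H" "\<sigma> x \<otimes>\<^bsub>L\<^esub> k \<in> K #>\<^bsub>L\<^esub> \<sigma> (x \<otimes>\<^bsub>G\<^esub> h)" using dense_sub assms by blast
  then obtain k2 where k2: "k2 \<in> K" "\<sigma> x \<otimes>\<^bsub>L\<^esub> k = k2 \<otimes>\<^bsub>L\<^esub> \<sigma> (x \<otimes>\<^bsub>G\<^esub> h)" by (auto simp: L.mem_r_coset_iff)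
  have c: "k1 \<in> carrier L" "k2 \<in> carrier L" "k \<in> carrier L" "h \<in> carrier G"
    using k1 k2 assms h subgroup.mem_carrier[OF K] subgroup.mem_carrier[OF H] by auto
  have "y \<otimes>\<^bsub>L\<^esub> k = k1 \<otimes>\<^bsub>L\<^esub> (\<sigma> x \<otimes>\<^bsub>L\<^esub> k)" using c assms by (simp add: k1 L.m_assoc)
  also have "\<dots> = (k1 \<otimes>\<^bsub>L\<^esub> k2) \<otimes>\<^bsub>L\<^esub> \<sigma> (x \<otimes>\<^bsub>G\<^esub> h)"
    unfolding k2(2) using c assms by (simp add: L.m_assoc del: \<sigma>_mult)
  finally show ?thesis using h(1) subgroup.m_closed[OF K k1(1) k2(1)] by (auto simp: L.mem_r_coset_iff)
qed

lemma extend_right_inv: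
  assumes "left_inv G H \<phi>" "right_inv G H \<phi>" shows "right_inv L K (extend \<phi>)"
  unfolding right_inv_def
proof (intro ballI)
  fix k y assume k: "k \<in> K" and y: "y \<in> carrier L"
  obtain x where x: "x \<in> carrier G" "y \<in> K #>\<^bsub>L\<^esub> \<sigma> x" using dense y by blast
  obtain h where h: "h \<in> H" "y \<otimes>\<^bsub>L\<^esub> k \<in> K #>\<^bsub>L\<^esub> \<sigma> (x \<otimes>\<^bsub>G\<^esub> h)" using mult_\<sigma>_in_coset[OF x k] by blast
  then have "extend \<phi> (y \<otimes>\<^bsub>L\<^esub> k) = \<phi> (x \<otimes>\<^bsub>G\<^esub> h)"
    using x subgroup.mem_carrier[OF H] by (intro extend_eq[OF assms(1)]) auto
  then show "extend \<phi> (y \<otimes>\<^bsub>L\<^esub> k) = extend \<phi> y"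
    using extend_eq[OF assms(1) x] right_invD[OF assms(2) h(1) x(1)] by simp
qed

text \<open>The delicate axiom is subadditivity. Writing \<open>y' = k' \<sigma>(x')\<close>, the
  factor \<open>k'\<close> between \<open>y\<close> and \<open>\<sigma>(x')\<close> need not come
  from \<open>G\<close>. It is pushed to the left as \<open>y k' = k \<sigma>(x h)\<close>, and
  \<open>l\<close> does not see \<open>h\<close>.\<close>

lemma extend_alg_length:
  assumes l: "alg_length G H l" shows "alg_length L K (extend l)"
proof -
  note linv = G.alg_length_inv[OF H l]
  note inv = extend_left_inv[OF linv(1)] extend_right_inv[OF linv]
  have rep: "\<exists>x\<in>carrier G. \<exists>k\<in>K. y = k \<otimes>\<^bsub>L\<^esub> \<sigma> x" if "y \<in> carrier L" for y
    using dense[OF that] by (auto simp: L.mem_r_coset_iff)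
  have Kc: "\<And>k. k \<in> K \<Longrightarrow> k \<in> carrier L" using subgroup.mem_carrier[OF K] .
  have "0 \<le> extend l y" "extend l (inv\<^bsub>L\<^esub> y) = extend l y" if y: "y \<in> carrier L" for y
  proof -
    obtain x k where x: "x \<in> carrier G" "k \<in> K" "y = k \<otimes>\<^bsub>L\<^esub> \<sigma> x" using rep y by blast
    then have "extend l y = l x" using left_invD[OF inv(1)] linv by simp
    moreover have "extend l (inv\<^bsub>L\<^esub> y) = l (inv\<^bsub>G\<^esub> x)"
      using x right_invD[OF inv(2), of "inv\<^bsub>L\<^esub> k" "\<sigma> (inv\<^bsub>G\<^esub> x)"] Kc linv subgroup.m_inv_closed[OF K]
        extend_\<sigma>[OF linv(1), of "inv\<^bsub>G\<^esub> x"]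
      by (simp add: L.inv_mult_group)
    ultimately show "0 \<le> extend l y" "extend l (inv\<^bsub>L\<^esub> y) = extend l y"
      using l x by (auto simp: alg_length_def)
  qed
  moreover have "extend l (y \<otimes>\<^bsub>L\<^esub> y') \<le> extend l y + extend l y'" if y: "y \<in> carrier L" "y' \<in> carrier L" for y y'
  proof -
    obtain x where x: "x \<in> carrier G" "y \<in> K #>\<^bsub>L\<^esub> \<sigma> x" using dense y by blast
    obtain x' k' where x': "x' \<in> carrier G" "k' \<in> K" "y' = k' \<otimes>\<^bsub>L\<^esub> \<sigma> x'" using rep y by blast
    obtain h where h: "h \<in> H" "y \<otimes>\<^bsub>L\<^esub> k' \<in> K #>\<^bsub>L\<^esub> \<sigma> (x \<otimes>\<^bsub>G\<^esub> h)"
      using mult_\<sigma>_in_coset[OF x x'(2)] by blast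
    then obtain k where k: "k \<in> K" "y \<otimes>\<^bsub>L\<^esub> k' = k \<otimes>\<^bsub>L\<^esub> \<sigma> (x \<otimes>\<^bsub>G\<^esub> h)" by (auto simp: L.mem_r_coset_iff)
    have hc: "h \<in> carrier G" using h subgroup.mem_carrier[OF H] by auto
    have "y \<otimes>\<^bsub>L\<^esub> y' = y \<otimes>\<^bsub>L\<^esub> k' \<otimes>\<^bsub>L\<^esub> \<sigma> x'" using y x' Kc by (simp add: L.m_assoc)
    also have "\<dots> = k \<otimes>\<^bsub>L\<^esub> \<sigma> (x \<otimes>\<^bsub>G\<^esub> h \<otimes>\<^bsub>G\<^esub> x')" using k(1) Kc x x' hc by (simp add: k(2) L.m_assoc)
    finally have "extend l (y \<otimes>\<^bsub>L\<^esub> y') = l (x \<otimes>\<^bsub>G\<^esub> h \<otimes>\<^bsub>G\<^esub> x')"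
      using left_invD[OF inv(1) k(1)] x x' hc extend_\<sigma>[OF linv(1), of "x \<otimes>\<^bsub>G\<^esub> h \<otimes>\<^bsub>G\<^esub> x'"] by simp
    also have "\<dots> \<le> l (x \<otimes>\<^bsub>G\<^esub> h) + l x'" using l x x' hc by (simp add: alg_length_def)
    also have "l (x \<otimes>\<^bsub>G\<^esub> h) = extend l y" using right_invD[OF linv(2) h(1) x(1)] extend_eq[OF linv(1) x] by simp
    also have "l x' = extend l y'" using x' left_invD[OF inv(1)] linv by simp
    finally show ?thesis .
  qed
  moreover have "extend l k = 0" if "k \<in> K" for k
  proof -
    have "extend l (k \<otimes>\<^bsub>L\<^esub> \<sigma> \<one>\<^bsub>G\<^esub>) = l \<one>\<^bsub>G\<^esub>" using left_invD[OF inv(1) that] linv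
      by (metis G.one_closed \<sigma>_closed extend_\<sigma>)
    then show ?thesis using Kc[OF that] l by (simp add: alg_length_def)
  qed
  moreover have "extend l \<one>\<^bsub>L\<^esub> = 0"
    using extend_\<sigma>[OF linv(1), of "\<one>\<^bsub>G\<^esub>"] l by (simp add: alg_length_def)
  ultimately show ?thesis by (simp add: alg_length_def)
qed

text \<open>The functions to be tested on \<open>L\<close> are composed with
  \<open>\<sigma>\<close>; each coset sum in the inequality keeps its value.\<close>

lemma disc_RD_extend:
  assumes RD: "disc_RD G H l s c" shows "disc_RD L K (extend l) s c"
  unfolding disc_RD_def
proof (intro conjI allI impI)
  have l: "alg_length G H l" and sc: "0 < s" "0 < c" using RD by (auto simp: disc_RD_def)
  show "alg_length L K (extend l)" by (rule extend_alg_length[OF l])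
  show "0 < s" "0 < c" by fact+
  note linv = G.alg_length_inv[OF H l]
  fix f \<xi> :: "'b \<Rightarrow> real"
  assume f0: "\<forall>x\<in>carrier L. 0 \<le> f x" and f: "left_inv L K f" "right_inv L K f"
    and supp: "fin_supp_mod L K f" and \<xi>0: "\<forall>x\<in>carrier L. 0 \<le> \<xi> x" and \<xi>: "left_inv L K \<xi>"
    and fin: "csum L K (\<lambda>x. ennreal ((\<xi> x)\<^sup>2)) < \<infinity>"
  have Hc: "\<And>h. h \<in> H \<Longrightarrow> h \<in> carrier G" using subgroup.mem_carrier[OF H] .
  have \<sigma>H: "\<And>h. h \<in> H \<Longrightarrow> \<sigma> h \<in> K" using preimage Hc by blast
  have inv: "left_inv G H (\<lambda>x. f (\<sigma> x))" "right_inv G H (\<lambda>x. f (\<sigma> x))" "left_inv G H (\<lambda>x. \<xi> (\<sigma> x))"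
    using f \<xi> \<sigma>H Hc by (auto simp: left_inv_def right_inv_def)
  have supp': "fin_supp_mod G H (\<lambda>x. f (\<sigma> x))"
  proof -
    obtain F where F: "finite F" "F \<subseteq> carrier L" "\<And>x. x \<in> carrier L \<Longrightarrow> f x \<noteq> 0 \<Longrightarrow> \<exists>a\<in>F. x \<in> K #>\<^bsub>L\<^esub> a"
      using supp by (auto simp: fin_supp_mod_def)
    have "\<forall>a\<in>F. \<exists>b\<in>carrier G. a \<in> K #>\<^bsub>L\<^esub> \<sigma> b" using dense F(2) by blast
    then obtain b where b: "\<And>a. a \<in> F \<Longrightarrow> b a \<in> carrier G \<and> a \<in> K #>\<^bsub>L\<^esub> \<sigma> (b a)" by metis
    have "\<exists>a\<in>b ` F. x \<in> H #>\<^bsub>G\<^esub> a" if x: "x \<in> carrier G" "f (\<sigma> x) \<noteq> 0" for x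
    proof -
      obtain a where a: "a \<in> F" "\<sigma> x \<in> K #>\<^bsub>L\<^esub> a" using F(3)[OF \<sigma>_closed] x by blast
      then have "\<sigma> x \<in> K #>\<^bsub>L\<^esub> \<sigma> (b a)"
        using b[OF a(1)] x F(2) L.r_coset_eq_iff[OF K] by (metis \<sigma>_closed subsetD)
      then show ?thesis using a b x by (auto simp: coset_eq_iff)
    qed
    moreover have "finite (b ` F)" "b ` F \<subseteq> carrier G" using F b by auto
    ultimately show ?thesis unfolding fin_supp_mod_def by blast
  qed
  have \<xi>2: "csum L K (\<lambda>x. ennreal ((\<xi> x)\<^sup>2)) = csum G H (\<lambda>x. ennreal ((\<xi> (\<sigma> x))\<^sup>2))"
    using \<xi> by (subst csum_transfer) (auto simp: left_inv_def)
  have f2: "csum L K (\<lambda>x. ennreal ((f x)\<^sup>2 * (1 + extend l x) powr (2 * s)))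
      = csum G H (\<lambda>x. ennreal ((f (\<sigma> x))\<^sup>2 * (1 + l x) powr (2 * s)))"
  proof -
    have "left_inv L K (\<lambda>x. ennreal ((f x)\<^sup>2 * (1 + extend l x) powr (2 * s)))"
      using f extend_left_inv[OF linv(1)] by (auto simp: left_inv_def)
    from csum_transfer[OF this, symmetric] show ?thesis
      using linv by (auto intro!: G.csum_cong)
  qed
  show "csum L K (\<lambda>x. (csum L K (\<lambda>y. ennreal (f (x \<otimes>\<^bsub>L\<^esub> inv\<^bsub>L\<^esub> y) * \<xi> y)))\<^sup>2)
     \<le> ennreal (c\<^sup>2) * csum L K (\<lambda>x. ennreal ((f x)\<^sup>2 * (1 + extend l x) powr (2 * s)))
             * csum L K (\<lambda>x. ennreal ((\<xi> x)\<^sup>2))"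
    unfolding csum_conv_transfer[OF f \<xi>] \<xi>2 f2
    using fin f0 \<xi>0 \<xi>2 by (intro disc_RD_D[OF RD _ inv(1,2) supp' _ inv(3)]) auto
qed

text \<open>The mirror image: the length is pulled back along \<open>\<sigma>\<close>, whereas the
  functions to be tested on \<open>G\<close> have to be extended to \<open>L\<close>.\<close>

lemma disc_RD_restrict:
  assumes RD: "disc_RD L K l s c" shows "disc_RD G H (\<lambda>x. l (\<sigma> x)) s c"
  unfolding disc_RD_def
proof (intro conjI allI impI)
  have l: "alg_length L K l" and sc: "0 < s" "0 < c" using RD by (auto simp: disc_RD_def)
  note linv = L.alg_length_inv[OF K l]
  have Hc: "\<And>h. h \<in> H \<Longrightarrow> h \<in> carrier G" using subgroup.mem_carrier[OF H] .
  have \<sigma>H: "\<And>h. h \<in> H \<Longrightarrow> \<sigma> h \<in> K" using preimage Hc by blast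
  show "alg_length G H (\<lambda>x. l (\<sigma> x))" using l \<sigma>H by (simp add: alg_length_def)
  show "0 < s" "0 < c" by fact+
  fix f \<xi> :: "'a \<Rightarrow> real"
  assume f0: "\<forall>x\<in>carrier G. 0 \<le> f x" and f: "left_inv G H f" "right_inv G H f"
    and supp: "fin_supp_mod G H f" and \<xi>0: "\<forall>x\<in>carrier G. 0 \<le> \<xi> x" and \<xi>: "left_inv G H \<xi>"
    and fin: "csum G H (\<lambda>x. ennreal ((\<xi> x)\<^sup>2)) < \<infinity>"
  let ?f = "extend f" and ?\<xi> = "extend \<xi>"
  have inv: "left_inv L K ?f" "right_inv L K ?f" "left_inv L K ?\<xi>"
    using extend_left_inv extend_right_inv f \<xi> by auto
  have pos: "0 \<le> ?f y" "0 \<le> ?\<xi> y" if y: "y \<in> carrier L" for y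
  proof -
    obtain x where x: "x \<in> carrier G" "y \<in> K #>\<^bsub>L\<^esub> \<sigma> x" using dense y by blast
    then show "0 \<le> ?f y" "0 \<le> ?\<xi> y" using extend_eq[OF f(1) x] extend_eq[OF \<xi> x] f0 \<xi>0 by auto
  qed
  have supp': "fin_supp_mod L K ?f"
  proof -
    obtain F where F: "finite F" "F \<subseteq> carrier G" "\<And>x. x \<in> carrier G \<Longrightarrow> f x \<noteq> 0 \<Longrightarrow> \<exists>a\<in>F. x \<in> H #>\<^bsub>G\<^esub> a"
      using supp by (auto simp: fin_supp_mod_def)
    have "\<exists>a\<in>\<sigma> ` F. y \<in> K #>\<^bsub>L\<^esub> a" if y: "y \<in> carrier L" "?f y \<noteq> 0" for y
    proof -
      obtain x where x: "x \<in> carrier G" "y \<in> K #>\<^bsub>L\<^esub> \<sigma> x" using dense y by blast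
      then obtain a where a: "a \<in> F" "x \<in> H #>\<^bsub>G\<^esub> a" using F(3) y extend_eq[OF f(1) x] by auto
      then have "\<sigma> x \<in> K #>\<^bsub>L\<^esub> \<sigma> a" using x F(2) by (auto simp: coset_eq_iff)
      then have "y \<in> K #>\<^bsub>L\<^esub> \<sigma> a"
        using x a F(2) L.r_coset_eq_iff[OF K] by (metis \<sigma>_closed subsetD)
      then show ?thesis using a by blast
    qed
    moreover have "finite (\<sigma> ` F)" "\<sigma> ` F \<subseteq> carrier L" using F by auto
    ultimately show ?thesis unfolding fin_supp_mod_def by blast
  qed
  have conv: "csum G H (\<lambda>x. (csum G H (\<lambda>y. ennreal (f (x \<otimes>\<^bsub>G\<^esub> inv\<^bsub>G\<^esub> y) * \<xi> y)))\<^sup>2)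
     = csum L K (\<lambda>x. (csum L K (\<lambda>y. ennreal (?f (x \<otimes>\<^bsub>L\<^esub> inv\<^bsub>L\<^esub> y) * ?\<xi> y)))\<^sup>2)"
    unfolding csum_conv_transfer[OF inv] using f \<xi>
    by (intro G.csum_cong arg_cong[where f="\<lambda>a. a\<^sup>2"]) (simp del: \<sigma>_mult)
  have \<xi>2: "csum G H (\<lambda>x. ennreal ((\<xi> x)\<^sup>2)) = csum L K (\<lambda>x. ennreal ((?\<xi> x)\<^sup>2))"
    using inv(3) \<xi> by (subst csum_transfer[symmetric]) (auto simp: left_inv_def[of L] intro!: G.csum_cong)
  have f2: "csum G H (\<lambda>x. ennreal ((f x)\<^sup>2 * (1 + l (\<sigma> x)) powr (2 * s)))
      = csum L K (\<lambda>x. ennreal ((?f x)\<^sup>2 * (1 + l x) powr (2 * s)))"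
    using inv(1) linv(1) f by (subst csum_transfer[symmetric]) (auto simp: left_inv_def[of L] intro!: G.csum_cong)
  show "csum G H (\<lambda>x. (csum G H (\<lambda>y. ennreal (f (x \<otimes>\<^bsub>G\<^esub> inv\<^bsub>G\<^esub> y) * \<xi> y)))\<^sup>2)
     \<le> ennreal (c\<^sup>2) * csum G H (\<lambda>x. ennreal ((f x)\<^sup>2 * (1 + l (\<sigma> x)) powr (2 * s)))
             * csum G H (\<lambda>x. ennreal ((\<xi> x)\<^sup>2))"
    unfolding conv f2 \<xi>2
    using fin \<xi>2 by (intro disc_RD_D[OF RD pos(1) inv(1,2) supp' pos(2) inv(3)]) auto
qed

end

section \<open>Haar measure on totally disconnected locally compact groups\<close>

text \<open>The group topology enters through translations and inversion one variable at a time. The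
  consequence of van Dantzig's theorem, a neighbourhood base of open subgroups, is the assumption
  \<open>base\<close>; for permutation groups it is supplied by pointwise stabilisers of finite
  sets.\<close>

locale tdlc_group = plain_group G for G :: "'a monoid" (structure) +
  fixes T :: "'a topology" and K :: "'a set"
  assumes topspace_G: "topspace T = carrier G"
    and openin_lcoset: "\<And>g A. g \<in> carrier G \<Longrightarrow> openin T A \<Longrightarrow> openin T (g <# A)"
    and openin_rcoset: "\<And>g A. g \<in> carrier G \<Longrightarrow> openin T A \<Longrightarrow> openin T (A #> g)"
    and openin_inv: "\<And>A. openin T A \<Longrightarrow> openin T {x \<in> carrier G. inv x \<in> A}"
    and K: "subgroup K G" "openin T K" "compactin T K"
    and base: "\<And>A. openin T A \<Longrightarrow> \<one> \<in> A \<Longrightarrow> \<exists>U. subgroup U G \<and> openin T U \<and> U \<subseteq> A \<inter> K"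
begin

definition opsub :: "'a set \<Rightarrow> bool" where
  "opsub U \<longleftrightarrow> subgroup U G \<and> openin T U \<and> U \<subseteq> K"

lemma opsubD: assumes "opsub U" shows "subgroup U G" "openin T U" "U \<subseteq> K" "U \<subseteq> carrier G"
  using assms subgroup.subset by (auto simp: opsub_def)

lemma opsub_K: "opsub K" using K by (simp add: opsub_def)

lemma opsub_Int: "opsub U \<Longrightarrow> opsub V \<Longrightarrow> opsub (U \<inter> V)"
  by (auto simp: opsub_def subgroups_Inter_pair)

lemma opsub_coset_open: "opsub U \<Longrightarrow> x \<in> carrier G \<Longrightarrow> openin T (U #> x)"
  by (simp add: opsub_def openin_rcoset)

lemma openin_opsub_inv:
  assumes "opsub U" "A \<subseteq> carrier G" "\<And>u x. u \<in> U \<Longrightarrow> x \<in> A \<Longrightarrow> u \<otimes> x \<in> A"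
  shows "openin T A"
  using openin_left_inv[OF opsubD(1)[OF assms(1)] opsub_coset_open[OF assms(1)] assms(2,3)] by auto

lemma continuous_map_ltrans: "g \<in> carrier G \<Longrightarrow> continuous_map T T (\<lambda>x. g \<otimes> x)"
proof (unfold continuous_map_def topspace_G, intro conjI allI impI)
  fix A assume g: "g \<in> carrier G" and A: "openin T A"
  then have "A \<subseteq> carrier G" using openin_subset topspace_G by auto
  then have "{x \<in> carrier G. g \<otimes> x \<in> A} = inv g <# A"
    using g by (force simp: l_coset_def inv_cancel)
  then show "openin T {x \<in> carrier G. g \<otimes> x \<in> A}" using g A openin_lcoset by simp
qed auto

lemma continuous_map_rtrans: "g \<in> carrier G \<Longrightarrow> continuous_map T T (\<lambda>x. x \<otimes> g)"
proof (unfold continuous_map_def topspace_G, intro conjI allI impI)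
  fix A assume g: "g \<in> carrier G" and A: "openin T A"
  then have Ac: "A \<subseteq> carrier G" using openin_subset topspace_G by auto
  have "{x \<in> carrier G. x \<otimes> g \<in> A} = A #> inv g"
  proof (intro equalityI subsetI)
    fix x assume "x \<in> {x \<in> carrier G. x \<otimes> g \<in> A}"
    moreover from this have "x = x \<otimes> g \<otimes> inv g" using g by (simp add: m_assoc)
    ultimately show "x \<in> A #> inv g" unfolding mem_r_coset_iff by blast
  next
    fix x assume "x \<in> A #> inv g"
    then obtain a where "a \<in> A" "x = a \<otimes> inv g" unfolding mem_r_coset_iff by blast
    moreover from this have "a \<in> carrier G" using Ac by blast
    ultimately show "x \<in> {x \<in> carrier G. x \<otimes> g \<in> A}" using g by (simp add: m_assoc)
  qed
  then show "openin T {x \<in> carrier G. x \<otimes> g \<in> A}" using g A openin_rcoset by simp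
qed (simp add: Pi_def)

lemma continuous_map_inv: "continuous_map T T (\<lambda>x. inv x)"
  unfolding continuous_map_def topspace_G using openin_inv by auto

text \<open>The cosets of \<open>U\<close> form a disjoint open cover. Disjointness forces every
  coset that meets \<open>C\<close> to belong to any finite subcover.\<close>

lemma finite_coset_cover:
  assumes U: "opsub U" and C: "compactin T C"
  shows "finite ((\<lambda>x. U #> x) ` C)"
proof -
  have Cc: "C \<subseteq> carrier G" using C compactin_subset_topspace topspace_G by auto
  note sU = opsubD(1)[OF U]
  have "\<exists>F. finite F \<and> F \<subseteq> (\<lambda>x. U #> x) ` C \<and> C \<subseteq> \<Union>F"
    using C opsub_coset_open[OF U] Cc rcos_self[OF _ sU]
    unfolding compactin_def by (elim conjE allE impE, intro conjI ballI) auto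
  then obtain F where F: "finite F" "F \<subseteq> (\<lambda>x. U #> x) ` C" "C \<subseteq> \<Union>F" by blast
  have "(\<lambda>x. U #> x) ` C \<subseteq> F"
  proof safe
    fix x assume x: "x \<in> C"
    then obtain D where D: "D \<in> F" "x \<in> D" using F(3) by blast
    then obtain y where "y \<in> C" "D = U #> y" using F(2) by blast
    moreover from this have "U #> x = U #> y" using D x Cc r_coset_eq_iff[OF sU, of x y] by blast
    ultimately show "U #> x \<in> F" using D by simp
  qed
  then show ?thesis using F(1) finite_subset by blast
qed

lemma opsub_transversal:
  assumes "opsub U" "opsub V" "V \<subseteq> U" "compactin T U" shows "\<exists>R. transversal V U R"
  using assms by (intro ex_transversal finite_coset_cover) (auto simp: opsubD)

text \<open>The compact set \<open>a K\<close> meets only finitely many cosets of the open subgroup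
  \<open>K\<close>.\<close>

lemma hecke_fin_K: "hecke_fin G K"
  unfolding hecke_fin_def
proof
  fix a assume a: "a \<in> carrier G"
  have Kc: "K \<subseteq> carrier G" using opsubD[OF opsub_K] by auto
  have "compactin T ((\<lambda>x. a \<otimes> x) ` K)"
    using continuous_map_ltrans[OF a] K(3) by (rule image_compactin[rotated])
  then have fin: "finite ((\<lambda>x. K #> x) ` (\<lambda>x. a \<otimes> x) ` K)" by (rule finite_coset_cover[OF opsub_K])
  let ?F = "coset_rep G K ` (\<lambda>x. K #> x) ` (\<lambda>x. a \<otimes> x) ` K"
  have "\<exists>b\<in>?F. a \<otimes> k \<in> K #> b" if k: "k \<in> K" for k
  proof -
    have ak: "a \<otimes> k \<in> carrier G" using a k Kc by auto
    then have "a \<otimes> k \<in> K #> coset_rep G K (K #> (a \<otimes> k))"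
      using coset_rep(2)[OF rcosets_memI[OF ak], of K] rcos_self[OF ak K(1)] by simp
    then show ?thesis using k by blast
  qed
  moreover have "?F \<subseteq> carrier G" using a Kc by (auto intro!: coset_rep(1) rcosets_memI)
  ultimately show "\<exists>F. finite F \<and> F \<subseteq> carrier G \<and> (\<forall>k\<in>K. \<exists>b\<in>F. a \<otimes> k \<in> K #> b)"
    using finite_imageI[OF fin] by (intro exI[of _ ?F]) simp
qed

text \<open>The complement of an open subgroup is a union of its cosets, so the subgroup is closed,
  and closed in the compact set \<open>K\<close>.\<close>

lemma opsub_closed_compact: assumes U: "opsub U" shows "compactin T U"
proof (rule closed_compactin[OF K(3) opsubD(3)[OF U]])
  have "openin T (carrier G - U)"
    using U opsubD[OF U] subgroup.m_closed[OF opsubD(1)[OF U]] subgroup.m_inv_closed[OF opsubD(1)[OF U]]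
  proof (intro openin_opsub_inv[OF U], goal_cases)
    case (2 u x)
    have "x = inv u \<otimes> (u \<otimes> x)" using 2 by (auto simp: inv_cancel)
    then have "u \<otimes> x \<notin> U" using 2 by (metis DiffD2)
    then show ?case using 2 by auto
  qed auto
  then show "closedin T U" using opsubD(4)[OF U] by (simp add: closedin_def topspace_G)
qed

section \<open>Volumes of compact open sets and the content they define\<close>

definition blk :: "'a set \<Rightarrow> 'a set \<Rightarrow> bool" where
  "blk U A \<longleftrightarrow> opsub U \<and> compactin T A \<and> (\<forall>u\<in>U. \<forall>x\<in>A. u \<otimes> x \<in> A)"

text \<open>A count of \<open>U\<close>-cosets divided by \<open>[K:U]\<close>: the Haar measure of
  \<open>A\<close> normalised by \<open>K\<close> having measure 1.\<close>

definition vol :: "'a set \<Rightarrow> 'a set \<Rightarrow> ennreal" where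
  "vol U A = csum G U (indicator A) / csum G U (indicator K)"

lemma blkD: assumes "blk U A"
  shows "opsub U" "compactin T A" "A \<subseteq> carrier G" "\<And>u x. u \<in> U \<Longrightarrow> x \<in> A \<Longrightarrow> u \<otimes> x \<in> A"
  using assms compactin_subset_topspace topspace_G by (auto simp: blk_def)

lemma blk_open: assumes "blk U A" shows "openin T A"
  using blkD[OF assms] by (intro openin_opsub_inv)

lemma blk_mono: "blk U A \<Longrightarrow> opsub V \<Longrightarrow> V \<subseteq> U \<Longrightarrow> blk V A"
  by (auto simp: blk_def)

lemma blk_Un: "blk U A \<Longrightarrow> blk U B \<Longrightarrow> blk U (A \<union> B)"
  by (auto simp: blk_def compactin_Un)

lemma blk_K: "opsub U \<Longrightarrow> blk U K"
  using K subgroup.m_closed by (fastforce simp: blk_def opsub_def)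

lemma left_inv_indicator:
  assumes U: "subgroup U G" and A: "\<And>u x. u \<in> U \<Longrightarrow> x \<in> A \<Longrightarrow> u \<otimes> x \<in> A"
  shows "left_inv G U (indicator A :: 'a \<Rightarrow> ennreal)"
  unfolding left_inv_def
proof (intro ballI)
  fix u x assume u: "u \<in> U" and x: "x \<in> carrier G"
  have "u \<otimes> x \<in> A \<longleftrightarrow> x \<in> A"
  proof
    assume "u \<otimes> x \<in> A"
    then have "inv u \<otimes> (u \<otimes> x) \<in> A" using A u subgroup.m_inv_closed[OF U] by auto
    then show "x \<in> A" using u x subgroup.mem_carrier[OF U] by (simp add: inv_cancel)
  qed (use A u in auto)
  then show "indicator A (u \<otimes> x) = (indicator A x :: ennreal)" by (simp add: indicator_def)
qed

lemma blk_left_inv: "blk U A \<Longrightarrow> left_inv G U (indicator A :: 'a \<Rightarrow> ennreal)"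
  by (rule left_inv_indicator) (auto simp: blk_def opsub_def)

lemma csum_indicator_finite:
  assumes "blk U A" shows "csum G U (indicator A) < \<infinity>"
proof -
  let ?S = "(\<lambda>x. U #> x) ` A"
  have fin: "finite ?S" using blkD[OF assms] by (intro finite_coset_cover)
  have "csum G U (indicator A) = (\<Sum>D\<in>?S. indicator A (coset_rep G U D))"
  proof (rule csum_eq_sum)
    show "finite ?S" by (fact fin)
    show "?S \<subseteq> rcosets U" using blkD[OF assms] by (auto intro!: rcosets_memI)
    fix D assume D: "D \<in> rcosets U - ?S"
    then have "coset_rep G U D \<notin> A" using coset_rep(2)[of D U] by blast
    then show "indicator A (coset_rep G U D) = 0" by simp
  qed
  also have "\<dots> < \<infinity>" using fin by (simp add: indicator_def of_bool_def)
  finally show ?thesis .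
qed

lemma csum_indicator_pos:
  assumes U: "blk U A" and "A \<noteq> {}" shows "0 < csum G U (indicator A)"
proof -
  obtain x where x: "x \<in> A" using assms by blast
  have xc: "x \<in> carrier G" using x blkD(3)[OF U] by blast
  have "1 = (\<Sum>D\<in>{U #> x}. indicator A (coset_rep G U D) :: ennreal)"
    using left_inv_rep[OF opsubD(1)[OF blkD(1)[OF U]] blk_left_inv[OF U] xc] x by simp
  also have "\<dots> \<le> csum G U (indicator A)"
    unfolding csum_def using rcosets_memI[OF xc] by (intro sum_le_nn_integral_count_space) auto
  finally show ?thesis by (auto simp: zero_less_iff_neq_zero)
qed

lemma idx_bounds: assumes "opsub U" shows "0 < csum G U (indicator K)" "csum G U (indicator K) < \<infinity>"
  using csum_indicator_finite[OF blk_K[OF assms]] csum_indicator_pos[OF blk_K[OF assms]]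
    subgroup.one_closed[OF K(1)] by auto

lemma csum_indicator_refine:
  assumes A: "blk U A" and V: "opsub V" "V \<subseteq> U" and R: "transversal V U R"
  shows "csum G V (indicator A) = of_nat (card R) * csum G U (indicator A)"
proof -
  note sU = opsubD(1)[OF blkD(1)[OF A]]
  have "left_inv G V (indicator A :: 'a \<Rightarrow> ennreal)" by (rule blk_left_inv[OF blk_mono[OF A V]])
  then have "csum G V (indicator A) = csum G U (\<lambda>x. \<Sum>r\<in>R. indicator A (r \<otimes> x))"
    by (rule csum_refine[OF opsubD(1)[OF V(1)] sU V(2) R])
  also have "\<dots> = csum G U (\<lambda>x. of_nat (card R) * indicator A x)"
  proof (rule csum_cong)
    fix x assume "x \<in> carrier G"
    then have "(\<Sum>r\<in>R. indicator A (r \<otimes> x)) = (\<Sum>r\<in>R. indicator A x :: ennreal)"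
      using left_invD[OF blk_left_inv[OF A]] R by (intro sum.cong) (auto simp: transversal_def)
    then show "(\<Sum>r\<in>R. indicator A (r \<otimes> x)) = of_nat (card R) * (indicator A x :: ennreal)" by simp
  qed
  finally show ?thesis by (simp add: csum_cmult)
qed

lemma transversal_card_pos:
  assumes "transversal V U R" "U \<noteq> {}" shows "0 < card R"
  using assms by (auto simp: transversal_def card_gt_0_iff)

text \<open>Shrinking \<open>U\<close> to \<open>V\<close> multiplies numerator and denominator by
  the same index \<open>[U:V]\<close>. So the volume of a compact open set does not depend on the
  subgroup that measures it.\<close>

lemma vol_refine:
  assumes A: "blk U A" and V: "opsub V" "V \<subseteq> U"
  shows "vol V A = vol U A"
proof -
  note U = blkD(1)[OF A]
  obtain R where R: "transversal V U R"
    using opsub_transversal[OF U V opsub_closed_compact[OF U]] by blast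
  have "U \<noteq> {}" using subgroup.one_closed[OF opsubD(1)[OF U]] by auto
  then have "0 < card R" using transversal_card_pos[OF R] by blast
  then show ?thesis
    unfolding vol_def csum_indicator_refine[OF A V R] csum_indicator_refine[OF blk_K[OF U] V R]
    unfolding mult.commute[of "of_nat (card R)"] by (intro divide_mult_eq) auto
qed

lemma vol_mono: "A \<subseteq> B \<Longrightarrow> vol U A \<le> vol U B"
  unfolding vol_def by (intro divide_right_mono_ennreal csum_mono) (auto simp: indicator_def)

lemma vol_Un: assumes "A \<inter> B = {}" shows "vol U (A \<union> B) = vol U A + vol U B"
proof -
  have "csum G U (indicator (A \<union> B)) = csum G U (\<lambda>x. indicator A x + indicator B x)"
    using assms by (intro csum_cong) (auto simp: indicator_def)
  also have "\<dots> = csum G U (indicator A) + csum G U (indicator B)"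
    unfolding csum_def by (rule nn_integral_add) auto
  finally show ?thesis by (simp add: vol_def add_divide_distrib_ennreal)
qed

lemma vol_UN_le: fixes B :: "nat \<Rightarrow> 'a set"
  shows "vol U (\<Union>i. B i) \<le> (\<Sum>i. vol U (B i))"
proof -
  have "csum G U (indicator (\<Union>i. B i)) \<le> csum G U (\<lambda>x. \<Sum>i. indicator (B i) x)"
  proof (rule csum_mono)
    fix x
    show "indicator (\<Union>i. B i) x \<le> (\<Sum>i. indicator (B i) x :: ennreal)"
    proof (cases "\<exists>i. x \<in> B i")
      case True
      then obtain i where "x \<in> B i" by blast
      then have "indicator (\<Union>i. B i) x = (\<Sum>i\<in>{i}. indicator (B i) x :: ennreal)" by (auto simp: indicator_def)
      also have "\<dots> \<le> (\<Sum>i. indicator (B i) x)" by (rule sum_le_suminf) auto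
      finally show ?thesis .
    qed (auto simp: indicator_def)
  qed
  also have "\<dots> = (\<Sum>i. csum G U (indicator (B i)))"
    unfolding csum_def by (rule nn_integral_suminf) auto
  finally show ?thesis unfolding vol_def
    by (simp add: divide_ennreal_def ennreal_suminf_multc mult_right_mono)
qed

text \<open>An inner content. The supremum runs over pairs, because measuring \<open>A\<close> needs
  a witness subgroup under which \<open>A\<close> is invariant.\<close>

definition hcontent :: "'a set \<Rightarrow> ennreal" where
  "hcontent W = (SUP p\<in>{(U, A). blk U A \<and> A \<subseteq> W}. vol (fst p) (snd p))"

lemma vol_le_hcontent: "blk U A \<Longrightarrow> A \<subseteq> W \<Longrightarrow> vol U A \<le> hcontent W"
  unfolding hcontent_def by (intro SUP_upper2[of "(U, A)"]) auto

lemma hcontent_leI: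
  assumes "\<And>U A. blk U A \<Longrightarrow> A \<subseteq> W \<Longrightarrow> vol U A \<le> c"
  shows "hcontent W \<le> c"
  unfolding hcontent_def by (rule SUP_least) (use assms in auto)

lemma hcontent_mono: "V \<subseteq> W \<Longrightarrow> hcontent V \<le> hcontent W"
  by (intro hcontent_leI vol_le_hcontent) auto

lemma hcontent_empty: "hcontent {} = 0"
proof -
  have "hcontent {} \<le> 0" by (intro hcontent_leI) (simp add: vol_def csum_def)
  then show ?thesis by simp
qed

lemma blk_empty: "opsub U \<Longrightarrow> blk U {}" by (simp add: blk_def)

text \<open>Lets a constant be added inside the supremum. The index set has to be nonempty for this,
  and the empty block ensures it.\<close>

lemma hcontent_add_le:
  assumes b: "\<And>U A. blk U A \<Longrightarrow> A \<subseteq> W \<Longrightarrow> vol U A + b \<le> c"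
  shows "hcontent W + b \<le> c"
proof -
  have "hcontent W + b = (SUP p\<in>{(U, A). blk U A \<and> A \<subseteq> W}. vol (fst p) (snd p) + b)"
    unfolding hcontent_def using blk_empty[OF opsub_K] by (intro ennreal_SUP_add_left[symmetric]) auto
  also have "\<dots> \<le> c" using b by (intro SUP_least) auto
  finally show ?thesis .
qed

text \<open>Blocks in \<open>V\<close> and in \<open>W\<close> may come with different subgroups;
  over the intersection of the two both can be measured, and disjoint volumes add.\<close>

lemma hcontent_superadd:
  assumes "V \<inter> W = {}"
  shows "hcontent V + hcontent W \<le> hcontent (V \<union> W)"
proof (rule hcontent_add_le)
  fix U A assume A: "blk U A" "A \<subseteq> V"
  have "hcontent W + vol U A \<le> hcontent (V \<union> W)"
  proof (rule hcontent_add_le)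
    fix U' B assume B: "blk U' B" "B \<subseteq> W"
    let ?U = "U \<inter> U'"
    have U: "opsub ?U" using A B blkD by (intro opsub_Int) auto
    have "vol U' B + vol U A = vol ?U B + vol ?U A"
      using vol_refine[OF A(1) U] vol_refine[OF B(1) U] by simp
    also have "\<dots> = vol ?U (B \<union> A)" using A B assms by (subst vol_Un) auto
    also have "\<dots> \<le> hcontent (V \<union> W)"
      using A B blk_mono[OF A(1) U] blk_mono[OF B(1) U] by (intro vol_le_hcontent blk_Un) auto
    finally show "vol U' B + vol U A \<le> hcontent (V \<union> W)" .
  qed
  then show "vol U A + hcontent W \<le> hcontent (V \<union> W)" by (simp add: add.commute)
qed

text \<open>The Lebesgue number lemma with subgroups in place of radii.\<close>

lemma lebesgue_opsub:
  assumes A: "compactin T A" and U: "opsub U" and O: "\<And>i. openin T (W i)" and cov: "A \<subseteq> (\<Union>i. W i)"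
  shows "\<exists>V. opsub V \<and> V \<subseteq> U \<and> (\<forall>x\<in>A. \<exists>i. V #> x \<subseteq> W i)"
proof -
  have Ac: "A \<subseteq> carrier G" using A compactin_subset_topspace topspace_G by auto
  have "\<exists>V. opsub V \<and> V \<subseteq> U \<and> (\<exists>i. V #> x \<subseteq> W i)" if x: "x \<in> A" for x
  proof -
    have xc: "x \<in> carrier G" using x Ac by auto
    obtain i where i: "x \<in> W i" using cov x by auto
    have Wc: "W i \<subseteq> carrier G" using openin_subset[OF O] topspace_G by simp
    \<comment> \<open>Translating back to the identity makes \<open>base\<close> applicable.\<close>
    have "openin T (W i #> inv x)" using O xc by (intro openin_rcoset) auto
    moreover have "\<one> \<in> W i #> inv x" using i xc by (force simp: r_coset_def)
    ultimately obtain V where V: "subgroup V G" "openin T V" "V \<subseteq> (W i #> inv x) \<inter> K" using base by blast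
    then have V': "opsub V" by (auto simp: opsub_def)
    have "(U \<inter> V) #> x \<subseteq> W i"
    proof
      fix y assume "y \<in> (U \<inter> V) #> x"
      then obtain v where v: "v \<in> V" "y = v \<otimes> x" by (auto simp: mem_r_coset_iff)
      then obtain w where w: "w \<in> W i" "v = w \<otimes> inv x" using V(3) by (auto simp: r_coset_def)
      then have "w \<in> carrier G" using Wc by auto
      then have "y = w" using v w xc by (simp add: m_assoc)
      then show "y \<in> W i" using w by simp
    qed
    then show ?thesis using opsub_Int[OF U V'] by blast
  qed
  then obtain V where V: "\<And>x. x \<in> A \<Longrightarrow> opsub (V x) \<and> V x \<subseteq> U \<and> (\<exists>i. V x #> x \<subseteq> W i)" by metis
  have self: "x \<in> V x #> x" if "x \<in> A" for x
    using V[OF that] that Ac opsubD(1) by (intro rcos_self) auto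
  have "\<exists>F. finite F \<and> F \<subseteq> (\<lambda>x. V x #> x) ` A \<and> A \<subseteq> \<Union>F"
  proof -
    have "\<forall>D\<in>(\<lambda>x. V x #> x) ` A. openin T D" using V Ac opsub_coset_open by auto
    moreover have "A \<subseteq> \<Union>((\<lambda>x. V x #> x) ` A)" using self by auto
    ultimately show ?thesis using A unfolding compactin_def by blast
  qed
  then obtain X where X: "finite X" "X \<subseteq> A" "A \<subseteq> (\<Union>x\<in>X. V x #> x)"
    by (metis (no_types, lifting) finite_subset_image)
  have fin: "opsub (U \<inter> (\<Inter>x\<in>Y. V x))" if "finite Y" "Y \<subseteq> A" for Y
    using that
  proof (induction Y rule: finite_induct)
    case (insert y Y)
    then have "opsub (V y \<inter> (U \<inter> (\<Inter>x\<in>Y. V x)))" using V[of y] by (intro opsub_Int[of "V y"]) auto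
    then show ?case by (simp add: Int_ac)
  qed (use U in simp)
  \<comment> \<open>As with ultrametric balls, \<open>V x #> y\<close> equals
    \<open>V x #> x\<close> as soon as \<open>y\<close> lies in the latter, so intersecting the
    finitely many subgroups suffices and no radius is halved.\<close>
  let ?V = "U \<inter> (\<Inter>x\<in>X. V x)"
  have "\<exists>i. ?V #> y \<subseteq> W i" if y: "y \<in> A" for y
  proof -
    obtain x where x: "x \<in> X" "y \<in> V x #> x" using X y by auto
    have Vx: "subgroup (V x) G" using V x X opsubD(1) by blast
    have "V x #> y = V x #> x" using r_coset_eq_iff[OF Vx, of y x] x X y Ac by auto
    moreover have "?V #> y \<subseteq> V x #> y" using x by (auto simp: r_coset_def)
    moreover have "x \<in> A" using x X by blast
    ultimately show ?thesis using V[of x] by (metis subset_trans)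
  qed
  then show ?thesis using fin[OF X(1,2)] by (intro exI[of _ ?V]) simp
qed

text \<open>A Lebesgue subgroup \<open>V\<close> for the cover of \<open>A\<close> allows splitting
  \<open>A\<close> along \<open>V\<close>-cosets: each coset lies in some \<open>W i\<close>. The
  pieces \<open>B i\<close> are \<open>V\<close>-invariant, hence closed in \<open>A\<close> and
  again blocks, all measured by the one subgroup \<open>V\<close>.\<close>

lemma hcontent_countably_subadd:
  assumes O: "\<And>i. openin T (W i)"
  shows "hcontent (\<Union>i::nat. W i) \<le> (\<Sum>i. hcontent (W i))"
proof (rule hcontent_leI)
  fix U A assume A: "blk U A" "A \<subseteq> (\<Union>i. W i)"
  obtain V where V: "opsub V" "V \<subseteq> U" "\<And>x. x \<in> A \<Longrightarrow> \<exists>i. V #> x \<subseteq> W i"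
    using lebesgue_opsub[OF blkD(2,1)[OF A(1)] O A(2)] by blast
  note sV = opsubD(1)[OF V(1)]
  note AV = blk_mono[OF A(1) V(1,2)]
  define B where "B i = {x \<in> A. V #> x \<subseteq> W i}" for i
  have Binv: "v \<otimes> x \<in> B i" if "v \<in> V" "x \<in> B i" for v x i
  proof -
    have c: "x \<in> carrier G" "v \<in> carrier G" using that blkD(3)[OF A(1)] opsubD(4)[OF V(1)] by (auto simp: B_def)
    have "V #> (v \<otimes> x) = V #> x"
      using r_coset_eq_iff[OF sV, of "v \<otimes> x" x] c that by (auto simp: mem_r_coset_iff)
    then show ?thesis using that blkD(4)[OF AV] by (auto simp: B_def)
  qed
  have blkB: "blk V (B i)" for i
  proof -
    have comp: "openin T (carrier G - B i)"
    proof (rule openin_opsub_inv[OF V(1)])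
      fix v x assume vx: "v \<in> V" "x \<in> carrier G - B i"
      then have vc: "v \<in> carrier G" "inv v \<in> V" using opsubD(4)[OF V(1)] subgroup.m_inv_closed[OF sV] by auto
      have "v \<otimes> x \<notin> B i"
      proof
        assume "v \<otimes> x \<in> B i"
        then have "inv v \<otimes> (v \<otimes> x) \<in> B i" using Binv vc by blast
        then show False using vx vc by (simp add: inv_cancel)
      qed
      then show "v \<otimes> x \<in> carrier G - B i" using vx vc by auto
    qed auto
    have "B i \<subseteq> carrier G" using blkD(3)[OF A(1)] by (auto simp: B_def)
    then have "closedin T (B i)" using comp by (simp add: closedin_def topspace_G)
    then have "compactin T (B i)" using blkD(2)[OF A(1)] by (rule closed_compactin[rotated 2]) (auto simp: B_def)
    then show ?thesis using V(1) Binv by (auto simp: blk_def)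
  qed
  have "A \<subseteq> (\<Union>i. B i)" using V(3) by (auto simp: B_def)
  then have "vol U A \<le> vol V (\<Union>i. B i)" using vol_refine[OF A(1) V(1,2)] vol_mono by metis
  also have "\<dots> \<le> (\<Sum>i. vol V (B i))" by (rule vol_UN_le)
  also have "\<dots> \<le> (\<Sum>i. hcontent (W i))"
  proof (intro suminf_le vol_le_hcontent[OF blkB])
    fix i show "B i \<subseteq> W i"
      using rcos_self[OF _ sV] blkD(3)[OF A(1)] by (auto simp: B_def)
  qed auto
  finally show "vol U A \<le> (\<Sum>i. hcontent (W i))" .
qed

end

section \<open>From the content to a right Haar measure by Caratheodory's method\<close>

lemma space_borel_of: "space (borel_of T) = topspace T"
  by (simp add: borel_of_def space_measure_of_conv)

lemma sets_borel_of: "sets (borel_of T) = sigma_sets (topspace T) {U. openin T U}"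
  unfolding borel_of_def by (intro sets_measure_of) (auto dest: openin_subset)

lemma borel_of_open: "openin T A \<Longrightarrow> A \<in> sets (borel_of T)"
  by (simp add: sets_borel_of sigma_sets.Basic)

lemma continuous_map_measurable:
  assumes "continuous_map S T f" shows "f \<in> measurable (borel_of S) (borel_of T)"
proof (rule measurable_sigma_sets[of _ "topspace T" "{U. openin T U}"])
  fix A assume "A \<in> {U. openin T U}"
  then have "openin S {x \<in> topspace S. f x \<in> A}" using assms by (auto simp: continuous_map_def)
  moreover have "f -` A \<inter> space (borel_of S) = {x \<in> topspace S. f x \<in> A}"
    by (auto simp: space_borel_of)
  ultimately show "f -` A \<inter> space (borel_of S) \<in> sets (borel_of S)" by (simp add: borel_of_open)
qed (use assms in \<open>auto simp: sets_borel_of space_borel_of continuous_map_def dest: openin_subset\<close>)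

context tdlc_group
begin

definition haar_outer :: "'a set \<Rightarrow> ennreal" where
  "haar_outer X = (INF W\<in>{W. openin T W \<and> X \<subseteq> W}. hcontent W)"

lemma haar_outer_open: "openin T W \<Longrightarrow> haar_outer W = hcontent W"
  unfolding haar_outer_def by (intro antisym INF_lower INF_greatest hcontent_mono) auto

lemma haar_outer_le: "openin T W \<Longrightarrow> X \<subseteq> W \<Longrightarrow> haar_outer X \<le> hcontent W"
  unfolding haar_outer_def by (intro INF_lower) auto

lemma haar_outer_mono: "X \<subseteq> Y \<Longrightarrow> haar_outer X \<le> haar_outer Y"
  unfolding haar_outer_def by (intro INF_superset_mono) auto

lemma haar_outer_greatest:
  assumes "\<And>W. openin T W \<Longrightarrow> X \<subseteq> W \<Longrightarrow> c \<le> hcontent W" shows "c \<le> haar_outer X"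
  unfolding haar_outer_def by (rule INF_greatest) (use assms in auto)

lemma haar_outer_countably_subadd:
  assumes X: "\<And>i::nat. X i \<subseteq> carrier G"
  shows "haar_outer (\<Union>i. X i) \<le> (\<Sum>i. haar_outer (X i))"
proof (cases "\<exists>i. haar_outer (X i) = \<infinity>")
  case True
  then obtain i where "haar_outer (X i) = \<infinity>" by blast
  then have "(\<Sum>i. haar_outer (X i)) = \<infinity>"
    using sum_le_suminf[of "\<lambda>i. haar_outer (X i)" "{i}"] by (simp add: top_unique)
  then show ?thesis by simp
next
  case False
  show ?thesis
  proof (rule ennreal_le_epsilon)
    fix e :: real assume e: "0 < e"
    have "\<exists>W. openin T W \<and> X i \<subseteq> W \<and> hcontent W \<le> haar_outer (X i) + ennreal (e * (1/2) ^ Suc i)" for i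
    proof -
      have "haar_outer (X i) < haar_outer (X i) + ennreal (e * (1/2) ^ Suc i)"
        using False e by (simp add: ennreal_less_top less_top[symmetric] ennreal_add_left_cancel_less[of _ 0, simplified])
      then show ?thesis
        unfolding haar_outer_def[of "X i"] INF_less_iff using less_imp_le by blast
    qed
    then obtain W where W: "\<And>i. openin T (W i)" "\<And>i. X i \<subseteq> W i"
      "\<And>i. hcontent (W i) \<le> haar_outer (X i) + ennreal (e * (1/2) ^ Suc i)" by metis
    have "haar_outer (\<Union>i. X i) \<le> hcontent (\<Union>i. W i)"
      using W by (intro haar_outer_le openin_Union) auto
    also have "\<dots> \<le> (\<Sum>i. hcontent (W i))" by (rule hcontent_countably_subadd[OF W(1)])
    also have "\<dots> \<le> (\<Sum>i. haar_outer (X i) + ennreal (e * (1/2) ^ Suc i))"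
      by (intro suminf_le W(3)) auto
    also have "\<dots> = (\<Sum>i. haar_outer (X i)) + (\<Sum>i. ennreal (e * (1/2) ^ Suc i))"
      by (intro suminf_add[symmetric]) auto
    also have "(\<Sum>i. ennreal (e * (1/2) ^ Suc i)) = ennreal e"
    proof -
      have "(\<lambda>i. e * (1/2) ^ Suc i) sums (e * 1)" by (intro sums_mult power_half_series)
      then show ?thesis using e by (intro suminf_ennreal_eq) auto
    qed
    finally show "haar_outer (\<Union>i. X i) \<le> (\<Sum>i. haar_outer (X i)) + ennreal e" .
  qed
qed

lemma haar_outer_measure_space: "outer_measure_space (Pow (carrier G)) haar_outer"
  unfolding outer_measure_space_def positive_def increasing_def countably_subadditive_def
proof (intro conjI ballI allI impI)
  show "haar_outer {} = 0" using haar_outer_open[of "{}"] hcontent_empty by simp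
  fix A :: "nat \<Rightarrow> 'a set" assume "range A \<subseteq> Pow (carrier G)"
  then show "haar_outer (\<Union>i. A i) \<le> (\<Sum>i. haar_outer (A i))"
    by (intro haar_outer_countably_subadd) blast
qed (rule haar_outer_mono)

lemma blk_diff_open:
  assumes "blk U A" "openin T W" shows "openin T (W - A)"
proof -
  have "openin T (carrier G - A)"
  proof (rule openin_opsub_inv[OF blkD(1)[OF assms(1)]])
    fix u x assume ux: "u \<in> U" "x \<in> carrier G - A"
    then have uc: "u \<in> carrier G" "inv u \<in> U"
      using opsubD(1,4)[OF blkD(1)[OF assms(1)]] subgroup.m_inv_closed by auto
    have "u \<otimes> x \<notin> A"
    proof
      assume "u \<otimes> x \<in> A"
      then have "inv u \<otimes> (u \<otimes> x) \<in> A" using blkD(4)[OF assms(1)] uc by blast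
      then show False using ux uc by (simp add: inv_cancel)
    qed
    then show "u \<otimes> x \<in> carrier G - A" using ux uc by auto
  qed auto
  moreover have "W - A = W \<inter> (carrier G - A)" using openin_subset[OF assms(2)] topspace_G by auto
  ultimately show ?thesis using assms(2) by (simp add: openin_Int)
qed

text \<open>For open \<open>V\<close> around \<open>X\<close>, the set \<open>V - W\<close> need not
  be open. It is enlarged to \<open>V - A\<close> for a block \<open>A\<close> inside
  \<open>V \<inter> W\<close>, which is open because blocks are closed; superadditivity for
  \<open>A\<close> and \<open>V - A\<close> then gives the nontrivial inequality.\<close>

lemma open_caratheodory:
  assumes W: "openin T W" shows "W \<in> lambda_system (carrier G) (Pow (carrier G)) haar_outer"
proof -
  interpret sigma_algebra "carrier G" "Pow (carrier G)" by (rule sigma_algebra_Pow)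
  have Wc: "W \<subseteq> carrier G" using openin_subset[OF W] topspace_G by simp
  have "haar_outer (X \<inter> W) + haar_outer (X - W) = haar_outer X" if X: "X \<subseteq> carrier G" for X
  proof (rule antisym)
    show "haar_outer (X \<inter> W) + haar_outer (X - W) \<le> haar_outer X"
    proof (rule haar_outer_greatest)
      fix V assume V: "openin T V" "X \<subseteq> V"
      have "haar_outer (X \<inter> W) + haar_outer (X - W) \<le> hcontent (V \<inter> W) + haar_outer (V - W)"
        using V W by (intro add_mono haar_outer_le haar_outer_mono) auto
      also have "\<dots> \<le> hcontent V"
      proof (rule hcontent_add_le)
        fix U A assume A: "blk U A" "A \<subseteq> V \<inter> W"
        have "vol U A + haar_outer (V - W) \<le> hcontent A + hcontent (V - A)"
          using A V by (intro add_mono vol_le_hcontent haar_outer_le blk_diff_open) auto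
        also have "\<dots> \<le> hcontent (A \<union> (V - A))" by (rule hcontent_superadd) auto
        also have "A \<union> (V - A) = V" using A by auto
        finally show "vol U A + haar_outer (V - W) \<le> hcontent V" .
      qed
      finally show "haar_outer (X \<inter> W) + haar_outer (X - W) \<le> hcontent V" .
    qed
    \<comment> \<open>Two sets padded with empty ones, so that countable subadditivity gives the
      other inequality.\<close>
    let ?X = "\<lambda>i::nat. if i = 0 then X \<inter> W else if i = 1 then X - W else {}"
    have "haar_outer (\<Union>i. ?X i) \<le> (\<Sum>i. haar_outer (?X i))"
      using X by (intro haar_outer_countably_subadd) auto
    also have "(\<Sum>i. haar_outer (?X i)) = (\<Sum>i\<in>{0,1}. haar_outer (?X i))"
      using haar_outer_open[of "{}"] hcontent_empty by (intro suminf_finite) auto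
    also have "\<dots> = haar_outer (X \<inter> W) + haar_outer (X - W)" by simp
    also have "(\<Union>i. ?X i) = X" by (auto split: if_splits)
    finally show "haar_outer X \<le> haar_outer (X \<inter> W) + haar_outer (X - W)" .
  qed
  then show ?thesis using Wc by (simp add: lambda_system_eq)
qed

definition haar :: "'a measure" where
  "haar = measure_of (carrier G) {U. openin T U} haar_outer"

lemma space_haar: "space haar = carrier G" by (simp add: haar_def space_measure_of_conv)

lemma sets_haar: "sets haar = sets (borel_of T)"
  unfolding haar_def sets_borel_of topspace_G by (intro sets_measure_of) (use topspace_G in \<open>auto dest: openin_subset\<close>)

lemma emeasure_haar:
  assumes "A \<in> sets (borel_of T)" shows "emeasure haar A = haar_outer A"
proof -
  let ?L = "lambda_system (carrier G) (Pow (carrier G)) haar_outer"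
  interpret sigma_algebra "carrier G" "Pow (carrier G)" by (rule sigma_algebra_Pow)
  have ms: "measure_space (carrier G) ?L haar_outer"
    by (rule caratheodory_lemma[OF haar_outer_measure_space])
  have sub: "sigma_sets (carrier G) {U. openin T U} \<subseteq> ?L"
    using ms open_caratheodory by (intro sigma_algebra.sigma_sets_subset) (auto simp: measure_space_def)
  have op: "{U. openin T U} \<subseteq> Pow (carrier G)" using topspace_G openin_subset by auto
  show ?thesis
  proof (rule emeasure_measure_of[OF haar_def])
    show "{U. openin T U} \<subseteq> Pow (carrier G)" by (fact op)
    show "A \<in> sets haar" using assms sets_haar by simp
    have s: "sets haar = sigma_sets (carrier G) {U. openin T U}" using sets_haar sets_borel_of topspace_G by metis
    show "positive (sets haar) haar_outer" using ms by (auto simp: measure_space_def positive_def)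
    show "countably_additive (sets haar) haar_outer"
      using ms sub unfolding measure_space_def countably_additive_def s by blast
  qed
qed

text \<open>Volumes count right cosets, and right translation permutes these. This is why the
  construction yields a right-invariant measure.\<close>

lemma vol_translate:
  assumes A: "blk U A" and g: "g \<in> carrier G"
  shows "blk U (A #> g)" "vol U (A #> g) = vol U A"
proof -
  note sU = opsubD(1,4)[OF blkD(1)[OF A]]
  have Ac: "A \<subseteq> carrier G" by (rule blkD(3)[OF A])
  have im: "A #> g = (\<lambda>x. x \<otimes> g) ` A" by (auto simp: r_coset_def)
  have "compactin T (A #> g)"
    unfolding im using continuous_map_rtrans[OF g] blkD(2)[OF A] by (rule image_compactin[rotated])
  moreover have "u \<otimes> x \<in> A #> g" if u: "u \<in> U" and x: "x \<in> A #> g" for u x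
  proof -
    obtain a where a: "a \<in> A" "x = a \<otimes> g" using x by (auto simp: r_coset_def)
    then have "u \<otimes> x = (u \<otimes> a) \<otimes> g" using u sU(2) Ac g by (simp add: m_assoc subset_iff)
    then show ?thesis using blkD(4)[OF A u a(1)] by (auto simp: r_coset_def)
  qed
  ultimately show b: "blk U (A #> g)" using blkD(1)[OF A] by (auto simp: blk_def)
  have "csum G U (indicator (A #> g)) = csum G U (\<lambda>x. indicator (A #> g) (x \<otimes> g))"
    by (rule csum_translate[OF sU(1) blk_left_inv[OF b] g, symmetric])
  also have "\<dots> = csum G U (indicator A)"
  proof (rule csum_cong)
    fix x assume x: "x \<in> carrier G"
    have "x \<otimes> g \<in> A #> g \<longleftrightarrow> x \<in> A"
      unfolding mem_r_coset_iff using x g Ac right_cancel by blast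
    then show "indicator (A #> g) (x \<otimes> g) = (indicator A x :: ennreal)" by (simp add: indicator_def)
  qed
  finally show "vol U (A #> g) = vol U A" by (simp add: vol_def)
qed

lemma hcontent_translate_le:
  assumes W: "W \<subseteq> carrier G" and g: "g \<in> carrier G" shows "hcontent W \<le> hcontent (W #> g)"
proof (rule hcontent_leI)
  fix U A assume A: "blk U A" "A \<subseteq> W"
  have "A #> g \<subseteq> W #> g" using A(2) by (auto simp: r_coset_def)
  then show "vol U A \<le> hcontent (W #> g)"
    using vol_translate[OF A(1) g] vol_le_hcontent by metis
qed

lemma r_coset_inv_cancel:
  assumes "X \<subseteq> carrier G" "g \<in> carrier G" shows "X #> g #> inv g = X" "X #> inv g #> g = X"
  using assms by (simp_all add: coset_mult_assoc)

text \<open>One inequality is enough: applied to the translated set and \<open>inv g\<close> it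
  gives the reverse one.\<close>

lemma haar_outer_translate_le:
  assumes X: "X \<subseteq> carrier G" and g: "g \<in> carrier G" shows "haar_outer X \<le> haar_outer (X #> g)"
proof (rule haar_outer_greatest)
  fix W assume W: "openin T W" "X #> g \<subseteq> W"
  have Wc: "W \<subseteq> carrier G" using openin_subset[OF W(1)] topspace_G by simp
  have "X \<subseteq> W #> inv g"
    using r_coset_inv_cancel(1)[OF X g] W(2) by (auto simp: r_coset_def)
  then have "haar_outer X \<le> hcontent (W #> inv g)" using W g by (intro haar_outer_le openin_rcoset) auto
  also have "\<dots> \<le> hcontent (W #> inv g #> g)"
    using Wc g by (intro hcontent_translate_le r_coset_subset_G) auto
  finally show "haar_outer X \<le> hcontent W" using r_coset_inv_cancel(2)[OF Wc g] by simp
qed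

lemma right_haar_haar: "right_haar G T haar"
  unfolding right_haar_def
proof (intro conjI allI impI ballI)
  show "space haar = space (borel_of T)" by (simp add: space_haar space_borel_of topspace_G)
  show "sets haar = sets (borel_of T)" by (rule sets_haar)
  \<comment> \<open>Compact sets are not known to be Borel here; on a non-measurable set
    \<open>emeasure\<close> is 0, so the bound still holds.\<close>
  have em: "emeasure haar A \<le> haar_outer A" for A
    using emeasure_haar[of A] sets_haar by (cases "A \<in> sets haar") (auto simp: emeasure_notin_sets)
  have em_open: "emeasure haar W = hcontent W" if "openin T W" for W
    using emeasure_haar[OF borel_of_open[OF that]] haar_outer_open[OF that] by simp
  show "emeasure haar C < \<infinity>" if C: "compactin T C" for C
  proof -
    have Cc: "C \<subseteq> carrier G" using compactin_subset_topspace[OF C] topspace_G by simp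
    \<comment> \<open>The \<open>K\<close>-saturation of \<open>C\<close> is a finite union of
      compact cosets, hence a block; its content is its finite volume.\<close>
    define A where "A = \<Union>((\<lambda>x. K #> x) ` C)"
    have fin: "finite ((\<lambda>x. K #> x) ` C)" by (rule finite_coset_cover[OF opsub_K C])
    have CA: "C \<subseteq> A" unfolding A_def using rcos_self[OF _ K(1)] Cc by blast
    have "compactin T A"
      unfolding A_def
    proof (rule compactin_Union[OF fin])
      fix D assume "D \<in> (\<lambda>x. K #> x) ` C"
      then obtain x where x: "x \<in> C" "D = K #> x" by auto
      then show "compactin T D" using vol_translate(1)[OF blk_K[OF opsub_K]] Cc blkD(2) by blast
    qed
    moreover have "k \<otimes> a \<in> A" if k: "k \<in> K" and a: "a \<in> A" for k a
    proof -
      obtain x where x: "x \<in> C" "a \<in> K #> x" using a unfolding A_def by blast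
      then have "k \<otimes> a \<in> K #> x"
        using k vol_translate(1)[OF blk_K[OF opsub_K], of x] Cc blkD(4) by blast
      then show ?thesis using x unfolding A_def by blast
    qed
    ultimately have A: "blk K A" using opsub_K by (simp add: blk_def)
    have "hcontent A \<le> vol K A"
    proof (rule hcontent_leI)
      fix U B assume B: "blk U B" "B \<subseteq> A"
      have "vol U B \<le> vol U A" by (rule vol_mono[OF B(2)])
      also have "\<dots> = vol K A" using vol_refine[OF A blkD(1)[OF B(1)] opsubD(3)[OF blkD(1)[OF B(1)]]] .
      finally show "vol U B \<le> vol K A" .
    qed
    also have "\<dots> < \<infinity>"
      unfolding vol_def using csum_indicator_finite[OF A] idx_bounds[OF opsub_K]
      by (auto simp: divide_ennreal_def ennreal_mult_eq_top_iff less_top[symmetric] ennreal_inverse_eq_top_iff)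
    finally have "hcontent A < \<infinity>" .
    moreover have "emeasure haar C \<le> hcontent A"
      using em[of C] haar_outer_le[OF blk_open[OF A] CA] by (rule order_trans)
    ultimately show ?thesis by (rule order_le_less_trans[rotated])
  qed
  show "emeasure haar A = (INF W\<in>{W. openin T W \<and> A \<subseteq> W}. emeasure haar W)" if "A \<in> sets haar" for A
    using emeasure_haar that sets_haar em_open unfolding haar_outer_def by (auto intro!: INF_cong)
  show "emeasure haar W = (SUP C\<in>{C. compactin T C \<and> C \<subseteq> W}. emeasure haar C)" if W: "openin T W" for W
  proof (rule antisym)
    show "emeasure haar W \<le> (SUP C\<in>{C. compactin T C \<and> C \<subseteq> W}. emeasure haar C)"
      unfolding em_open[OF W]
    proof (rule hcontent_leI)
      fix U A assume A: "blk U A" "A \<subseteq> W"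
      have "vol U A \<le> emeasure haar A" using em_open[OF blk_open[OF A(1)]] vol_le_hcontent[OF A(1) order_refl] by simp
      also have "\<dots> \<le> (SUP C\<in>{C. compactin T C \<and> C \<subseteq> W}. emeasure haar C)"
        using A blkD(2) by (intro SUP_upper) auto
      finally show "vol U A \<le> (SUP C\<in>{C. compactin T C \<and> C \<subseteq> W}. emeasure haar C)" .
    qed
    show "(SUP C\<in>{C. compactin T C \<and> C \<subseteq> W}. emeasure haar C) \<le> emeasure haar W"
      using sets_haar borel_of_open[OF W] by (intro SUP_least emeasure_mono) auto
  qed
  show "emeasure haar (carrier G) \<noteq> 0"
  proof -
    have "0 < vol K K" unfolding vol_def using idx_bounds[OF opsub_K]
      by (simp add: ennreal_zero_less_divide)
    also have "\<dots> \<le> hcontent (carrier G)"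
      using blk_K[OF opsub_K] opsubD(4)[OF opsub_K] by (rule vol_le_hcontent)
    finally show ?thesis using em_open[of "carrier G"] topspace_G openin_topspace[of T] by simp
  qed
  fix A g assume A: "A \<in> sets haar" and g: "g \<in> carrier G"
  have Ac: "A \<subseteq> carrier G" using sets.sets_into_space[OF A] space_haar by simp
  have "(\<lambda>x. x \<otimes> inv g) -` A \<inter> space (borel_of T) \<in> sets (borel_of T)"
    using continuous_map_measurable[OF continuous_map_rtrans[of "inv g"]] g A sets_haar by (auto intro: measurable_sets)
  moreover have "(\<lambda>x. x \<otimes> inv g) -` A \<inter> space (borel_of T) = A #> g"
    unfolding space_borel_of topspace_G
  proof (intro equalityI subsetI)
    fix x assume x: "x \<in> (\<lambda>x. x \<otimes> inv g) -` A \<inter> carrier G"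
    then have "x = (x \<otimes> inv g) \<otimes> g" using g by (simp add: m_assoc)
    then show "x \<in> A #> g" unfolding mem_r_coset_iff using x by blast
  next
    fix x assume "x \<in> A #> g"
    then obtain a where "a \<in> A" "x = a \<otimes> g" unfolding mem_r_coset_iff by blast
    moreover from this have "a \<in> carrier G" using Ac by blast
    ultimately show "x \<in> (\<lambda>x. x \<otimes> inv g) -` A \<inter> carrier G" using g by (simp add: m_assoc)
  qed
  ultimately have Ag: "A #> g \<in> sets (borel_of T)" by simp
  then show "A #> g \<in> sets haar" using sets_haar by simp
  have "haar_outer (A #> g) \<le> haar_outer (A #> g #> inv g)"
    using Ac g by (intro haar_outer_translate_le r_coset_subset_G) auto
  then have "haar_outer (A #> g) = haar_outer A"
    using haar_outer_translate_le[OF Ac g] r_coset_inv_cancel(1)[OF Ac g] by simp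
  then show "emeasure haar (A #> g) = emeasure haar A" using emeasure_haar Ag A sets_haar by simp
qed

end

section \<open>Rapid decay with respect to Haar measure\<close>

text \<open>The measure is arbitrary, because \<open>group_RD\<close> only provides some right Haar
  measure. Deriving the coset inequality from it thus needs no uniqueness theorem.\<close>

locale tdlc_haar = tdlc_group G T K for G :: "'a monoid" (structure) and T K +
  fixes \<mu> :: "'a measure"
  assumes \<mu>: "right_haar G T \<mu>"
begin

lemma sets_\<mu>: "sets \<mu> = sets (borel_of T)" and space_\<mu>: "space \<mu> = carrier G"
  using \<mu> by (auto simp: right_haar_def space_borel_of topspace_G)

lemma measurable_\<mu>: "measurable \<mu> N = measurable (borel_of T) N"
  by (rule measurable_cong_sets) (auto simp: sets_\<mu>)

lemma opsub_coset_sets: "opsub U \<Longrightarrow> x \<in> carrier G \<Longrightarrow> U #> x \<in> sets \<mu>"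
  using opsub_coset_open borel_of_open sets_\<mu> by auto

lemma opsub_sets: "opsub U \<Longrightarrow> U \<in> sets \<mu>"
  using opsubD(2) borel_of_open sets_\<mu> by auto

lemma emeasure_coset: "opsub U \<Longrightarrow> x \<in> carrier G \<Longrightarrow> emeasure \<mu> (U #> x) = emeasure \<mu> U"
  using \<mu> opsub_sets by (auto simp: right_haar_def)

lemma emeasure_opsub_finite: "opsub U \<Longrightarrow> emeasure \<mu> U < \<infinity>"
  using \<mu> opsub_closed_compact by (auto simp: right_haar_def)

text \<open>If \<open>U\<close> were null, so would be every compact set, being covered by finitely
  many translates of \<open>U\<close>. Inner regularity of the whole group would then make the
  measure zero.\<close>

lemma emeasure_opsub_pos: assumes U: "opsub U" shows "0 < emeasure \<mu> U"
proof (rule ccontr)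
  assume "\<not> ?thesis"
  then have 0: "emeasure \<mu> U = 0" by simp
  have "emeasure \<mu> C \<le> 0" if C: "compactin T C" for C
  proof -
    have Cc: "C \<subseteq> carrier G" using compactin_subset_topspace[OF C] topspace_G by simp
    let ?I = "(\<lambda>x. U #> x) ` C"
    have fin: "finite ?I" by (rule finite_coset_cover[OF U C])
    have sets: "D \<in> sets \<mu>" "emeasure \<mu> D = 0" if "D \<in> ?I" for D
      using that opsub_coset_sets[OF U] emeasure_coset[OF U] 0 Cc by auto
    have "emeasure \<mu> C \<le> emeasure \<mu> (\<Union>D\<in>?I. D)"
      using rcos_self[OF _ opsubD(1)[OF U]] Cc sets(1) fin
      by (intro emeasure_mono sets.finite_UN) blast+
    also have "\<dots> \<le> (\<Sum>D\<in>?I. emeasure \<mu> D)"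
      using sets(1) fin by (intro emeasure_subadditive_finite) auto
    also have "\<dots> = 0" using sets(2) by (intro sum.neutral) auto
    finally show ?thesis .
  qed
  moreover have "emeasure \<mu> (carrier G) = (SUP C\<in>{C. compactin T C \<and> C \<subseteq> carrier G}. emeasure \<mu> C)"
    using \<mu> openin_topspace[of T] topspace_G by (auto simp: right_haar_def)
  ultimately have "emeasure \<mu> (carrier G) \<le> 0" by (simp only:) (rule SUP_least, simp)
  then show False using \<mu> by (simp add: right_haar_def)
qed

lemma rcosets_disjoint:
  assumes U: "subgroup U G" and D: "D \<in> rcosets U" and x: "x \<in> D"
  shows "x \<in> carrier G" "U #> x = D"
proof -
  obtain y where y: "y \<in> carrier G" "D = U #> y" using D by (rule rcosetE)
  then show xc: "x \<in> carrier G" using x r_coset_subset_G[OF subgroup.subset[OF U]] by blast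
  show "U #> x = D" using x y r_coset_eq_iff[OF U xc, of y] by simp
qed

lemma rcoset_sets: "opsub U \<Longrightarrow> D \<in> rcosets U \<Longrightarrow> D \<in> sets \<mu> \<and> emeasure \<mu> D = emeasure \<mu> U"
  using opsub_coset_sets emeasure_coset by (auto elim!: rcosetE)

text \<open>Only finite families of disjoint cosets are compared with the full integral, so
  uncountably many cosets cause no difficulty.\<close>

lemma csum_coset_integrals_le:
  assumes U: "opsub U" and h [measurable]: "h \<in> borel_measurable \<mu>"
  shows "csum G U (\<lambda>x. \<integral>\<^sup>+y. h y * indicator (U #> x) y \<partial>\<mu>) \<le> (\<integral>\<^sup>+y. h y \<partial>\<mu>)"
  unfolding csum_def
proof (rule nn_integral_count_space_leI)
  fix F assume F: "finite F" "F \<subseteq> rcosets U"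
  have [measurable]: "D \<in> sets \<mu>" if "D \<in> F" for D using rcoset_sets[OF U] F that by auto
  have "(\<Sum>D\<in>F. \<integral>\<^sup>+y. h y * indicator (U #> coset_rep G U D) y \<partial>\<mu>) = (\<Sum>D\<in>F. \<integral>\<^sup>+y. h y * indicator D y \<partial>\<mu>)"
    using F coset_rep(2) by (intro sum.cong) auto
  also have "\<dots> = (\<integral>\<^sup>+y. (\<Sum>D\<in>F. h y * indicator D y) \<partial>\<mu>)"
    by (rule nn_integral_sum[symmetric]) measurable
  also have "\<dots> \<le> (\<integral>\<^sup>+y. h y \<partial>\<mu>)"
  proof (rule nn_integral_mono)
    fix y
    have "(\<Sum>D\<in>F. h y * indicator D y) \<le> (\<Sum>D\<in>{U #> y}. h y * indicator D y)"
    proof (cases "U #> y \<in> F")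
      case True
      then have "(\<Sum>D\<in>F. h y * indicator D y) = (\<Sum>D\<in>{U #> y}. h y * indicator D y)"
        using F rcosets_disjoint[OF opsubD(1)[OF U]]
        by (intro sum.mono_neutral_right) (auto simp: indicator_def)
      then show ?thesis by simp
    next
      case False
      then have "(\<Sum>D\<in>F. h y * indicator D y) = 0"
        using F rcosets_disjoint[OF opsubD(1)[OF U]] by (intro sum.neutral) (auto simp: indicator_def)
      then show ?thesis by simp
    qed
    also have "\<dots> \<le> h y" by (cases "y \<in> U #> y") simp_all
    finally show "(\<Sum>D\<in>F. h y * indicator D y) \<le> h y" .
  qed
  finally show "(\<Sum>D\<in>F. \<integral>\<^sup>+y. h y * indicator (U #> coset_rep G U D) y \<partial>\<mu>) \<le> (\<integral>\<^sup>+y. h y \<partial>\<mu>)" .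
qed

lemma left_inv_measurable:
  assumes "opsub U" "left_inv G U \<phi>" "space N = UNIV"
  shows "\<phi> \<in> measurable \<mu> N"
  unfolding measurable_\<mu>
  using borel_of_left_inv[OF opsubD(1)[OF assms(1)] opsub_coset_open[OF assms(1)] topspace_G assms(2,3)]
  by blast

lemma nn_integral_coset_const:
  assumes U: "opsub U" and \<phi>: "left_inv G U \<phi>" and D: "D \<in> rcosets U"
  shows "(\<integral>\<^sup>+y. \<phi> y * indicator D y \<partial>\<mu>) = \<phi> (coset_rep G U D) * emeasure \<mu> U"
proof -
  have "(\<integral>\<^sup>+y. \<phi> y * indicator D y \<partial>\<mu>) = (\<integral>\<^sup>+y. \<phi> (coset_rep G U D) * indicator D y \<partial>\<mu>)"
  proof (rule nn_integral_cong)
    fix y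
    show "\<phi> y * indicator D y = \<phi> (coset_rep G U D) * indicator D y"
      using left_inv_rep[OF opsubD(1)[OF U] \<phi>, of y] rcosets_disjoint[OF opsubD(1)[OF U] D, of y]
      by (cases "y \<in> D") simp_all
  qed
  also have "\<dots> = \<phi> (coset_rep G U D) * emeasure \<mu> U"
    using rcoset_sets[OF U D] by (simp add: nn_integral_cmult_indicator)
  finally show ?thesis .
qed

text \<open>The upper bound is the harder half. If the coset sum is infinite, positivity of
  \<open>\<mu>(U)\<close> settles it; if it is finite, only countably many cosets carry the function
  and sum and integral may be exchanged.\<close>

lemma nn_integral_left_inv:
  assumes U: "opsub U" and \<phi>: "left_inv G U \<phi>"
  shows "(\<integral>\<^sup>+y. \<phi> y \<partial>\<mu>) = emeasure \<mu> U * csum G U \<phi>"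
proof (rule antisym)
  note sU = opsubD(1)[OF U]
  have [measurable]: "\<phi> \<in> borel_measurable \<mu>" using left_inv_measurable[OF U \<phi>] by simp
  have "emeasure \<mu> U * csum G U \<phi> = csum G U (\<lambda>x. \<integral>\<^sup>+y. \<phi> y * indicator (U #> x) y \<partial>\<mu>)"
    unfolding csum_cmult[symmetric]
  proof (rule csum_cong)
    fix x assume x: "x \<in> carrier G"
    show "emeasure \<mu> U * \<phi> x = (\<integral>\<^sup>+y. \<phi> y * indicator (U #> x) y \<partial>\<mu>)"
      using nn_integral_coset_const[OF U \<phi> rcosets_memI[OF x]] left_inv_rep[OF sU \<phi> x] by (simp add: mult.commute)
  qed
  also have "\<dots> \<le> (\<integral>\<^sup>+y. \<phi> y \<partial>\<mu>)" by (rule csum_coset_integrals_le[OF U]) measurable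
  finally show "emeasure \<mu> U * csum G U \<phi> \<le> (\<integral>\<^sup>+y. \<phi> y \<partial>\<mu>)" .
  show "(\<integral>\<^sup>+y. \<phi> y \<partial>\<mu>) \<le> emeasure \<mu> U * csum G U \<phi>"
  proof (cases "csum G U \<phi> < \<infinity>")
    case False
    then have "csum G U \<phi> = \<infinity>" by (simp add: not_less top_unique)
    then show ?thesis using emeasure_opsub_pos[OF U] by (simp add: ennreal_mult_top)
  next
    case True
    define I where "I = {D \<in> rcosets U. \<phi> (coset_rep G U D) \<noteq> 0}"
    have I: "countable I" "I \<subseteq> rcosets U"
      using countable_support_count_space True unfolding I_def csum_def by auto
    have sets [measurable]: "D \<in> sets \<mu>" if "D \<in> I" for D using rcoset_sets[OF U] I that by auto
    have "(\<integral>\<^sup>+y. \<phi> y \<partial>\<mu>) = (\<integral>\<^sup>+y. (\<integral>\<^sup>+D. \<phi> y * indicator D y \<partial>count_space I) \<partial>\<mu>)"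
    proof (rule nn_integral_cong)
      fix y assume "y \<in> space \<mu>"
      then have y: "y \<in> carrier G" by (simp add: space_\<mu>)
      show "\<phi> y = (\<integral>\<^sup>+D. \<phi> y * indicator D y \<partial>count_space I)"
      proof (cases "U #> y \<in> I")
        case True
        have "(\<integral>\<^sup>+D. \<phi> y * indicator D y \<partial>count_space I) = (\<Sum>D\<in>{U #> y}. \<phi> y * indicator D y)"
          using True I rcosets_disjoint[OF sU]
          by (intro nn_integral_count_space') (auto simp: indicator_def)
        then show ?thesis using rcos_self[OF y sU] by simp
      next
        case False
        then have "\<phi> y = 0" using left_inv_rep[OF sU \<phi> y] rcosets_memI[OF y] by (simp add: I_def)
        then show ?thesis by simp
      qed
    qed
    also have "\<dots> = (\<integral>\<^sup>+D. (\<integral>\<^sup>+y. \<phi> y * indicator D y \<partial>\<mu>) \<partial>count_space I)"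
      by (intro nn_integral_count_space_nn_integral I) measurable
    also have "\<dots> = (\<integral>\<^sup>+D. emeasure \<mu> U * \<phi> (coset_rep G U D) \<partial>count_space I)"
      using I nn_integral_coset_const[OF U \<phi>] by (intro nn_integral_cong) (auto simp: mult.commute)
    also have "\<dots> = (\<integral>\<^sup>+D. emeasure \<mu> U * \<phi> (coset_rep G U D) \<partial>count_space (rcosets U))"
      by (rule nn_integral_count_space_eq) (auto simp: I_def)
    also have "\<dots> = emeasure \<mu> U * csum G U \<phi>"
      unfolding csum_def by (rule nn_integral_cmult) auto
    finally show ?thesis by simp
  qed
qed

lemma nn_integral_left_inv_mult:
  assumes U: "opsub U" and \<phi>: "left_inv G U \<phi>" and supp: "fin_supp_mod G U \<phi>"
    and h [measurable]: "h \<in> borel_measurable \<mu>"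
  shows "(\<integral>\<^sup>+y. \<phi> y * h y \<partial>\<mu>) = csum G U (\<lambda>x. \<phi> x * (\<integral>\<^sup>+y. h y * indicator (U #> x) y \<partial>\<mu>))"
proof -
  note sU = opsubD(1)[OF U]
  let ?r = "coset_rep G U"
  define S where "S = {D \<in> rcosets U. \<phi> (?r D) \<noteq> 0}"
  have S: "finite S" "S \<subseteq> rcosets U" unfolding S_def using fin_supp_mod_finite[OF sU supp] by auto
  have [measurable]: "D \<in> sets \<mu>" if "D \<in> S" for D using rcoset_sets[OF U] S that by auto
  have "(\<integral>\<^sup>+y. \<phi> y * h y \<partial>\<mu>) = (\<integral>\<^sup>+y. (\<Sum>D\<in>S. \<phi> (?r D) * (h y * indicator D y)) \<partial>\<mu>)"
  proof (rule nn_integral_cong)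
    fix y assume "y \<in> space \<mu>"
    then have y: "y \<in> carrier G" by (simp add: space_\<mu>)
    show "\<phi> y * h y = (\<Sum>D\<in>S. \<phi> (?r D) * (h y * indicator D y))"
    proof (cases "U #> y \<in> S")
      case True
      have "(\<Sum>D\<in>S. \<phi> (?r D) * (h y * indicator D y)) = (\<Sum>D\<in>{U #> y}. \<phi> (?r D) * (h y * indicator D y))"
        using True S rcosets_disjoint[OF sU] by (intro sum.mono_neutral_right) (auto simp: indicator_def)
      then show ?thesis using rcos_self[OF y sU] left_inv_rep[OF sU \<phi> y] by simp
    next
      case False
      then have "\<phi> y = 0" using left_inv_rep[OF sU \<phi> y] rcosets_memI[OF y] by (simp add: S_def)
      moreover have "(\<Sum>D\<in>S. \<phi> (?r D) * (h y * indicator D y)) = 0"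
        using False S rcosets_disjoint[OF sU] by (intro sum.neutral) (auto simp: indicator_def)
      ultimately show ?thesis by simp
    qed
  qed
  also have "\<dots> = (\<Sum>D\<in>S. \<phi> (?r D) * (\<integral>\<^sup>+y. h y * indicator D y \<partial>\<mu>))"
    by (subst nn_integral_sum) (auto simp: nn_integral_cmult)
  also have "\<dots> = (\<Sum>D\<in>S. \<phi> (?r D) * (\<integral>\<^sup>+y. h y * indicator (U #> ?r D) y \<partial>\<mu>))"
    using S coset_rep(2) by (intro sum.cong) auto
  also have "\<dots> = csum G U (\<lambda>x. \<phi> x * (\<integral>\<^sup>+y. h y * indicator (U #> x) y \<partial>\<mu>))"
    using S by (intro csum_eq_sum[symmetric]) (auto simp: S_def)
  finally show ?thesis .
qed

text \<open>The identity that cancels the index lost to the Hilbert-Schmidt norm.\<close>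

lemma card_transversal_emeasure:
  assumes U: "opsub U" and R: "transversal U K R"
  shows "of_nat (card R) * emeasure \<mu> U = emeasure \<mu> K"
proof -
  have K1: "emeasure \<mu> K = emeasure \<mu> V * csum G V (indicator K)" if "opsub V" for V
    using nn_integral_left_inv[OF that blk_left_inv[OF blk_K[OF that]]] opsub_sets[OF opsub_K] by simp
  have "emeasure \<mu> K = emeasure \<mu> U * (of_nat (card R) * csum G K (indicator K))"
    using K1[OF U] csum_indicator_refine[OF blk_K[OF opsub_K] U opsubD(3)[OF U] R] by simp
  \<comment> \<open>There is just one \<open>K\<close>-coset inside \<open>K\<close>. The value is
    read off from the integral of the indicator by cancelling the finite positive measure of
    \<open>K\<close>.\<close>
  moreover have "csum G K (indicator K) = 1"
  proof -
    have "csum G K (indicator K) * emeasure \<mu> K / emeasure \<mu> K = emeasure \<mu> K / emeasure \<mu> K"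
      using K1[OF opsub_K] by (simp add: mult.commute)
    then show ?thesis
      using emeasure_opsub_pos[OF opsub_K] emeasure_opsub_finite[OF opsub_K]
      by (simp add: mult_divide_eq_ennreal less_top ennreal_divide_self)
  qed
  ultimately show ?thesis by (simp add: mult.commute)
qed

lemma coset_Cauchy_Schwarz:
  assumes U: "opsub U" and x: "x \<in> carrier G" and h [measurable]: "h \<in> borel_measurable \<mu>"
  shows "(\<integral>\<^sup>+y. h y * indicator (U #> x) y \<partial>\<mu>)\<^sup>2
     \<le> emeasure \<mu> U * (\<integral>\<^sup>+y. (h y)\<^sup>2 * indicator (U #> x) y \<partial>\<mu>)"
proof -
  have [measurable]: "U #> x \<in> sets \<mu>" by (rule opsub_coset_sets[OF U x])
  let ?I = "indicator (U #> x) :: 'a \<Rightarrow> ennreal"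
  have "(\<integral>\<^sup>+y. (h y * ?I y) * ?I y \<partial>\<mu>)\<^sup>2 \<le> (\<integral>\<^sup>+y. (h y * ?I y)\<^sup>2 \<partial>\<mu>) * (\<integral>\<^sup>+y. (?I y)\<^sup>2 \<partial>\<mu>)"
    by (rule Cauchy_Schwarz_nn_integral) measurable
  moreover have "(h y * ?I y) * ?I y = h y * ?I y" "(h y * ?I y)\<^sup>2 = (h y)\<^sup>2 * ?I y" "(?I y)\<^sup>2 = ?I y" for y
    by (auto simp: indicator_def)
  ultimately show ?thesis
    using emeasure_coset[OF U x] by (simp add: mult.commute)
qed

end

section \<open>The cosets of the trivial subgroup as a copy of the group\<close>

context plain_group
begin

lemma r_coset_one: "x \<in> carrier G \<Longrightarrow> {\<one>} #> x = {x}"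
  by (simp add: r_coset_def)

lemma rcosets_one: "rcosets {\<one>} = (\<lambda>x. {x}) ` carrier G"
  by (auto simp: RCOSETS_def r_coset_one)

lemma coset_rep_one: "x \<in> carrier G \<Longrightarrow> coset_rep G {\<one>} {x} = x"
  using coset_rep[of "{x}" "{\<one>}"] by (auto simp: rcosets_one r_coset_one)

end

context tdlc_group
begin

lemma openin_quot_one:
  "openin (quot_top G T {\<one>}) V \<longleftrightarrow> V \<subseteq> (\<lambda>x. {x}) ` carrier G \<and> openin T {x \<in> carrier G. {x} \<in> V}"
proof -
  have "{x \<in> carrier G. {\<one>} #> x \<in> V} = {x \<in> carrier G. {x} \<in> V}" by (auto simp: r_coset_one)
  then show ?thesis by (simp add: openin_quot_top rcosets_one)
qed

lemma topspace_quot_one: "topspace (quot_top G T {\<one>}) = (\<lambda>x. {x}) ` carrier G"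
proof -
  have "openin (quot_top G T {\<one>}) ((\<lambda>x. {x}) ` carrier G)"
    using openin_topspace[of T] topspace_G by (auto simp: openin_quot_one image_iff)
  moreover have "topspace (quot_top G T {\<one>}) \<subseteq> (\<lambda>x. {x}) ` carrier G"
    using openin_topspace[of "quot_top G T {\<one>}"] by (simp only: openin_quot_one)
  ultimately show ?thesis using openin_subset by blast
qed

lemma continuous_map_singleton: "continuous_map T (quot_top G T {\<one>}) (\<lambda>x. {x})"
  unfolding continuous_map_def topspace_quot_one topspace_G by (auto simp: openin_quot_one)

lemma continuous_map_the_elem: "continuous_map (quot_top G T {\<one>}) T the_elem"
  unfolding continuous_map_def topspace_quot_one topspace_G
proof (intro conjI allI impI)
  fix A assume A: "openin T A"
  then have "A \<subseteq> carrier G" using openin_subset topspace_G by blast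
  then have "{x \<in> carrier G. {x} \<in> {D \<in> (\<lambda>x. {x}) ` carrier G. the_elem D \<in> A}} = A" by auto
  then show "openin (quot_top G T {\<one>}) {D \<in> (\<lambda>x. {x}) ` carrier G. the_elem D \<in> A}"
    using A by (auto simp: openin_quot_one)
qed auto

text \<open>Compactness of \<open>C\<close> gives one \<open>U\<close> for which \<open>f\<close>
  varies by less than \<open>\<epsilon>\<close> on \<open>U y U\<close> for every \<open>y\<close>
  in \<open>C\<close>. The majorant is the supremum of the modulus over \<open>U x U\<close>, which
  is bi-invariant by construction.\<close>

lemma biinvariant_majorant:
  fixes f :: "'a \<Rightarrow> complex" and \<epsilon> :: real
  assumes f: "continuous_map T euclidean f" and C: "compactin T C"
    and supp: "\<And>x. x \<in> carrier G - C \<Longrightarrow> f x = 0" and \<epsilon>: "0 < \<epsilon>"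
  shows "\<exists>U g. opsub U \<and> left_inv G U g \<and> right_inv G U g \<and>
    (\<forall>x\<in>carrier G. cmod (f x) \<le> g x \<and> g x \<le> cmod (f x) + \<epsilon>) \<and>
    (\<forall>x\<in>carrier G. g x \<noteq> 0 \<longrightarrow> (\<exists>u\<in>U. \<exists>v\<in>U. u \<otimes> x \<otimes> v \<in> C))"
proof -
  have Cc: "C \<subseteq> carrier G" using compactin_subset_topspace[OF C] topspace_G by simp
  have "\<exists>V. opsub V \<and> (\<forall>u\<in>V. \<forall>v\<in>V. cmod (f (u \<otimes> x \<otimes> v) - f x) < \<epsilon> / 2)" if x: "x \<in> carrier G" for x
  proof -
    let ?B = "{y \<in> carrier G. f y \<in> ball (f x) (\<epsilon> / 2)}"
    have B: "openin T ?B" using f unfolding continuous_map_def topspace_G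
      by (metis open_ball open_openin)
    have "openin T (inv x <# ?B)" using x B by (intro openin_lcoset) auto
    moreover have "\<one> \<in> inv x <# ?B" using x \<epsilon> by (auto simp: l_coset_def intro!: bexI[of _ x])
    ultimately obtain V where V: "subgroup V G" "openin T V" "V \<subseteq> (inv x <# ?B) \<inter> K" using base by blast
    have Vc: "V \<subseteq> carrier G" using V(1) subgroup.subset by blast
    have xV: "x \<otimes> v \<in> ?B" if "v \<in> V" for v
    proof -
      have "v \<in> inv x <# ?B" using V(3) that by blast
      then obtain b where b: "b \<in> ?B" "v = inv x \<otimes> b" by (auto simp: l_coset_def)
      then have "x \<otimes> v = b" using x by (simp add: inv_cancel)
      then show ?thesis using b by blast
    qed
    \<comment> \<open>The left factor is handled by conjugation: \<open>u\<close> in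
      \<open>x V inv x\<close> turns \<open>u x\<close> into \<open>x w\<close> with
      \<open>w\<close> in \<open>V\<close>, so right translations alone control both sides.\<close>
    have "openin T (x <# V #> inv x)" using x V(2) by (intro openin_lcoset openin_rcoset) auto
    moreover have "\<one> \<in> x <# V #> inv x"
      using x subgroup.one_closed[OF V(1)] by (force simp: r_coset_def l_coset_def)
    ultimately obtain V' where V': "subgroup V' G" "openin T V'" "V' \<subseteq> (x <# V #> inv x) \<inter> K" using base by blast
    have W: "opsub (V \<inter> V')" using V V' by (intro opsub_Int) (auto simp: opsub_def)
    have "cmod (f (u \<otimes> x \<otimes> v) - f x) < \<epsilon> / 2" if u: "u \<in> V \<inter> V'" and v: "v \<in> V \<inter> V'" for u v
    proof -
      have "u \<in> x <# V #> inv x" using u V'(3) by blast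
      then obtain w where w: "w \<in> V" "u = x \<otimes> w \<otimes> inv x" by (auto simp: r_coset_def l_coset_def)
      have c: "w \<in> carrier G" "v \<in> carrier G" using w v Vc by auto
      have "u \<otimes> x \<otimes> v = x \<otimes> (w \<otimes> v)" using c x by (simp add: w m_assoc)
      moreover have "w \<otimes> v \<in> V" using w v subgroup.m_closed[OF V(1)] by auto
      ultimately have "f (u \<otimes> x \<otimes> v) \<in> ball (f x) (\<epsilon> / 2)" using xV by auto
      then show ?thesis by (simp add: dist_norm norm_minus_commute)
    qed
    then show ?thesis using W by (intro exI[of _ "V \<inter> V'"]) simp
  qed
  then obtain V where V: "\<And>x. x \<in> carrier G \<Longrightarrow> opsub (V x)"
    "\<And>x u v. x \<in> carrier G \<Longrightarrow> u \<in> V x \<Longrightarrow> v \<in> V x \<Longrightarrow> cmod (f (u \<otimes> x \<otimes> v) - f x) < \<epsilon> / 2"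
    by metis
  have VG: "subgroup (V x) G" "V x \<subseteq> carrier G" if "x \<in> carrier G" for x using opsubD[OF V(1)[OF that]] by auto
  have "\<exists>X. finite X \<and> X \<subseteq> C \<and> C \<subseteq> (\<Union>x\<in>X. V x #> x)"
  proof -
    have "\<forall>D\<in>(\<lambda>x. V x #> x) ` C. openin T D" using V(1) Cc opsub_coset_open by auto
    moreover have "C \<subseteq> \<Union>((\<lambda>x. V x #> x) ` C)" using rcos_self VG(1) Cc by blast
    ultimately have "\<exists>F. finite F \<and> F \<subseteq> (\<lambda>x. V x #> x) ` C \<and> C \<subseteq> \<Union>F" using C unfolding compactin_def by blast
    then show ?thesis by (metis (no_types, lifting) finite_subset_image)
  qed
  then obtain X where X: "finite X" "X \<subseteq> C" "C \<subseteq> (\<Union>x\<in>X. V x #> x)" by blast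
  have fin: "opsub (K \<inter> (\<Inter>x\<in>Y. V x))" if "finite Y" "Y \<subseteq> C" for Y
    using that
  proof (induction Y rule: finite_induct)
    case (insert y Y)
    then have "opsub (V y \<inter> (K \<inter> (\<Inter>x\<in>Y. V x)))" using V(1)[of y] Cc by (intro opsub_Int[of "V y"]) auto
    then show ?case by (simp add: Int_ac)
  qed (simp add: opsub_K)
  define U where "U = K \<inter> (\<Inter>x\<in>X. V x)"
  have U: "opsub U" unfolding U_def by (rule fin[OF X(1,2)])
  note sU = opsubD(1)[OF U]
  have Uc: "\<And>u. u \<in> U \<Longrightarrow> u \<in> carrier G" using opsubD(4)[OF U] by blast
  have close_C: "cmod (f (u \<otimes> y \<otimes> v) - f y) < \<epsilon>" if y: "y \<in> C" and u: "u \<in> U" and v: "v \<in> U" for y u v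
  proof -
    obtain x where x: "x \<in> X" "y \<in> V x #> x" using X y by auto
    then obtain a where a: "a \<in> V x" "y = a \<otimes> x" by (auto simp: mem_r_coset_iff)
    have xc: "x \<in> carrier G" using x X Cc by auto
    have uV: "u \<in> V x" "v \<in> V x" using u v x by (auto simp: U_def)
    have c: "a \<in> carrier G" "u \<in> carrier G" "v \<in> carrier G" using a uV VG(2)[OF xc] by auto
    have "u \<otimes> a \<in> V x" using uV a subgroup.m_closed[OF VG(1)[OF xc]] by auto
    then have "cmod (f (u \<otimes> a \<otimes> x \<otimes> v) - f x) < \<epsilon> / 2" using V(2)[OF xc] uV by blast
    moreover have "u \<otimes> a \<otimes> x \<otimes> v = u \<otimes> y \<otimes> v" using a c xc by (simp add: m_assoc)
    moreover have "cmod (f (a \<otimes> x \<otimes> \<one>) - f x) < \<epsilon> / 2"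
      using V(2)[OF xc a(1)] subgroup.one_closed[OF VG(1)[OF xc]] by blast
    moreover have "a \<otimes> x \<otimes> \<one> = y" using a c xc by simp
    ultimately have "cmod (f (u \<otimes> y \<otimes> v) - f x) < \<epsilon> / 2" "cmod (f y - f x) < \<epsilon> / 2" by simp_all
    then show ?thesis using norm_triangle_ineq4[of "f (u \<otimes> y \<otimes> v) - f x" "f y - f x"] by simp
  qed
  \<comment> \<open>For \<open>y\<close> outside \<open>C\<close> the estimate is applied in
    reverse: if \<open>u y v\<close> lies in \<open>C\<close>, then \<open>y\<close> is its
    translate by inverses; otherwise \<open>f\<close> vanishes at \<open>u y v\<close>.\<close>
  have close: "cmod (f (u \<otimes> y \<otimes> v)) \<le> cmod (f y) + \<epsilon>" if y: "y \<in> carrier G" and u: "u \<in> U" and v: "v \<in> U" for y u v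
  proof (cases "u \<otimes> y \<otimes> v \<in> C")
    case True
    have c: "u \<in> carrier G" "v \<in> carrier G" "inv u \<in> U" "inv v \<in> U"
      using u v Uc subgroup.m_inv_closed[OF sU] by auto
    have "inv u \<otimes> (u \<otimes> y \<otimes> v) \<otimes> inv v = y" using c y by (simp add: m_assoc inv_cancel)
    then have "cmod (f y - f (u \<otimes> y \<otimes> v)) < \<epsilon>" using close_C[OF True c(3,4)] by simp
    then show ?thesis using norm_triangle_ineq3[of "f y" "f (u \<otimes> y \<otimes> v)"] by simp
  next
    case False
    then have "f (u \<otimes> y \<otimes> v) = 0" using supp[of "u \<otimes> y \<otimes> v"] u v y Uc by auto
    then show ?thesis using \<epsilon> by simp
  qed
  define g where "g x = (SUP p\<in>U \<times> U. cmod (f (fst p \<otimes> x \<otimes> snd p)))" for x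
  have bdd: "bdd_above ((\<lambda>p. cmod (f (fst p \<otimes> x \<otimes> snd p))) ` (U \<times> U))" if "x \<in> carrier G" for x
    using close[OF that] by (intro bdd_aboveI2[where M="cmod (f x) + \<epsilon>"]) auto
  have one: "\<one> \<in> U" by (rule subgroup.one_closed[OF sU])
  have lower: "cmod (f x) \<le> g x" if "x \<in> carrier G" for x
    unfolding g_def using bdd[OF that] one that by (intro cSUP_upper2[of _ _ "(\<one>, \<one>)"]) auto
  have upper: "g x \<le> cmod (f x) + \<epsilon>" if "x \<in> carrier G" for x
    unfolding g_def using close[OF that] one by (intro cSUP_least) auto
  have trans: "(\<lambda>u. u \<otimes> w) ` U = U" "(\<lambda>u. w \<otimes> u) ` U = U" if w: "w \<in> U" for w
  proof -
    have iw: "inv w \<in> U" "w \<in> carrier G" using subgroup.m_inv_closed[OF sU w] Uc[OF w] by auto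
    show "(\<lambda>u. u \<otimes> w) ` U = U"
    proof (intro equalityI subsetI)
      fix u assume u: "u \<in> U"
      then have "u = u \<otimes> inv w \<otimes> w" using Uc iw by (simp add: m_assoc)
      then show "u \<in> (\<lambda>u. u \<otimes> w) ` U" using subgroup.m_closed[OF sU u iw(1)] by blast
    qed (use subgroup.m_closed[OF sU] w in auto)
    show "(\<lambda>u. w \<otimes> u) ` U = U"
    proof (intro equalityI subsetI)
      fix u assume u: "u \<in> U"
      then have "u = w \<otimes> (inv w \<otimes> u)" using Uc iw by (simp add: inv_cancel)
      then show "u \<in> (\<lambda>u. w \<otimes> u) ` U" using subgroup.m_closed[OF sU iw(1) u] by blast
    qed (use subgroup.m_closed[OF sU] w in auto)
  qed
  have left: "left_inv G U g"
    unfolding left_inv_def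
  proof (intro ballI)
    fix w x assume w: "w \<in> U" and x: "x \<in> carrier G"
    have "U \<times> U = (\<lambda>p. (fst p \<otimes> w, snd p)) ` (U \<times> U)"
      using trans(1)[OF w] by (auto simp: image_iff) (metis imageE trans(1)[OF w])
    then have "g x = (SUP p\<in>(\<lambda>p. (fst p \<otimes> w, snd p)) ` (U \<times> U). cmod (f (fst p \<otimes> x \<otimes> snd p)))"
      unfolding g_def by simp
    also have "\<dots> = g (w \<otimes> x)"
      unfolding g_def image_image using Uc w x by (intro SUP_cong) (auto simp: m_assoc)
    finally show "g (w \<otimes> x) = g x" ..
  qed
  have right: "right_inv G U g"
    unfolding right_inv_def
  proof (intro ballI)
    fix w x assume w: "w \<in> U" and x: "x \<in> carrier G"
    have "U \<times> U = (\<lambda>p. (fst p, w \<otimes> snd p)) ` (U \<times> U)"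
      using trans(2)[OF w] by (auto simp: image_iff) (metis imageE trans(2)[OF w])
    then have "g x = (SUP p\<in>(\<lambda>p. (fst p, w \<otimes> snd p)) ` (U \<times> U). cmod (f (fst p \<otimes> x \<otimes> snd p)))"
      unfolding g_def by simp
    also have "\<dots> = g (x \<otimes> w)"
      unfolding g_def image_image using Uc w x by (intro SUP_cong) (auto simp: m_assoc)
    finally show "g (x \<otimes> w) = g x" ..
  qed
  have gsupp: "\<exists>u\<in>U. \<exists>v\<in>U. u \<otimes> x \<otimes> v \<in> C" if x: "x \<in> carrier G" "g x \<noteq> 0" for x
  proof (rule ccontr)
    assume no: "\<not> ?thesis"
    have "f (u \<otimes> x \<otimes> v) = 0" if "u \<in> U" "v \<in> U" for u v
      using supp[of "u \<otimes> x \<otimes> v"] no that x Uc by auto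
    then have "g x = (SUP p\<in>U \<times> U. 0)" unfolding g_def by (intro SUP_cong) auto
    then have "g x = 0" using one by (subst (asm) cSUP_const) auto
    then show False using x by simp
  qed
  show ?thesis using U left right lower upper gsupp by blast
qed

end

text \<open>If \<open>W\<close> is infinite, the bound at \<open>\<epsilon> = 1\<close> is already
  the claim. Otherwise the excess is at most \<open>\<epsilon>\<close> times the finite number
  \<open>Z\<close>.\<close>

lemma ennreal_perturbation_limit:
  fixes a k W B X :: ennreal
  assumes le: "\<And>\<epsilon>::real. 0 < \<epsilon> \<Longrightarrow> \<epsilon> \<le> 1 \<Longrightarrow> a \<le> k * (ennreal (1 + \<epsilon>) * W + ennreal (2 * \<epsilon>) * B) * X"
    and fin: "k < \<infinity>" "B < \<infinity>" "X < \<infinity>"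
  shows "a \<le> k * W * X"
proof (cases "W = \<infinity>")
  case True
  then show ?thesis using le[of 1] by (simp add: ennreal_mult_top)
next
  case False
  define Z where "Z = k * (W + 2 * B) * X"
  have "Z < \<infinity>" unfolding Z_def using fin False by (simp add: ennreal_mult_less_top less_top)
  then obtain z where z: "Z = ennreal z" "0 \<le> z" by (cases Z) auto
  show ?thesis
  proof (rule ennreal_le_epsilon)
    fix e :: real assume e: "0 < e"
    \<comment> \<open>The denominator \<open>z + 1\<close> avoids a case distinction at
      \<open>z = 0\<close>.\<close>
    define \<epsilon> where "\<epsilon> = min 1 (e / (z + 1))"
    have \<epsilon>: "0 < \<epsilon>" "\<epsilon> \<le> 1" using e z by (auto simp: \<epsilon>_def)
    have "\<epsilon> * z \<le> e / (z + 1) * z" using z by (intro mult_right_mono) (auto simp: \<epsilon>_def)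
    also have "\<dots> \<le> e" using e z by (simp add: field_simps)
    finally have ez: "ennreal \<epsilon> * Z \<le> ennreal e" using \<epsilon> z by (simp add: ennreal_mult[symmetric] ennreal_leI)
    have "ennreal (1 + \<epsilon>) * W + ennreal (2 * \<epsilon>) * B = W + ennreal \<epsilon> * (W + 2 * B)"
      using \<epsilon> by (simp add: ennreal_mult distrib_left distrib_right ac_simps)
    then have "k * (ennreal (1 + \<epsilon>) * W + ennreal (2 * \<epsilon>) * B) * X = k * W * X + ennreal \<epsilon> * Z"
      unfolding Z_def by (simp add: distrib_left distrib_right ac_simps)
    then have "a \<le> k * W * X + ennreal \<epsilon> * Z" using le[OF \<epsilon>] by simp
    also have "\<dots> \<le> k * W * X + ennreal e" by (intro add_left_mono ez)
    finally show "a \<le> k * W * X + ennreal e" .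
  qed
qed

lemma (in plain_group) csum_fin_supp_finite:
  assumes K: "subgroup K G" and "fin_supp_mod G K (\<phi> :: 'a \<Rightarrow> real)"
  shows "csum G K (\<lambda>x. ennreal (\<phi> x)) < \<infinity>"
proof -
  let ?S = "{D \<in> rcosets K. \<phi> (coset_rep G K D) \<noteq> 0}"
  have fin: "finite ?S" by (rule fin_supp_mod_finite[OF assms])
  then have "csum G K (\<lambda>x. ennreal (\<phi> x)) = (\<Sum>D\<in>?S. ennreal (\<phi> (coset_rep G K D)))"
    by (intro csum_eq_sum) auto
  then show ?thesis using fin by simp
qed

lemma (in plain_group) fin_supp_mod_refine:
  assumes U: "subgroup U G" and K: "subgroup K G" and R: "transversal U K R" and "fin_supp_mod G K \<phi>"
  shows "fin_supp_mod G U \<phi>"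
proof -
  have Kc: "K \<subseteq> carrier G" using K subgroup.subset by blast
  have RK: "R \<subseteq> K" "finite R" using R by (auto simp: transversal_def)
  obtain F where F: "finite F" "F \<subseteq> carrier G" "\<And>x. x \<in> carrier G \<Longrightarrow> \<phi> x \<noteq> 0 \<Longrightarrow> \<exists>a\<in>F. x \<in> K #> a"
    using assms by (auto simp: fin_supp_mod_def)
  let ?F = "(\<lambda>(r, a). r \<otimes> a) ` (R \<times> F)"
  have "\<exists>b\<in>?F. x \<in> U #> b" if x: "x \<in> carrier G" "\<phi> x \<noteq> 0" for x
  proof -
    obtain a where a: "a \<in> F" "x \<in> K #> a" using F(3)[OF x] by blast
    then obtain k where k: "k \<in> K" "x = k \<otimes> a" unfolding mem_r_coset_iff by blast
    then obtain r where r: "r \<in> R" "k \<in> U #> r" using R unfolding transversal_def by blast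
    then obtain u where u: "u \<in> U" "k = u \<otimes> r" unfolding mem_r_coset_iff by blast
    have c: "u \<in> carrier G" "r \<in> carrier G" "a \<in> carrier G"
      using u r a F(2) RK Kc subgroup.mem_carrier[OF U] by auto
    have "x = u \<otimes> (r \<otimes> a)" using c k u by (simp add: m_assoc)
    then have "x \<in> U #> (r \<otimes> a)" using u unfolding mem_r_coset_iff by blast
    moreover have "r \<otimes> a \<in> ?F" using r a by force
    ultimately show ?thesis by blast
  qed
  moreover have "finite ?F" using F RK by simp
  moreover have "?F \<subseteq> carrier G" using F(2) RK(1) Kc by (auto simp: subset_iff)
  ultimately show ?thesis unfolding fin_supp_mod_def by (intro exI[of _ ?F]) simp
qed

section \<open>Convolution operators on the group itself\<close>

context tdlc_haar
begin

definition \<nu> :: "'a set measure" where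
  "\<nu> = distr \<mu> (borel_of (quot_top G T {\<one>})) (\<lambda>x. {\<one>} #> x)"

lemma singleton_measurable: "(\<lambda>x. {x}) \<in> measurable \<mu> (borel_of (quot_top G T {\<one>}))"
  unfolding measurable_\<mu> by (rule continuous_map_measurable[OF continuous_map_singleton])

lemma \<nu>_eq: "\<nu> = distr \<mu> (borel_of (quot_top G T {\<one>})) (\<lambda>x. {x})"
  unfolding \<nu>_def by (intro distr_cong) (auto simp: space_\<mu> r_coset_one)

lemma space_\<nu>: "space \<nu> = (\<lambda>x. {x}) ` carrier G"
  by (simp add: \<nu>_def space_borel_of topspace_quot_one)

lemma sets_\<nu>: "sets \<nu> = sets (borel_of (quot_top G T {\<one>}))"
  by (simp add: \<nu>_def)

text \<open>The singleton map and \<open>the_elem\<close> are inverse continuous maps, so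
  measurability can be tested on the group.\<close>

lemma measurable_\<nu>I:
  assumes "(\<lambda>x. h {x}) \<in> measurable \<mu> N" shows "h \<in> measurable \<nu> N"
proof -
  have "the_elem \<in> measurable \<nu> \<mu>"
    using continuous_map_measurable[OF continuous_map_the_elem] measurable_cong_sets[OF sets_\<nu> sets_\<mu>] by blast
  from measurable_compose[OF this assms] have "(\<lambda>D. h {the_elem D}) \<in> measurable \<nu> N" .
  then show ?thesis by (rule measurable_cong[THEN iffD1, rotated]) (auto simp: space_\<nu>)
qed

lemma measurable_\<nu>D: "h \<in> measurable \<nu> N \<Longrightarrow> (\<lambda>x. h {x}) \<in> measurable \<mu> N"
  using measurable_compose[OF singleton_measurable, of h N] measurable_cong_sets[OF sets_\<nu> refl] by blast

lemma nn_integral_\<nu>: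
  assumes "(\<lambda>x. h {x}) \<in> borel_measurable \<mu>"
  shows "(\<integral>\<^sup>+D. h D \<partial>\<nu>) = (\<integral>\<^sup>+x. h {x} \<partial>\<mu>)"
proof -
  have "h \<in> borel_measurable (borel_of (quot_top G T {\<one>}))"
    using measurable_\<nu>I[OF assms] measurable_cong_sets[OF sets_\<nu> refl] by blast
  then show ?thesis unfolding \<nu>_eq by (intro nn_integral_distr singleton_measurable) simp
qed

lemma integral_\<nu>:
  fixes h :: "'a set \<Rightarrow> complex"
  assumes "(\<lambda>x. h {x}) \<in> borel_measurable \<mu>"
  shows "(LINT D|\<nu>. h D) = (LINT x|\<mu>. h {x})"
proof -
  have "h \<in> borel_measurable (borel_of (quot_top G T {\<one>}))"
    using measurable_\<nu>I[OF assms] measurable_cong_sets[OF sets_\<nu> refl] by blast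
  then show ?thesis unfolding \<nu>_eq by (intro integral_distr singleton_measurable)
qed

lemma conv_argument_measurable:
  assumes "f \<in> measurable \<mu> N" "x \<in> carrier G"
  shows "(\<lambda>y. f (x \<otimes> inv y)) \<in> measurable \<mu> N"
proof -
  have "continuous_map T T ((\<lambda>y. x \<otimes> y) \<circ> (\<lambda>y. inv y))"
    using continuous_map_inv continuous_map_ltrans[OF assms(2)] by (rule continuous_map_compose)
  then have "(\<lambda>y. x \<otimes> inv y) \<in> measurable \<mu> (borel_of T)"
    unfolding measurable_\<mu> by (intro continuous_map_measurable) (simp add: o_def)
  from measurable_compose[OF this] show ?thesis using assms(1) by (simp add: measurable_\<mu>)
qed

lemma hecke_conv_one:
  fixes f \<xi> :: "'a set \<Rightarrow> complex"
  assumes f: "(\<lambda>x. f {x}) \<in> borel_measurable \<mu>" and \<xi>: "(\<lambda>x. \<xi> {x}) \<in> borel_measurable \<mu>"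
    and x: "x \<in> carrier G"
  shows "hecke_conv G {\<one>} \<nu> f \<xi> {x} = (LINT y|\<mu>. f {x \<otimes> inv y} * \<xi> {y})"
proof -
  have "hecke_conv G {\<one>} \<nu> f \<xi> {x} = (LINT D|\<nu>. (\<lambda>D. f {x \<otimes> inv (the_elem D)} * \<xi> D) D)"
    unfolding hecke_conv_def using x
    by (intro Bochner_Integration.integral_cong) (auto simp: space_\<nu> coset_rep_one r_coset_one)
  also have "\<dots> = (LINT y|\<mu>. f {x \<otimes> inv y} * \<xi> {y})"
    using conv_argument_measurable[OF f x] \<xi> by (subst integral_\<nu>) auto
  finally show ?thesis .
qed

lemma l2sq_\<nu>:
  "(\<lambda>x. \<xi> {x}) \<in> borel_measurable \<mu> \<Longrightarrow> l2sq \<nu> \<xi> = (\<integral>\<^sup>+x. ennreal ((cmod (\<xi> {x}))\<^sup>2) \<partial>\<mu>)"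
  unfolding l2sq_def by (subst nn_integral_\<nu>) auto

lemma rd_weight_\<nu>:
  assumes f [measurable]: "(\<lambda>x. f {x}) \<in> borel_measurable \<mu>" and l [measurable]: "l \<in> borel_measurable \<mu>"
  shows "rd_weight_sq G {\<one>} \<nu> l s f = (\<integral>\<^sup>+x. ennreal ((cmod (f {x}))\<^sup>2 * (1 + l x) powr (2 * s)) \<partial>\<mu>)"
proof -
  have "rd_weight_sq G {\<one>} \<nu> l s f
      = (\<integral>\<^sup>+D. (\<lambda>D. ennreal ((cmod (f D))\<^sup>2 * (1 + l (the_elem D)) powr (2 * s))) D \<partial>\<nu>)"
    unfolding rd_weight_sq_def by (intro nn_integral_cong) (auto simp: space_\<nu> coset_rep_one)
  also have "\<dots> = (\<integral>\<^sup>+x. ennreal ((cmod (f {x}))\<^sup>2 * (1 + l x) powr (2 * s)) \<partial>\<mu>)"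
    by (subst nn_integral_\<nu>) auto
  finally show ?thesis .
qed

text \<open>Since \<open>g\<close> is constant on \<open>U\<close>-double cosets,
  \<open>\<xi>\<close> matters only through the integrals of its modulus over
  \<open>U\<close>-cosets. The refined inequality applies to these, and \<open>U\<close> enters the
  final constant only through \<open>[K:U] \<mu>(U) = \<mu>(K)\<close>.\<close>

lemma conv_majorant_bound:
  fixes f \<xi> :: "'a set \<Rightarrow> complex" and g :: "'a \<Rightarrow> real"
  assumes RD: "disc_RD G K l s c" and U: "opsub U" and g: "left_inv G U g" "right_inv G U g"
    and supp: "fin_supp_mod G K g" and fg: "\<And>x. x \<in> carrier G \<Longrightarrow> cmod (f {x}) \<le> g x"
    and f [measurable]: "(\<lambda>x. f {x}) \<in> borel_measurable \<mu>"
    and \<xi> [measurable]: "(\<lambda>x. \<xi> {x}) \<in> borel_measurable \<mu>"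
    and fin: "l2sq \<nu> \<xi> < \<infinity>"
  shows "l2sq \<nu> (hecke_conv G {\<one>} \<nu> f \<xi>)
    \<le> ennreal (c\<^sup>2) * emeasure \<mu> K * (\<integral>\<^sup>+x. ennreal ((g x)\<^sup>2 * (1 + l x) powr (2 * s)) \<partial>\<mu>) * l2sq \<nu> \<xi>"
proof -
  note sU = opsubD(1)[OF U] and UK = opsubD(3)[OF U]
  obtain R where R: "transversal U K R" using opsub_transversal[OF opsub_K U UK K(3)] by blast
  have l: "alg_length G K l" using RD by (simp add: disc_RD_def)
  note linv = alg_length_inv[OF K(1) l]
  have g0: "0 \<le> g x" if "x \<in> carrier G" for x using fg[OF that] norm_ge_zero order_trans by blast
  let ?h = "\<lambda>y. ennreal (cmod (\<xi> {y}))"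
  have h [measurable]: "?h \<in> borel_measurable \<mu>" by measurable
  define J where "J x = (\<integral>\<^sup>+y. ?h y * indicator (U #> x) y \<partial>\<mu>)" for x
  define A where "A x = csum G U (\<lambda>y. ennreal (g (x \<otimes> inv y)) * J y)" for x
  have coset: "U #> (u \<otimes> x) = U #> x" if "u \<in> U" "x \<in> carrier G" for u x
    using r_coset_eq_iff[OF sU, of "u \<otimes> x" x] that subgroup.mem_carrier[OF sU] by (auto simp: mem_r_coset_iff)
  have J: "left_inv G U J" unfolding left_inv_def J_def using coset by simp
  have Al: "left_inv G U A"
    unfolding left_inv_def
  proof (intro ballI)
    fix u x assume u: "u \<in> U" and x: "x \<in> carrier G"
    have "g (u \<otimes> x \<otimes> inv y) = g (x \<otimes> inv y)" if "y \<in> carrier G" for y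
      using left_invD[OF g(1) u, of "x \<otimes> inv y"] subgroup.mem_carrier[OF sU u] x that by (simp add: m_assoc)
    then show "A (u \<otimes> x) = A x" unfolding A_def by (intro csum_cong) simp
  qed
  have conv: "ennreal (cmod (hecke_conv G {\<one>} \<nu> f \<xi> {x})) \<le> A x" if x: "x \<in> carrier G" for x
  proof -
    have "ennreal (cmod (hecke_conv G {\<one>} \<nu> f \<xi> {x})) \<le> (\<integral>\<^sup>+y. ennreal (cmod (f {x \<otimes> inv y} * \<xi> {y})) \<partial>\<mu>)"
      unfolding hecke_conv_one[OF f \<xi> x] by (rule ennreal_norm_integral_le)
    also have "\<dots> \<le> (\<integral>\<^sup>+y. ennreal (g (x \<otimes> inv y)) * ?h y \<partial>\<mu>)"
    proof (rule nn_integral_mono)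
      fix y assume "y \<in> space \<mu>"
      then have "x \<otimes> inv y \<in> carrier G" using x by (simp add: space_\<mu>)
      then have "cmod (f {x \<otimes> inv y} * \<xi> {y}) \<le> g (x \<otimes> inv y) * cmod (\<xi> {y})"
        using fg by (simp add: norm_mult mult_right_mono)
      then show "ennreal (cmod (f {x \<otimes> inv y} * \<xi> {y})) \<le> ennreal (g (x \<otimes> inv y)) * ?h y"
        using g0[OF \<open>x \<otimes> inv y \<in> carrier G\<close>] by (simp add: ennreal_mult[symmetric])
    qed
    also have "\<dots> = A x"
      unfolding A_def J_def
    proof (rule nn_integral_left_inv_mult[OF U _ _ h])
      show "left_inv G U (\<lambda>y. ennreal (g (x \<otimes> inv y)))"
        unfolding left_inv_def
      proof (intro ballI)
        fix u y assume u: "u \<in> U" and y: "y \<in> carrier G"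
        have "inv u \<in> U" using subgroup.m_inv_closed[OF sU u] .
        then have "g (x \<otimes> inv y \<otimes> inv u) = g (x \<otimes> inv y)" using right_invD[OF g(2)] x y by simp
        then show "ennreal (g (x \<otimes> inv (u \<otimes> y))) = ennreal (g (x \<otimes> inv y))"
          using subgroup.mem_carrier[OF sU u] y x by (simp add: inv_mult_group m_assoc)
      qed
      have "fin_supp_mod G U (\<lambda>y. g (x \<otimes> inv y))"
        by (rule fin_supp_mod_refine[OF sU K(1) R fin_supp_mod_convolution[OF K(1) hecke_fin_K supp x]])
      then show "fin_supp_mod G U (\<lambda>y. ennreal (g (x \<otimes> inv y)))"
        unfolding fin_supp_mod_def by (metis ennreal_0)
    qed
    finally show ?thesis .
  qed
  have h2: "(?h y)\<^sup>2 = ennreal ((cmod (\<xi> {y}))\<^sup>2)" for y by (simp add: ennreal_power)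
  have l2: "l2sq \<nu> \<xi> = (\<integral>\<^sup>+y. (?h y)\<^sup>2 \<partial>\<mu>)" unfolding h2 by (rule l2sq_\<nu>[OF \<xi>])
  have J2: "(J x)\<^sup>2 \<le> emeasure \<mu> U * (\<integral>\<^sup>+y. (?h y)\<^sup>2 * indicator (U #> x) y \<partial>\<mu>)" if "x \<in> carrier G" for x
    unfolding J_def by (rule coset_Cauchy_Schwarz[OF U that h])
  have Jsum: "csum G U (\<lambda>x. (J x)\<^sup>2) \<le> emeasure \<mu> U * l2sq \<nu> \<xi>"
  proof -
    have "csum G U (\<lambda>x. (J x)\<^sup>2) \<le> csum G U (\<lambda>x. emeasure \<mu> U * (\<integral>\<^sup>+y. (?h y)\<^sup>2 * indicator (U #> x) y \<partial>\<mu>))"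
      by (intro csum_mono J2)
    also have "\<dots> \<le> emeasure \<mu> U * l2sq \<nu> \<xi>"
      unfolding csum_cmult l2 by (intro mult_left_mono csum_coset_integrals_le[OF U]) auto
    finally show ?thesis .
  qed
  \<comment> \<open>Finiteness allows \<open>J\<close> to be replaced by the real function
    \<open>\<eta>\<close>, as \<open>disc_RD\<close> speaks of real functions.\<close>
  have Jfin: "J x < \<infinity>" if x: "x \<in> carrier G" for x
  proof -
    have "(J x)\<^sup>2 \<le> emeasure \<mu> U * l2sq \<nu> \<xi>"
      using J2[OF x] unfolding l2
      by (rule order_trans) (intro mult_left_mono nn_integral_mono, auto simp: indicator_def)
    also have "\<dots> < \<infinity>" using fin emeasure_opsub_finite[OF U] by (simp add: ennreal_mult_less_top)
    finally show ?thesis by (cases "J x = \<infinity>") (auto simp: less_top ennreal_top_mult power2_eq_square)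
  qed
  define \<eta> where "\<eta> x = enn2real (J x)" for x
  have \<eta>: "ennreal (\<eta> x) = J x" if "x \<in> carrier G" for x using Jfin[OF that] by (simp add: \<eta>_def)
  have \<eta>inv: "left_inv G U \<eta>" using J by (auto simp: left_inv_def \<eta>_def)
  have \<eta>0: "0 \<le> \<eta> x" for x by (simp add: \<eta>_def)
  have \<eta>2: "csum G U (\<lambda>x. ennreal ((\<eta> x)\<^sup>2)) = csum G U (\<lambda>x. (J x)\<^sup>2)"
    using \<eta>0 \<eta> by (intro csum_cong) (simp add: ennreal_power[symmetric])
  have \<eta>fin: "csum G U (\<lambda>x. ennreal ((\<eta> x)\<^sup>2)) < \<infinity>"
    unfolding \<eta>2 using Jsum fin emeasure_opsub_finite[OF U]
    by (metis ennreal_mult_less_top infinity_ennreal_def order_le_less_trans)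
  have A_eq: "A x = csum G U (\<lambda>y. ennreal (g (x \<otimes> inv y) * \<eta> y))" if "x \<in> carrier G" for x
    unfolding A_def using that g0 \<eta>0 \<eta> by (intro csum_cong) (simp add: ennreal_mult)
  have w: "(\<integral>\<^sup>+x. ennreal ((g x)\<^sup>2 * (1 + l x) powr (2 * s)) \<partial>\<mu>)
      = emeasure \<mu> U * csum G U (\<lambda>x. ennreal ((g x)\<^sup>2 * (1 + l x) powr (2 * s)))"
    using g(1) linv(1) UK by (intro nn_integral_left_inv[OF U]) (auto simp: left_inv_def)
  have "l2sq \<nu> (hecke_conv G {\<one>} \<nu> f \<xi>) \<le> (\<integral>\<^sup>+D. (A (the_elem D))\<^sup>2 \<partial>\<nu>)"
    unfolding l2sq_def
  proof (rule nn_integral_mono)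
    fix D assume "D \<in> space \<nu>"
    then obtain x where x: "x \<in> carrier G" "D = {x}" by (auto simp: space_\<nu>)
    then show "ennreal ((cmod (hecke_conv G {\<one>} \<nu> f \<xi> D))\<^sup>2) \<le> (A (the_elem D))\<^sup>2"
      using conv[OF x(1)] by (simp add: power_mono flip: ennreal_power)
  qed
  also have "\<dots> = (\<integral>\<^sup>+x. (A x)\<^sup>2 \<partial>\<mu>)"
    using left_inv_measurable[OF U Al, of borel] by (subst nn_integral_\<nu>) auto
  also have "\<dots> = emeasure \<mu> U * csum G U (\<lambda>x. (A x)\<^sup>2)"
    using Al by (intro nn_integral_left_inv[OF U]) (auto simp: left_inv_def)
  also have "csum G U (\<lambda>x. (A x)\<^sup>2) = csum G U (\<lambda>x. (csum G U (\<lambda>y. ennreal (g (x \<otimes> inv y) * \<eta> y)))\<^sup>2)"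
    using A_eq by (intro csum_cong) simp
  also have "emeasure \<mu> U * \<dots> \<le> emeasure \<mu> U * (ennreal (c\<^sup>2) *
      (of_nat (card R) * csum G U (\<lambda>x. ennreal ((g x)\<^sup>2 * (1 + l x) powr (2 * s)))) * csum G U (\<lambda>x. ennreal ((\<eta> x)\<^sup>2)))"
    by (intro mult_left_mono disc_RD_refine[OF RD K(1) hecke_fin_K sU UK R g0 g supp \<eta>0 \<eta>inv \<eta>fin]) auto
  also have "\<dots> \<le> emeasure \<mu> U * (ennreal (c\<^sup>2) *
      (of_nat (card R) * csum G U (\<lambda>x. ennreal ((g x)\<^sup>2 * (1 + l x) powr (2 * s)))) * (emeasure \<mu> U * l2sq \<nu> \<xi>))"
    unfolding \<eta>2 by (intro mult_left_mono Jsum) auto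
  \<comment> \<open>Of the two factors \<open>\<mu>(U)\<close>, one comes from the outer integral
    and one from Cauchy-Schwarz on cosets. One combines with \<open>card R\<close> to give
    \<open>\<mu>(K)\<close>; the other turns the coset sum of the weight into its integral.\<close>
  also have "\<dots> = ennreal (c\<^sup>2) * (of_nat (card R) * emeasure \<mu> U)
      * (emeasure \<mu> U * csum G U (\<lambda>x. ennreal ((g x)\<^sup>2 * (1 + l x) powr (2 * s)))) * l2sq \<nu> \<xi>"
    by (simp add: ac_simps)
  finally show ?thesis unfolding w card_transversal_emeasure[OF U R] .
qed

lemma measure_K: "emeasure \<mu> K = ennreal (measure \<mu> K)" "0 < measure \<mu> K"
proof -
  have "emeasure \<mu> K \<noteq> \<infinity>" using emeasure_opsub_finite[OF opsub_K] by auto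
  then show eq: "emeasure \<mu> K = ennreal (measure \<mu> K)" by (simp add: emeasure_eq_ennreal_measure)
  show "0 < measure \<mu> K" using emeasure_opsub_pos[OF opsub_K] unfolding eq by (simp only: ennreal_less_zero_iff)
qed

lemma compactin_quot_one:
  assumes "compactin (quot_top G T {\<one>}) C"
  shows "compactin T (the_elem ` C)" "x \<in> carrier G \<Longrightarrow> {x} \<in> C \<Longrightarrow> x \<in> the_elem ` C"
proof -
  show "compactin T (the_elem ` C)" using assms continuous_map_the_elem by (rule image_compactin)
  show "{x} \<in> C \<Longrightarrow> x \<in> the_elem ` C" by force
qed

text \<open>The constant becomes \<open>c * sqrt m\<close>, whose square is \<open>\<mu>(K)\<close>
  times the old one. The bound for majorants is uniform in \<open>\<epsilon>\<close> up to an error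
  supported on a fixed compact set, so \<open>\<epsilon>\<close> can tend to 0.\<close>

lemma disc_RD_imp_RD_one:
  assumes RD: "disc_RD G K l s c"
  shows "pair_RD G T {\<one>} \<nu>"
proof -
  have l: "alg_length G K l" and sc: "0 < s" "0 < c" using RD by (auto simp: disc_RD_def)
  note linv = alg_length_inv[OF K(1) l]
  have lm [measurable]: "l \<in> borel_measurable \<mu>" using left_inv_measurable[OF opsub_K linv(1)] by simp
  have Kc: "\<And>k. k \<in> K \<Longrightarrow> k \<in> carrier G" using opsubD(4)[OF opsub_K] by blast
  have l0: "0 \<le> l x" if "x \<in> carrier G" for x using l that by (simp add: alg_length_def)
  define m where "m = measure \<mu> K"
  have m: "emeasure \<mu> K = ennreal m" "0 < m"
    unfolding m_def by (rule measure_K)+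
  have "length_function G T {\<one>} l"
    using l lm unfolding length_function_def alg_length_def measurable_\<mu> by simp
  moreover have "locally_bounded G T {\<one>} l"
    unfolding locally_bounded_def
  proof (intro allI impI)
    fix C assume C: "compactin (quot_top G T {\<one>}) C"
    have fin: "finite ((\<lambda>x. K #> x) ` the_elem ` C)"
      by (rule finite_coset_cover[OF opsub_K compactin_quot_one(1)[OF C]])
    have "l x \<le> Max ((\<lambda>D. l (coset_rep G K D)) ` (\<lambda>x. K #> x) ` the_elem ` C)"
      if x: "x \<in> carrier G" "{\<one>} #> x \<in> C" for x
    proof (rule Max_ge)
      have "x \<in> the_elem ` C" using compactin_quot_one(2)[OF C x(1)] x by (simp add: r_coset_one)
      then show "l x \<in> (\<lambda>D. l (coset_rep G K D)) ` (\<lambda>x. K #> x) ` the_elem ` C"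
        using left_inv_rep[OF K(1) linv(1) x(1), symmetric] by blast
    qed (use fin in auto)
    then show "\<exists>B. \<forall>x\<in>carrier G. {\<one>} #> x \<in> C \<longrightarrow> l x \<le> B" by blast
  qed
  moreover have "l2sq \<nu> (hecke_conv G {\<one>} \<nu> f \<xi>)
      \<le> ennreal ((c * sqrt m)\<^sup>2) * rd_weight_sq G {\<one>} \<nu> l s f * l2sq \<nu> \<xi>"
    if hf: "hecke_fun G T {\<one>} f" and \<xi>\<nu>: "\<xi> \<in> borel_measurable \<nu>" and fin: "l2sq \<nu> \<xi> < \<infinity>" for f \<xi>
  proof -
    have cont: "continuous_map T euclidean (\<lambda>x. f {x})"
      using continuous_map_compose[OF continuous_map_singleton, of euclidean f] hf
      by (simp add: hecke_fun_def o_def)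
    have fm [measurable]: "(\<lambda>x. f {x}) \<in> borel_measurable \<mu>"
    proof -
      have "borel_of euclidean = (borel :: complex measure)"
        by (simp add: borel_of_def borel_def open_openin[symmetric])
      then show ?thesis using continuous_map_measurable[OF cont] by (simp add: measurable_\<mu>)
    qed
    have \<xi>m: "(\<lambda>x. \<xi> {x}) \<in> borel_measurable \<mu>" by (rule measurable_\<nu>D[OF \<xi>\<nu>])
    obtain C0 where C0: "compactin (quot_top G T {\<one>}) C0" "\<And>D. D \<in> (\<lambda>x. {x}) ` carrier G - C0 \<Longrightarrow> f D = 0"
      using hf by (auto simp: hecke_fun_def rcosets_one)
    define C where "C = the_elem ` C0"
    have C: "compactin T C" unfolding C_def by (rule compactin_quot_one(1)[OF C0(1)])
    have Cc: "C \<subseteq> carrier G" using compactin_subset_topspace[OF C] topspace_G by simp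
    have suppf: "f {x} = 0" if "x \<in> carrier G - C" for x
      using C0(2)[of "{x}"] compactin_quot_one(2)[OF C0(1), of x] that by (auto simp: C_def)
    \<comment> \<open>The set \<open>K C K\<close>. It contains the support of every majorant,
      whatever \<open>\<epsilon>\<close> and \<open>U\<close> are.\<close>
    define A where "A = {x \<in> carrier G. \<exists>k\<in>K. \<exists>k'\<in>K. k \<otimes> x \<otimes> k' \<in> C}"
    have Asupp: "\<exists>F. finite F \<and> F \<subseteq> carrier G \<and> (\<forall>x\<in>A. \<exists>a\<in>F. x \<in> K #> a)"
    proof -
      have finC: "finite ((\<lambda>x. K #> x) ` C)" by (rule finite_coset_cover[OF opsub_K C])
      define F0 where "F0 = coset_rep G K ` (\<lambda>x. K #> x) ` C"
      have F0: "F0 \<subseteq> carrier G" unfolding F0_def using coset_rep(1) rcosets_memI Cc by auto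
      have "\<exists>B. finite B \<and> B \<subseteq> carrier G \<and> (\<forall>k\<in>K. \<exists>b\<in>B. a \<otimes> k \<in> K #> b)" if "a \<in> F0" for a
        using hecke_fin_K subsetD[OF F0 that] unfolding hecke_fin_def by (rule bspec)
      then obtain B where B: "\<And>a. a \<in> F0 \<Longrightarrow> finite (B a) \<and> B a \<subseteq> carrier G \<and> (\<forall>k\<in>K. \<exists>b\<in>B a. a \<otimes> k \<in> K #> b)"
        by metis
      have "\<exists>b\<in>(\<Union>a\<in>F0. B a). x \<in> K #> b" if x: "x \<in> A" for x
      proof -
        obtain k k' where k: "x \<in> carrier G" "k \<in> K" "k' \<in> K" "k \<otimes> x \<otimes> k' \<in> C" using x by (auto simp: A_def)
        let ?z = "k \<otimes> x \<otimes> k'"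
        define a where "a = coset_rep G K (K #> ?z)"
        have z: "?z \<in> carrier G" using k Kc by simp
        have a: "a \<in> F0" unfolding F0_def a_def using k(4) by (intro imageI)
        have ac: "a \<in> carrier G" using F0 a by blast
        have "?z \<in> K #> a" unfolding a_def using coset_rep(2)[OF rcosets_memI[OF z], of K] rcos_self[OF z K(1)] by simp
        then obtain k1 where k1: "k1 \<in> K" "?z = k1 \<otimes> a" unfolding mem_r_coset_iff by blast
        have ik: "inv k \<in> K" "inv k' \<in> K" using k subgroup.m_inv_closed[OF K(1)] by auto
        obtain b where b: "b \<in> B a" "a \<otimes> inv k' \<in> K #> b" using B[OF a] ik by blast
        then obtain k2 where k2: "k2 \<in> K" "a \<otimes> inv k' = k2 \<otimes> b" unfolding mem_r_coset_iff by blast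
        have bc: "b \<in> carrier G" using b B[OF a] by blast
        have "x = inv k \<otimes> ?z \<otimes> inv k'" using k(1-3) Kc by (simp add: m_assoc inv_cancel)
        also have "\<dots> = inv k \<otimes> (k1 \<otimes> a) \<otimes> inv k'" using k1(2) by simp
        also have "\<dots> = inv k \<otimes> (k1 \<otimes> (a \<otimes> inv k'))" using k(1-3) k1(1) ac Kc by (simp add: m_assoc)
        also have "\<dots> = (inv k \<otimes> k1 \<otimes> k2) \<otimes> b" using k(1-3) k1(1) k2(1) ac Kc bc by (simp add: k2(2) m_assoc)
        finally have "x = (inv k \<otimes> k1 \<otimes> k2) \<otimes> b" .
        moreover have "inv k \<otimes> k1 \<otimes> k2 \<in> K" using ik k1 k2 subgroup.m_closed[OF K(1)] by simp
        ultimately have "x \<in> K #> b" unfolding mem_r_coset_iff by blast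
        then show ?thesis using a b by blast
      qed
      moreover have "finite (\<Union>a\<in>F0. B a)" 
      proof (rule finite_UN_I)
        show "finite F0" unfolding F0_def by (intro finite_imageI finC)
      qed (use B in blast)
      moreover have "(\<Union>a\<in>F0. B a) \<subseteq> carrier G" using B by blast
      ultimately show ?thesis by (intro exI[of _ "\<Union>a\<in>F0. B a"]) simp
    qed
    let ?w = "\<lambda>x. (1 + l x) powr (2 * s)"
    \<comment> \<open>The weighted measure of \<open>K C K\<close>, finite because this set is a
      finite union of \<open>K\<close>-cosets. It multiplies the error term.\<close>
    define B where "B = (\<integral>\<^sup>+x. ennreal (?w x * indicator A x) \<partial>\<mu>)"
    have Ainv: "k \<otimes> x \<in> A" if k: "k \<in> K" and x: "x \<in> A" for k x
    proof -
      obtain k1 k2 where k1: "x \<in> carrier G" "k1 \<in> K" "k2 \<in> K" "k1 \<otimes> x \<otimes> k2 \<in> C" using x by (auto simp: A_def)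
      have "(k1 \<otimes> inv k) \<otimes> (k \<otimes> x) \<otimes> k2 = k1 \<otimes> x \<otimes> k2" using k k1 Kc by (simp add: m_assoc inv_cancel)
      moreover have "k1 \<otimes> inv k \<in> K" using k k1 subgroup.m_closed[OF K(1)] subgroup.m_inv_closed[OF K(1)] by simp
      ultimately have "\<exists>k1\<in>K. \<exists>k2\<in>K. k1 \<otimes> (k \<otimes> x) \<otimes> k2 \<in> C" using k1 by metis
      then show ?thesis using k k1 Kc by (simp add: A_def)
    qed
    have Aiff: "k \<otimes> x \<in> A \<longleftrightarrow> x \<in> A" if k: "k \<in> K" and x: "x \<in> carrier G" for k x
      using Ainv[of "inv k" "k \<otimes> x"] Ainv[OF k, of x] subgroup.m_inv_closed[OF K(1) k] Kc[OF k] x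
      by (auto simp: inv_cancel)
    have wAinv: "left_inv G K (\<lambda>x. ?w x * indicator A x)"
      using linv(1) Aiff by (auto simp: left_inv_def indicator_def)
    have Bfin: "B < \<infinity>"
    proof -
      have "left_inv G K (\<lambda>x. ennreal (?w x * indicator A x))" using wAinv by (auto simp: left_inv_def)
      then have "B = emeasure \<mu> K * csum G K (\<lambda>x. ennreal (?w x * indicator A x))"
        unfolding B_def by (rule nn_integral_left_inv[OF opsub_K])
      moreover have "fin_supp_mod G K (\<lambda>x. ?w x * indicator A x)"
        using Asupp unfolding fin_supp_mod_def by (auto simp: indicator_def)
      ultimately show ?thesis
        using csum_fin_supp_finite[OF K(1)] emeasure_opsub_finite[OF opsub_K]
        by (simp add: ennreal_mult_less_top)
    qed
    let ?W = "rd_weight_sq G {\<one>} \<nu> l s f"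
    have W: "?W = (\<integral>\<^sup>+x. ennreal ((cmod (f {x}))\<^sup>2 * ?w x) \<partial>\<mu>)" by (rule rd_weight_\<nu>[OF fm lm])
    have wAm [measurable]: "(\<lambda>x. ?w x * indicator A x) \<in> borel_measurable \<mu>"
      using left_inv_measurable[OF opsub_K wAinv] by simp
    have bound: "l2sq \<nu> (hecke_conv G {\<one>} \<nu> f \<xi>)
       \<le> (ennreal (c\<^sup>2) * emeasure \<mu> K) * (ennreal (1 + \<epsilon>) * ?W + ennreal (2 * \<epsilon>) * B) * l2sq \<nu> \<xi>"
      if \<epsilon>: "0 < \<epsilon>" "\<epsilon> \<le> 1" for \<epsilon> :: real
    proof -
      from biinvariant_majorant[OF cont C suppf \<epsilon>(1)] obtain U g where U: "opsub U"
        and g: "left_inv G U g" "right_inv G U g"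
        and fg: "\<And>x. x \<in> carrier G \<Longrightarrow> cmod (f {x}) \<le> g x" "\<And>x. x \<in> carrier G \<Longrightarrow> g x \<le> cmod (f {x}) + \<epsilon>"
        and gs: "\<And>x. x \<in> carrier G \<Longrightarrow> g x \<noteq> 0 \<Longrightarrow> \<exists>u\<in>U. \<exists>v\<in>U. u \<otimes> x \<otimes> v \<in> C"
        by blast
      have gA: "x \<in> A" if "x \<in> carrier G" "g x \<noteq> 0" for x
        using gs[OF that] that opsubD(3)[OF U] by (auto simp: A_def)
      have supp: "fin_supp_mod G K g"
        using Asupp gA unfolding fin_supp_mod_def by metis
      have "(\<integral>\<^sup>+x. ennreal ((g x)\<^sup>2 * ?w x) \<partial>\<mu>)
          \<le> (\<integral>\<^sup>+x. ennreal (1 + \<epsilon>) * ennreal ((cmod (f {x}))\<^sup>2 * ?w x) + ennreal (2 * \<epsilon>) * ennreal (?w x * indicator A x) \<partial>\<mu>)"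
      proof (rule nn_integral_mono)
        fix x assume "x \<in> space \<mu>"
        then have x: "x \<in> carrier G" by (simp add: space_\<mu>)
        let ?a = "cmod (f {x})"
        have g0: "0 \<le> g x" using fg(1)[OF x] norm_ge_zero order_trans by blast
        have "(g x)\<^sup>2 * ?w x \<le> (1 + \<epsilon>) * (?a\<^sup>2 * ?w x) + 2 * \<epsilon> * (?w x * indicator A x)"
        proof (cases "x \<in> A")
          case True
          have "(g x)\<^sup>2 \<le> (?a + \<epsilon>)\<^sup>2" using fg(2)[OF x] g0 by (rule power_mono)
          also have "\<dots> = ?a\<^sup>2 + \<epsilon> * (2 * ?a) + \<epsilon> * \<epsilon>" by (simp add: power2_eq_square algebra_simps)
          \<comment> \<open>From \<open>2 a <= a^2 + 1\<close> and \<open>\<epsilon> <= 1\<close>: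
            the cross term is absorbed into a relative error \<open>\<epsilon>\<close> and an
            absolute error \<open>2 \<epsilon>\<close>.\<close>
          also have "\<dots> \<le> ?a\<^sup>2 + \<epsilon> * (?a\<^sup>2 + 1) + \<epsilon> * 1"
          proof -
            have "0 \<le> (?a - 1)\<^sup>2" by simp
            then have "2 * ?a \<le> ?a\<^sup>2 + 1" by (simp add: power2_eq_square algebra_simps)
            then have "\<epsilon> * (2 * ?a) \<le> \<epsilon> * (?a\<^sup>2 + 1)" using \<epsilon>(1) by (intro mult_left_mono) auto
            moreover have "\<epsilon> * \<epsilon> \<le> \<epsilon> * 1" using \<epsilon> by (intro mult_left_mono) auto
            ultimately show ?thesis by linarith
          qed
          also have "\<dots> = (1 + \<epsilon>) * ?a\<^sup>2 + 2 * \<epsilon>" by (simp add: algebra_simps)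
          finally have "(g x)\<^sup>2 * ?w x \<le> ((1 + \<epsilon>) * ?a\<^sup>2 + 2 * \<epsilon>) * ?w x" by (intro mult_right_mono) auto
          then show ?thesis using True by (simp add: algebra_simps)
        next
          case False
          then have "g x = 0" using gA x by blast
          then show ?thesis using \<epsilon> by simp
        qed
        then have "ennreal ((g x)\<^sup>2 * ?w x) \<le> ennreal ((1 + \<epsilon>) * (?a\<^sup>2 * ?w x) + 2 * \<epsilon> * (?w x * indicator A x))"
          by (rule ennreal_leI)
        also have "\<dots> = ennreal (1 + \<epsilon>) * ennreal (?a\<^sup>2 * ?w x) + ennreal (2 * \<epsilon>) * ennreal (?w x * indicator A x)"
          using \<epsilon> by (subst ennreal_plus) (auto simp: ennreal_mult)
        finally show "ennreal ((g x)\<^sup>2 * ?w x) \<le> \<dots>" .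
      qed
      also have "\<dots> = ennreal (1 + \<epsilon>) * ?W + ennreal (2 * \<epsilon>) * B"
        unfolding W B_def by (subst nn_integral_add) (auto simp: nn_integral_cmult)
      finally have gW: "(\<integral>\<^sup>+x. ennreal ((g x)\<^sup>2 * ?w x) \<partial>\<mu>) \<le> ennreal (1 + \<epsilon>) * ?W + ennreal (2 * \<epsilon>) * B" .
      have "l2sq \<nu> (hecke_conv G {\<one>} \<nu> f \<xi>)
         \<le> ennreal (c\<^sup>2) * emeasure \<mu> K * (\<integral>\<^sup>+x. ennreal ((g x)\<^sup>2 * ?w x) \<partial>\<mu>) * l2sq \<nu> \<xi>"
        by (rule conv_majorant_bound[OF RD U g supp fg(1) fm \<xi>m fin])
      also have "\<dots> \<le> ennreal (c\<^sup>2) * emeasure \<mu> K * (ennreal (1 + \<epsilon>) * ?W + ennreal (2 * \<epsilon>) * B) * l2sq \<nu> \<xi>"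
        by (intro mult_left_mono mult_right_mono gW) auto
      finally show ?thesis .
    qed
    have "l2sq \<nu> (hecke_conv G {\<one>} \<nu> f \<xi>) \<le> (ennreal (c\<^sup>2) * emeasure \<mu> K) * ?W * l2sq \<nu> \<xi>"
    proof (rule ennreal_perturbation_limit[OF bound _ Bfin fin])
      show "ennreal (c\<^sup>2) * emeasure \<mu> K < \<infinity>"
        using emeasure_opsub_finite[OF opsub_K] by (simp add: ennreal_mult_less_top)
    qed
    also have "ennreal (c\<^sup>2) * emeasure \<mu> K = ennreal ((c * sqrt m)\<^sup>2)"
      unfolding m(1) using m(2) by (simp add: ennreal_mult[symmetric] power_mult_distrib)
    finally show ?thesis .
  qed
  moreover have "0 < c * sqrt m" using sc m by simp
  ultimately show ?thesis unfolding pair_RD_def using sc(1) by blast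
qed

text \<open>The witness is the supremum of \<open>l0\<close> over \<open>K x K\<close> outside \<open>K\<close>, and \<open>0\<close> on \<open>K\<close>.\<close>

lemma alg_length_of_length:
  assumes nn: "\<And>x. x \<in> carrier G \<Longrightarrow> 0 \<le> (l0 x :: real)"
    and inv: "\<And>x. x \<in> carrier G \<Longrightarrow> l0 (inv x) = l0 x"
    and sub: "\<And>x y. x \<in> carrier G \<Longrightarrow> y \<in> carrier G \<Longrightarrow> l0 (x \<otimes> y) \<le> l0 x + l0 y"
    and bnd: "\<And>k. k \<in> K \<Longrightarrow> l0 k \<le> B"
  shows "\<exists>l. alg_length G K l \<and> (\<forall>x\<in>carrier G. 1 + l0 x \<le> (1 + B) * (1 + l x))"
proof -
  have Kc: "\<And>k. k \<in> K \<Longrightarrow> k \<in> carrier G" using opsubD(4)[OF opsub_K] by blast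
  have one: "\<one> \<in> K" by (rule subgroup.one_closed[OF K(1)])
  have B: "0 \<le> B" using nn[of \<one>] bnd[OF one] by simp
  define l1 where "l1 x = (SUP p\<in>K \<times> K. l0 (fst p \<otimes> x \<otimes> snd p))" for x
  have bdd: "bdd_above ((\<lambda>p. l0 (fst p \<otimes> x \<otimes> snd p)) ` (K \<times> K))" if x: "x \<in> carrier G" for x
  proof (rule bdd_aboveI2[where M="l0 x + 2 * B"])
    fix p assume "p \<in> K \<times> K"
    then have p: "fst p \<in> K" "snd p \<in> K" by auto
    have "l0 (fst p \<otimes> x \<otimes> snd p) \<le> l0 (fst p) + l0 x + l0 (snd p)"
      using sub[of "fst p \<otimes> x" "snd p"] sub[of "fst p" x] p Kc x by simp
    then show "l0 (fst p \<otimes> x \<otimes> snd p) \<le> l0 x + 2 * B" using bnd[OF p(1)] bnd[OF p(2)] by simp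
  qed
  have up: "l0 (k \<otimes> x \<otimes> k') \<le> l1 x" if "x \<in> carrier G" "k \<in> K" "k' \<in> K" for x k k'
    unfolding l1_def using bdd[OF that(1)] that by (intro cSUP_upper2[of _ _ "(k, k')"]) auto
  have least: "l1 x \<le> c" if "\<And>k k'. k \<in> K \<Longrightarrow> k' \<in> K \<Longrightarrow> l0 (k \<otimes> x \<otimes> k') \<le> c" for x c
    unfolding l1_def using that one by (intro cSUP_least) auto
  have l01: "l0 x \<le> l1 x" if "x \<in> carrier G" for x using up[OF that one one] that by simp
  have l1nn: "0 \<le> l1 x" if "x \<in> carrier G" for x using l01[OF that] nn[OF that] by simp
  have l1inv: "l1 (inv x) \<le> l1 x" if x: "x \<in> carrier G" for x
  proof (rule least)
    fix k k' assume k: "k \<in> K" "k' \<in> K"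
    have "k \<otimes> inv x \<otimes> k' = inv (inv k' \<otimes> x \<otimes> inv k)" using k Kc x by (simp add: inv_mult_group m_assoc)
    then have "l0 (k \<otimes> inv x \<otimes> k') = l0 (inv k' \<otimes> x \<otimes> inv k)" using inv[of "inv k' \<otimes> x \<otimes> inv k"] k Kc x by simp
    also have "\<dots> \<le> l1 x" using up[OF x] k subgroup.m_inv_closed[OF K(1)] by simp
    finally show "l0 (k \<otimes> inv x \<otimes> k') \<le> l1 x" .
  qed
  have l1mult: "l1 (x \<otimes> y) \<le> l1 x + l1 y" if x: "x \<in> carrier G" and y: "y \<in> carrier G" for x y
  proof (rule least)
    fix k k' assume k: "k \<in> K" "k' \<in> K"
    have "l0 (k \<otimes> (x \<otimes> y) \<otimes> k') = l0 ((k \<otimes> x \<otimes> \<one>) \<otimes> (\<one> \<otimes> y \<otimes> k'))" using k Kc x y by (simp add: m_assoc)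
    also have "\<dots> \<le> l0 (k \<otimes> x \<otimes> \<one>) + l0 (\<one> \<otimes> y \<otimes> k')" using k Kc x y by (intro sub) auto
    also have "\<dots> \<le> l1 x + l1 y" using k one x y by (intro add_mono up) auto
    finally show "l0 (k \<otimes> (x \<otimes> y) \<otimes> k') \<le> l1 x + l1 y" .
  qed
  have l1left: "l1 (k \<otimes> x) \<le> l1 x" "l1 (x \<otimes> k) \<le> l1 x" if k: "k \<in> K" and x: "x \<in> carrier G" for k x
  proof -
    show "l1 (k \<otimes> x) \<le> l1 x"
    proof (rule least)
      fix a b assume ab: "a \<in> K" "b \<in> K"
      have "a \<otimes> (k \<otimes> x) \<otimes> b = (a \<otimes> k) \<otimes> x \<otimes> b" using ab k Kc x by (simp add: m_assoc)
      then show "l0 (a \<otimes> (k \<otimes> x) \<otimes> b) \<le> l1 x" using up[OF x _ ab(2), of "a \<otimes> k"] subgroup.m_closed[OF K(1) ab(1) k] by simp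
    qed
    show "l1 (x \<otimes> k) \<le> l1 x"
    proof (rule least)
      fix a b assume ab: "a \<in> K" "b \<in> K"
      have "a \<otimes> (x \<otimes> k) \<otimes> b = a \<otimes> x \<otimes> (k \<otimes> b)" using ab k Kc x by (simp add: m_assoc)
      then show "l0 (a \<otimes> (x \<otimes> k) \<otimes> b) \<le> l1 x" using up[OF x ab(1), of "k \<otimes> b"] subgroup.m_closed[OF K(1) k ab(2)] by simp
    qed
  qed
  define l where "l x = (if x \<in> K then 0 else l1 x)" for x
  have inK: "inv x \<in> K \<longleftrightarrow> x \<in> K" if "x \<in> carrier G" for x
    using subgroup.m_inv_closed[OF K(1), of "inv x"] subgroup.m_inv_closed[OF K(1), of x] that by auto
  \<comment> \<open>Resetting the supremum to 0 on \<open>K\<close> could break subadditivity only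
    when a factor lies in \<open>K\<close>; but multiplication by \<open>K\<close> does not increase
    \<open>l1\<close>.\<close>
  have "l (x \<otimes> y) \<le> l x + l y" if x: "x \<in> carrier G" and y: "y \<in> carrier G" for x y
  proof -
    consider "x \<otimes> y \<in> K" | "x \<in> K" "x \<otimes> y \<notin> K" | "y \<in> K" "x \<otimes> y \<notin> K" | "x \<notin> K" "y \<notin> K" "x \<otimes> y \<notin> K" by blast
    then show ?thesis
    proof cases
      case 1 then show ?thesis using l1nn[OF x] l1nn[OF y] by (simp add: l_def)
    next
      case 2
      then have "y \<notin> K" using subgroup.m_closed[OF K(1)] by blast
      then show ?thesis using 2 l1left(1)[OF 2(1) y] by (simp add: l_def)
    next
      case 3
      then have "x \<notin> K" using subgroup.m_closed[OF K(1)] by blast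
      then show ?thesis using 3 l1left(2)[OF 3(1) x] by (simp add: l_def)
    next
      case 4 then show ?thesis using l1mult[OF x y] by (simp add: l_def)
    qed
  qed
  moreover have "l (inv x) = l x" if x: "x \<in> carrier G" for x
    using inK[OF x] l1inv[OF x] l1inv[of "inv x"] x by (simp add: l_def)
  ultimately have "alg_length G K l"
    using l1nn one by (auto simp: alg_length_def l_def)
  \<comment> \<open>On \<open>K\<close>, where \<open>l\<close> vanishes, the factor
    \<open>1 + B\<close> absorbs the values of \<open>l0\<close>; off \<open>K\<close> already
    \<open>l0 <= l1\<close>.\<close>
  moreover have "1 + l0 x \<le> (1 + B) * (1 + l x)" if x: "x \<in> carrier G" for x
  proof (cases "x \<in> K")
    case True then show ?thesis using bnd by (simp add: l_def)
  next
    case False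
    have "1 * (1 + l1 x) \<le> (1 + B) * (1 + l1 x)" using B l1nn[OF x] by (intro mult_right_mono) auto
    then show ?thesis using False l01[OF x] by (simp add: l_def)
  qed
  ultimately show ?thesis by blast
qed

text \<open>Tests (RD) of the group on \<open>K\<close>-bi-invariant functions. These are locally
  constant with compact support, and each Haar integral becomes \<open>m\<close> times a coset sum.
  The given length need not vanish on \<open>K\<close>, so it is replaced by one that does, at the
  cost of a factor.\<close>

lemma RD_one_imp_disc_RD:
  assumes RD: "pair_RD G T {\<one>} \<nu>"
  shows "\<exists>l s c. disc_RD G K l s c"
proof -
  from RD obtain l0 s c where len: "length_function G T {\<one>} l0" and lb: "locally_bounded G T {\<one>} l0"
    and sc: "0 < s" "0 < c"
    and bound: "\<And>f \<xi>. hecke_fun G T {\<one>} f \<Longrightarrow> \<xi> \<in> borel_measurable \<nu> \<Longrightarrow> l2sq \<nu> \<xi> < \<infinity> \<Longrightarrow>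
       l2sq \<nu> (hecke_conv G {\<one>} \<nu> f \<xi>) \<le> ennreal (c\<^sup>2) * rd_weight_sq G {\<one>} \<nu> l0 s f * l2sq \<nu> \<xi>"
    unfolding pair_RD_def by blast
  have Kc: "\<And>k. k \<in> K \<Longrightarrow> k \<in> carrier G" using opsubD(4)[OF opsub_K] by blast
  have l0m [measurable]: "l0 \<in> borel_measurable \<mu>" using len by (simp add: length_function_def measurable_\<mu>)
  \<comment> \<open>Local boundedness, tested on the compact subgroup \<open>K\<close>, supplies the
    bound \<open>B\<close>.\<close>
  have "compactin (quot_top G T {\<one>}) ((\<lambda>x. {x}) ` K)"
    using K(3) continuous_map_singleton by (rule image_compactin)
  then obtain B where B: "\<And>x. x \<in> carrier G \<Longrightarrow> {\<one>} #> x \<in> (\<lambda>x. {x}) ` K \<Longrightarrow> l0 x \<le> B"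
    using lb unfolding locally_bounded_def by blast
  have BK: "l0 k \<le> B" if "k \<in> K" for k using B[OF Kc[OF that]] that Kc[OF that] by (simp add: r_coset_one)
  have l0nn: "0 \<le> l0 x" if "x \<in> carrier G" for x using len that by (simp add: length_function_def)
  have B0: "0 \<le> B" using BK[OF subgroup.one_closed[OF K(1)]] l0nn[of \<one>] by simp
  obtain l where l: "alg_length G K l" and ll: "\<And>x. x \<in> carrier G \<Longrightarrow> 1 + l0 x \<le> (1 + B) * (1 + l x)"
    using alg_length_of_length[of l0 B] len BK by (auto simp: length_function_def)
  note linv = alg_length_inv[OF K(1) l]
  define m where "m = measure \<mu> K"
  have m: "emeasure \<mu> K = ennreal m" "0 < m"
    unfolding m_def by (rule measure_K)+
  \<comment> \<open>Changing the length costs \<open>(1 + B) powr s\<close>. The power of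
    \<open>m\<close> comes from comparing \<open>m^3\<close> on the left (twice from the squared
    convolution, once from the outer integral) with \<open>m^2\<close> on the right (weight and
    \<open>\<xi>\<close>).\<close>
  define c' where "c' = c * (1 + B) powr s / sqrt m"
  have c': "0 < c'" unfolding c'_def using sc m B0 by simp
  have "disc_RD G K l s c'"
    unfolding disc_RD_def
  proof (intro conjI allI impI)
    show "alg_length G K l" "0 < s" "0 < c'" by fact+
    fix f \<xi> :: "'a \<Rightarrow> real"
    assume f0: "\<forall>x\<in>carrier G. 0 \<le> f x" and f: "left_inv G K f" "right_inv G K f"
      and supp: "fin_supp_mod G K f" and \<xi>0: "\<forall>x\<in>carrier G. 0 \<le> \<xi> x" and \<xi>: "left_inv G K \<xi>"
      and fin: "csum G K (\<lambda>x. ennreal ((\<xi> x)\<^sup>2)) < \<infinity>"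
    define f' where "f' D = complex_of_real (f (the_elem D))" for D
    define \<xi>' where "\<xi>' D = complex_of_real (\<xi> (the_elem D))" for D
    have fm [measurable]: "f \<in> borel_measurable \<mu>" by (rule left_inv_measurable[OF opsub_K f(1)]) simp
    have \<xi>m [measurable]: "\<xi> \<in> borel_measurable \<mu>" by (rule left_inv_measurable[OF opsub_K \<xi>]) simp
    have f'm: "(\<lambda>x. f' {x}) \<in> borel_measurable \<mu>" and \<xi>'m: "(\<lambda>x. \<xi>' {x}) \<in> borel_measurable \<mu>"
      by (simp_all add: f'_def \<xi>'_def)
    have hf: "hecke_fun G T {\<one>} f'"
      unfolding hecke_fun_def
    proof (intro conjI ballI)
      have "continuous_map T euclidean (\<lambda>x. complex_of_real (f x))"
        unfolding continuous_map_def topspace_G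
        using f(1) Kc by (auto intro!: openin_opsub_inv[OF opsub_K] simp: left_inv_def)
      from continuous_map_compose[OF continuous_map_the_elem this]
      show "continuous_map (quot_top G T {\<one>}) euclidean f'" by (simp add: o_def f'_def[abs_def])
      obtain F where F: "finite F" "F \<subseteq> carrier G" "\<And>x. x \<in> carrier G \<Longrightarrow> f x \<noteq> 0 \<Longrightarrow> \<exists>a\<in>F. x \<in> K #> a"
        using supp by (auto simp: fin_supp_mod_def)
      have "compactin T (\<Union>a\<in>F. K #> a)"
        using F(1,2) vol_translate(1)[OF blk_K[OF opsub_K]] blkD(2) by (intro compactin_Union) auto
      then have "compactin (quot_top G T {\<one>}) ((\<lambda>x. {x}) ` (\<Union>a\<in>F. K #> a))"
        using continuous_map_singleton by (rule image_compactin)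
      moreover have "f' D = 0" if D: "D \<in> rcosets {\<one>} - (\<lambda>x. {x}) ` (\<Union>a\<in>F. K #> a)" for D
      proof -
        obtain x where x: "x \<in> carrier G" "D = {x}" using D by (auto simp: rcosets_one)
        then have "\<not> (\<exists>a\<in>F. x \<in> K #> a)" using D by blast
        then show ?thesis using F(3)[OF x(1)] x by (auto simp: f'_def)
      qed
      ultimately show "\<exists>C. compactin (quot_top G T {\<one>}) C \<and> (\<forall>D\<in>rcosets {\<one>} - C. f' D = 0)" by blast
      show "f' ({\<one>} #> (x \<otimes> h)) = f' ({\<one>} #> x)" if "x \<in> carrier G" "h \<in> {\<one>}" for x h
        using that by simp
    qed
    have l2\<xi>: "l2sq \<nu> \<xi>' = ennreal m * csum G K (\<lambda>x. ennreal ((\<xi> x)\<^sup>2))"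
      unfolding l2sq_\<nu>[OF \<xi>'m] m(1)[symmetric] using \<xi>
      by (subst nn_integral_left_inv[OF opsub_K, symmetric]) (auto simp: \<xi>'_def left_inv_def)
    have fin': "l2sq \<nu> \<xi>' < \<infinity>" unfolding l2\<xi> using fin by (simp add: ennreal_mult_less_top)
    let ?w = "\<lambda>x. (1 + l x) powr (2 * s)"
    let ?W = "csum G K (\<lambda>x. ennreal ((f x)\<^sup>2 * ?w x))"
    have weight: "rd_weight_sq G {\<one>} \<nu> l0 s f' \<le> ennreal ((1 + B) powr (2 * s)) * (ennreal m * ?W)"
    proof -
      have fw: "left_inv G K (\<lambda>x. ennreal ((f x)\<^sup>2 * ?w x))" using f(1) linv(1) by (auto simp: left_inv_def)
      have fwm [measurable]: "(\<lambda>x. ennreal ((f x)\<^sup>2 * ?w x)) \<in> borel_measurable \<mu>"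
        by (rule left_inv_measurable[OF opsub_K fw]) simp
      have "rd_weight_sq G {\<one>} \<nu> l0 s f' = (\<integral>\<^sup>+x. ennreal ((f x)\<^sup>2 * (1 + l0 x) powr (2 * s)) \<partial>\<mu>)"
        unfolding rd_weight_\<nu>[OF f'm l0m] by (simp add: f'_def)
      also have "\<dots> \<le> (\<integral>\<^sup>+x. ennreal ((1 + B) powr (2 * s)) * ennreal ((f x)\<^sup>2 * ?w x) \<partial>\<mu>)"
      proof (rule nn_integral_mono)
        fix x assume "x \<in> space \<mu>"
        then have x: "x \<in> carrier G" by (simp add: space_\<mu>)
        have lx: "0 \<le> l x" using l x by (simp add: alg_length_def)
        have "(1 + l0 x) powr (2 * s) \<le> ((1 + B) * (1 + l x)) powr (2 * s)"
          using ll[OF x] l0nn[OF x] sc by (intro powr_mono2) auto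
        also have "\<dots> = (1 + B) powr (2 * s) * ?w x" using B0 lx by (simp add: powr_mult)
        finally have "(f x)\<^sup>2 * (1 + l0 x) powr (2 * s) \<le> (f x)\<^sup>2 * ((1 + B) powr (2 * s) * ?w x)"
          by (intro mult_left_mono) auto
        also have "\<dots> = (1 + B) powr (2 * s) * ((f x)\<^sup>2 * ?w x)" by (simp add: ac_simps)
        finally show "ennreal ((f x)\<^sup>2 * (1 + l0 x) powr (2 * s)) \<le> ennreal ((1 + B) powr (2 * s)) * ennreal ((f x)\<^sup>2 * ?w x)"
          by (simp add: ennreal_mult[symmetric] ennreal_leI)
      qed
      also have "\<dots> = ennreal ((1 + B) powr (2 * s)) * (ennreal m * ?W)"
        unfolding m(1)[symmetric] nn_integral_left_inv[OF opsub_K fw, symmetric] by (rule nn_integral_cmult) measurable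
      finally show ?thesis .
    qed
    let ?A = "\<lambda>x. csum G K (\<lambda>y. ennreal (f (x \<otimes> inv y) * \<xi> y))"
    have Al: "left_inv G K ?A"
      unfolding left_inv_def
    proof (intro ballI)
      fix k x assume k: "k \<in> K" and x: "x \<in> carrier G"
      have "f (k \<otimes> x \<otimes> inv y) = f (x \<otimes> inv y)" if "y \<in> carrier G" for y
        using left_invD[OF f(1) k, of "x \<otimes> inv y"] Kc[OF k] x that by (simp add: m_assoc)
      then show "?A (k \<otimes> x) = ?A x" by (intro csum_cong) simp
    qed
    have conv: "ennreal (cmod (hecke_conv G {\<one>} \<nu> f' \<xi>' {x})) = ennreal m * ?A x" if x: "x \<in> carrier G" for x
    proof -
      let ?a = "\<lambda>y. f (x \<otimes> inv y) * \<xi> y"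
      have a0: "0 \<le> ?a y" if "y \<in> carrier G" for y using f0 \<xi>0 x that by simp
      have am: "?a \<in> borel_measurable \<mu>" using conv_argument_measurable[OF fm x] by measurable
      have ainv: "left_inv G K (\<lambda>y. ennreal (?a y))"
        unfolding left_inv_def
      proof (intro ballI)
        fix k y assume k: "k \<in> K" and y: "y \<in> carrier G"
        have "inv k \<in> K" using subgroup.m_inv_closed[OF K(1) k] .
        then have "f (x \<otimes> inv y \<otimes> inv k) = f (x \<otimes> inv y)" using right_invD[OF f(2)] x y by simp
        then show "ennreal (?a (k \<otimes> y)) = ennreal (?a y)"
          using left_invD[OF \<xi> k y] Kc[OF k] y x by (simp add: inv_mult_group m_assoc)
      qed
      have nn: "(\<integral>\<^sup>+y. ennreal (?a y) \<partial>\<mu>) = ennreal m * ?A x"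
        unfolding m(1)[symmetric] by (rule nn_integral_left_inv[OF opsub_K ainv])
      have "fin_supp_mod G K (\<lambda>y. f (x \<otimes> inv y))"
        by (rule fin_supp_mod_convolution[OF K(1) hecke_fin_K supp x])
      then have "fin_supp_mod G K ?a" unfolding fin_supp_mod_def by (metis mult_zero_left)
      then have "?A x < \<infinity>" by (rule csum_fin_supp_finite[OF K(1)])
      then have "(\<integral>\<^sup>+y. ennreal (?a y) \<partial>\<mu>) < \<infinity>" unfolding nn by (simp add: ennreal_mult_less_top)
      then have int: "integrable \<mu> ?a"
        using am a0 by (intro integrableI_nonneg) (auto simp: space_\<mu>)
      have "hecke_conv G {\<one>} \<nu> f' \<xi>' {x} = (LINT y|\<mu>. complex_of_real (?a y))"
        unfolding hecke_conv_one[OF f'm \<xi>'m x] by (simp add: f'_def \<xi>'_def)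
      also have "\<dots> = complex_of_real (LINT y|\<mu>. ?a y)" by (rule integral_complex_of_real)
      finally have "cmod (hecke_conv G {\<one>} \<nu> f' \<xi>' {x}) = (LINT y|\<mu>. ?a y)"
        using a0 Bochner_Integration.integral_nonneg[of \<mu> ?a] by (simp add: space_\<mu>)
      moreover have "AE y in \<mu>. 0 \<le> ?a y" using a0 by (intro AE_I2) (simp add: space_\<mu>)
      ultimately show ?thesis using nn_integral_eq_integral[OF int] nn by simp
    qed
    let ?L = "csum G K (\<lambda>x. (?A x)\<^sup>2)"
    have lhs: "l2sq \<nu> (hecke_conv G {\<one>} \<nu> f' \<xi>') = ennreal (m ^ 3) * ?L"
    proof -
      have A2: "left_inv G K (\<lambda>x. (ennreal m * ?A x)\<^sup>2)" using Al by (simp add: left_inv_def)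
      have "l2sq \<nu> (hecke_conv G {\<one>} \<nu> f' \<xi>') = (\<integral>\<^sup>+D. (\<lambda>D. (ennreal m * ?A (the_elem D))\<^sup>2) D \<partial>\<nu>)"
        unfolding l2sq_def
      proof (rule nn_integral_cong)
        fix D assume "D \<in> space \<nu>"
        then obtain x where x: "x \<in> carrier G" "D = {x}" by (auto simp: space_\<nu>)
        then show "ennreal ((cmod (hecke_conv G {\<one>} \<nu> f' \<xi>' D))\<^sup>2) = (ennreal m * ?A (the_elem D))\<^sup>2"
          using conv[OF x(1)] by (simp flip: ennreal_power)
      qed
      also have "\<dots> = (\<integral>\<^sup>+x. (ennreal m * ?A x)\<^sup>2 \<partial>\<mu>)"
        using left_inv_measurable[OF opsub_K A2, of borel] by (subst nn_integral_\<nu>) auto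
      also have "\<dots> = ennreal m * csum G K (\<lambda>x. (ennreal m * ?A x)\<^sup>2)"
        unfolding m(1)[symmetric] using A2 m(1) by (intro nn_integral_left_inv[OF opsub_K]) simp
      also have "\<dots> = ennreal m * ((ennreal m)\<^sup>2 * ?L)"
        by (simp add: power_mult_distrib csum_cmult)
      also have "\<dots> = ennreal (m ^ 3) * ?L"
        using m(2) by (simp add: ennreal_power[symmetric] power3_eq_cube power2_eq_square mult.assoc ennreal_mult)
      finally show ?thesis .
    qed
    let ?X = "csum G K (\<lambda>x. ennreal ((\<xi> x)\<^sup>2))"
    have "ennreal (m ^ 3) * ?L \<le> ennreal (c\<^sup>2) * rd_weight_sq G {\<one>} \<nu> l0 s f' * l2sq \<nu> \<xi>'"
      unfolding lhs[symmetric] by (rule bound[OF hf measurable_\<nu>I[OF \<xi>'m] fin'])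
    also have "\<dots> \<le> ennreal (c\<^sup>2) * (ennreal ((1 + B) powr (2 * s)) * (ennreal m * ?W)) * (ennreal m * ?X)"
      unfolding l2\<xi> by (intro mult_left_mono mult_right_mono weight) auto
    also have "\<dots> = ennreal (m ^ 3) * (ennreal (c'\<^sup>2) * ?W * ?X)"
    proof -
      have "c\<^sup>2 * (1 + B) powr (2 * s) * m * m = m ^ 3 * c'\<^sup>2"
      proof -
        have "((1 + B) powr s)\<^sup>2 = (1 + B) powr (2 * s)" using B0 by (simp add: powr_power mult.commute)
        then show ?thesis
          using m(2) by (simp add: c'_def power_divide power_mult_distrib power3_eq_cube)
      qed
      then have e: "ennreal (c\<^sup>2) * ennreal ((1 + B) powr (2 * s)) * ennreal m * ennreal m = ennreal (m ^ 3) * ennreal (c'\<^sup>2)"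
        using m(2) by (simp add: ennreal_mult[symmetric])
      have reorder: "a * (b * (d * w)) * (d * x) = a * b * d * d * (w * x)" for a b d w x :: ennreal
        by (simp only: ac_simps)
      show ?thesis unfolding reorder e by (simp only: mult.assoc)
    qed
    finally have "ennreal (m ^ 3) * ?L \<le> ennreal (m ^ 3) * (ennreal (c'\<^sup>2) * ?W * ?X)" .
    then show "?L \<le> ennreal (c'\<^sup>2) * ?W * ?X"
      using m(2) by (subst (asm) ennreal_mult_le_mult_iff) auto
  qed
  then show ?thesis by blast
qed

end

section \<open>The Schlichting completion\<close>

lemma topspace_perm_top: "topspace (perm_top X) = Bij X"
proof -
  have "Bij X \<subseteq> (\<Pi>\<^sub>E i\<in>X. X)"
    unfolding PiE_def by (intro subsetI IntI Bij_imp_extensional Bij_imp_funcset)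
  then show ?thesis by (auto simp: perm_top_def)
qed

text \<open>A basic box restricts finitely many coordinates, and in a discrete space each of these
  may be shrunk to a point. Later arguments thus only need approximation on finite sets.\<close>

lemma openin_perm_top:
  "openin (perm_top X) W \<longleftrightarrow> W \<subseteq> Bij X \<and>
     (\<forall>y\<in>W. \<exists>F. finite F \<and> F \<subseteq> X \<and> (\<forall>z\<in>Bij X. (\<forall>C\<in>F. z C = y C) \<longrightarrow> z \<in> W))"
  (is "?l \<longleftrightarrow> ?r")
proof
  assume ?l
  then obtain V where V: "openin (product_topology (\<lambda>_. discrete_topology X) X) V" "W = V \<inter> Bij X"
    unfolding perm_top_def openin_subtopology by blast
  have "\<exists>F. finite F \<and> F \<subseteq> X \<and> (\<forall>z\<in>Bij X. (\<forall>C\<in>F. z C = y C) \<longrightarrow> z \<in> W)" if y: "y \<in> W" for y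
  proof -
    obtain U where U: "finite {i \<in> X. U i \<noteq> X}" "y \<in> Pi\<^sub>E X U" "Pi\<^sub>E X U \<subseteq> V"
      using V y unfolding openin_product_topology_alt by fastforce
    have "z \<in> W" if z: "z \<in> Bij X" and eq: "\<forall>C\<in>{i \<in> X. U i \<noteq> X}. z C = y C" for z
    proof -
      have "z \<in> Pi\<^sub>E X U"
      proof (rule PiE_I)
        fix C assume C: "C \<in> X"
        show "z C \<in> U C"
        proof (cases "U C = X")
          case True
          then show ?thesis using Bij_imp_funcset[OF z] C by auto
        next
          case False
          then show ?thesis using eq C U(2) by auto
        qed
      next
        fix C assume "C \<notin> X"
        then show "z C = undefined" using Bij_imp_extensional[OF z] by (simp add: extensional_def)
      qed
      then show ?thesis using U V z by auto
    qed
    then show ?thesis using U(1) by (intro exI[of _ "{i \<in> X. U i \<noteq> X}"]) auto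
  qed
  then show ?r using V by auto
next
  assume r: ?r
  then have "\<forall>y\<in>W. \<exists>F. finite F \<and> F \<subseteq> X \<and> (\<forall>z\<in>Bij X. (\<forall>C\<in>F. z C = y C) \<longrightarrow> z \<in> W)" by blast
  then obtain F where F: "\<And>y. y \<in> W \<Longrightarrow> finite (F y) \<and> F y \<subseteq> X \<and> (\<forall>z\<in>Bij X. (\<forall>C\<in>F y. z C = y C) \<longrightarrow> z \<in> W)"
    by metis
  let ?U = "\<lambda>y C. if C \<in> F y then {y C} else X"
  define V where "V = (\<Union>y\<in>W. Pi\<^sub>E X (?U y))"
  have maps: "y C \<in> X" if "y \<in> W" "C \<in> X" for y C using Bij_imp_funcset[of y X] r that by auto
  have "openin (product_topology (\<lambda>_. discrete_topology X) X) V"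
    unfolding V_def
  proof (intro openin_Union, safe)
    fix y assume y: "y \<in> W"
    have "{i \<in> X. ?U y i \<noteq> X} \<subseteq> F y" by auto
    then have "finite {i \<in> X. ?U y i \<noteq> X}" using F[OF y] finite_subset by blast
    then show "openin (product_topology (\<lambda>_. discrete_topology X) X) (Pi\<^sub>E X (?U y))"
      using maps[OF y] by (intro openin_PiE_gen[THEN iffD2] disjI2 conjI ballI) auto
  qed
  moreover have "W = V \<inter> Bij X"
  proof (intro equalityI subsetI)
    fix y assume y: "y \<in> W"
    then have yB: "y \<in> Bij X" using r by auto
    have "y \<in> Pi\<^sub>E X (?U y)"
      using maps[OF y] Bij_imp_extensional[OF yB] by (auto simp: PiE_def)
    then show "y \<in> V \<inter> Bij X" using y yB by (auto simp: V_def)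
  next
    fix z assume "z \<in> V \<inter> Bij X"
    then obtain y where y: "y \<in> W" "z \<in> Pi\<^sub>E X (?U y)" "z \<in> Bij X" by (auto simp: V_def)
    then have "z C = y C" if "C \<in> F y" for C using PiE_mem[OF y(2), of C] F[OF y(1)] that by auto
    then show "z \<in> W" using F[OF y(1)] y(3) by blast
  qed
  ultimately show ?l unfolding perm_top_def openin_subtopology by blast
qed

lemma in_closure_perm_top:
  assumes "S \<subseteq> Bij X"
  shows "y \<in> perm_top X closure_of S \<longleftrightarrow>
    y \<in> Bij X \<and> (\<forall>F. finite F \<longrightarrow> F \<subseteq> X \<longrightarrow> (\<exists>z\<in>S. \<forall>C\<in>F. z C = y C))"
  (is "?l \<longleftrightarrow> ?r")
proof
  assume l: ?l
  have yB: "y \<in> Bij X" using l closure_of_subset_topspace[of "perm_top X" S] topspace_perm_top[of X] by auto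
  have "\<exists>z\<in>S. \<forall>C\<in>F. z C = y C" if F: "finite F" "F \<subseteq> X" for F
  proof -
    have op: "openin (perm_top X) {z \<in> Bij X. \<forall>C\<in>F. z C = y C}"
      unfolding openin_perm_top using F by auto
    have "\<exists>z. z \<in> S \<and> z \<in> W" if "y \<in> W" "openin (perm_top X) W" for W
      using l that by (simp add: in_closure_of)
    from this[OF _ op] yB show ?thesis by auto
  qed
  then show ?r using yB by blast
next
  assume r: ?r
  show ?l
    unfolding in_closure_of topspace_perm_top
  proof (intro conjI allI impI)
    fix W assume W: "y \<in> W \<and> openin (perm_top X) W"
    then obtain F where F: "finite F" "F \<subseteq> X" "\<forall>z\<in>Bij X. (\<forall>C\<in>F. z C = y C) \<longrightarrow> z \<in> W"
      unfolding openin_perm_top by blast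
    then obtain z where "z \<in> S" "\<forall>C\<in>F. z C = y C" using r by blast
    then show "\<exists>z. z \<in> S \<and> z \<in> W" using F assms by blast
  qed (use r in blast)
qed

section \<open>The completion and its action on left cosets\<close>

locale schlichting = plain_group G for G :: "'a monoid" (structure) +
  fixes H :: "'a set"
  assumes hecke: "hecke_pair G H"
begin

lemma H: "subgroup H G" using hecke by (simp add: hecke_pair_def)

lemma Hc: "h \<in> H \<Longrightarrow> h \<in> carrier G" using subgroup.mem_carrier[OF H] .

abbreviation X :: "'a set set" where "X \<equiv> lcosets H"
abbreviation L :: "('a set \<Rightarrow> 'a set) monoid" where "L \<equiv> sch_group G H"
abbreviation K :: "('a set \<Rightarrow> 'a set) set" where "K \<equiv> sch_sub G H"
abbreviation \<sigma> :: "'a \<Rightarrow> 'a set \<Rightarrow> 'a set" where "\<sigma> \<equiv> sch_emb G H"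

lemma X_iff: "C \<in> X \<longleftrightarrow> (\<exists>a\<in>carrier G. C = a <# H)"
  by (auto simp: LCOSETS_def)

lemma X_subset: "C \<in> X \<Longrightarrow> C \<subseteq> carrier G"
  using l_coset_subset_G[OF subgroup.subset[OF H]] by (auto simp: X_iff)

lemma act_assoc: "C \<in> X \<Longrightarrow> g \<in> carrier G \<Longrightarrow> h \<in> carrier G \<Longrightarrow> g <# (h <# C) = (g \<otimes> h) <# C"
  using X_subset by (simp add: lcos_m_assoc)

lemma act_one: "C \<in> X \<Longrightarrow> \<one> <# C = C"
  using X_subset by (simp add: lcos_mult_one)

lemma act_closed: "C \<in> X \<Longrightarrow> g \<in> carrier G \<Longrightarrow> g <# C \<in> X"
  using lcos_m_assoc[OF subgroup.subset[OF H]] by (auto simp: X_iff)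

lemma H_in_X: "H \<in> X"
  using lcos_mult_one[OF subgroup.subset[OF H]] by (auto simp: X_iff intro!: bexI[of _ \<one>])

lemma act_H_iff: "g \<in> carrier G \<Longrightarrow> g <# H = H \<longleftrightarrow> g \<in> H"
  using lcos_self[OF _ H] coset_join3[OF _ H] by auto

lemma \<sigma>_apply: "C \<in> X \<Longrightarrow> \<sigma> g C = g <# C" by (simp add: sch_emb_def)

lemma \<sigma>_Bij: assumes g: "g \<in> carrier G" shows "\<sigma> g \<in> Bij X"
proof -
  have "bij_betw (\<sigma> g) X X"
  proof (rule bij_betw_byWitness[where f'="\<sigma> (inv g)"])
    show "\<forall>C\<in>X. \<sigma> (inv g) (\<sigma> g C) = C" "\<forall>C\<in>X. \<sigma> g (\<sigma> (inv g) C) = C"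
      using g by (auto simp: \<sigma>_apply act_closed act_assoc act_one)
    show "\<sigma> g ` X \<subseteq> X" "\<sigma> (inv g) ` X \<subseteq> X" using g by (auto simp: \<sigma>_apply act_closed)
  qed
  then show ?thesis by (simp add: Bij_def sch_emb_def)
qed

lemma sch_carrier_iff:
  "y \<in> sch_carrier G H \<longleftrightarrow>
    y \<in> Bij X \<and> (\<forall>F. finite F \<longrightarrow> F \<subseteq> X \<longrightarrow> (\<exists>g\<in>carrier G. \<forall>C\<in>F. g <# C = y C))"
proof -
  have "\<sigma> ` carrier G \<subseteq> Bij X" using \<sigma>_Bij by auto
  from in_closure_perm_top[OF this, of y] show ?thesis
    unfolding sch_carrier_def by (auto simp: \<sigma>_apply subset_iff Ball_def Bex_def)
qed

lemma sch_sub_iff: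
  "y \<in> K \<longleftrightarrow> y \<in> Bij X \<and> (\<forall>F. finite F \<longrightarrow> F \<subseteq> X \<longrightarrow> (\<exists>g\<in>H. \<forall>C\<in>F. g <# C = y C))"
proof -
  have "\<sigma> ` H \<subseteq> Bij X" using \<sigma>_Bij Hc by auto
  from in_closure_perm_top[OF this, of y] show ?thesis
    unfolding sch_sub_def by (auto simp: \<sigma>_apply subset_iff Ball_def Bex_def)
qed

lemma carrier_L: "carrier L = sch_carrier G H" by (simp add: sch_group_def)

lemma L_Bij: "y \<in> carrier L \<Longrightarrow> y \<in> Bij X" by (simp add: carrier_L sch_carrier_iff)

lemma L_approx: "y \<in> carrier L \<Longrightarrow> finite F \<Longrightarrow> F \<subseteq> X \<Longrightarrow> \<exists>g\<in>carrier G. \<forall>C\<in>F. g <# C = y C"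
  by (simp add: carrier_L sch_carrier_iff)

lemma Bij_inv_apply:
  assumes "y \<in> Bij X" "C \<in> X"
  shows "inv_into X y C \<in> X" "y (inv_into X y C) = C" "y C \<in> X"
proof -
  show "inv_into X y C \<in> X" by (rule Bij_inv_into_mem[OF assms])
  show "y (inv_into X y C) = C" using assms by (intro bij_betw_inv_into_right[of y X X]) (auto simp: Bij_def)
  show "y C \<in> X" using Bij_imp_funcset[OF assms(1)] assms(2) by blast
qed

text \<open>Approximants of \<open>y\<close> on suitable finite sets suffice: on the preimage of
  \<open>F\<close> for the inverse, and on the image \<open>z F\<close> for the product
  \<open>y z\<close>.\<close>

lemma subgroup_sch_carrier: "subgroup (sch_carrier G H) (BijGroup X)"
proof (rule group.subgroupI[OF group_BijGroup])
  show "sch_carrier G H \<subseteq> carrier (BijGroup X)" by (auto simp: BijGroup_def sch_carrier_iff)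
  have "(\<lambda>C\<in>X. C) \<in> sch_carrier G H"
    unfolding sch_carrier_iff by (auto simp: id_Bij subset_iff act_one intro!: bexI[of _ \<one>])
  then show "sch_carrier G H \<noteq> {}" by blast
  fix y assume y: "y \<in> sch_carrier G H"
  then have yB: "y \<in> Bij X" by (simp add: sch_carrier_iff)
  show "inv\<^bsub>BijGroup X\<^esub> y \<in> sch_carrier G H"
    unfolding inv_BijGroup[OF yB] sch_carrier_iff
  proof (intro conjI allI impI)
    show "restrict (inv_into X y) X \<in> Bij X" using restrict_inv_into_Bij[OF yB] .
    fix F assume F: "finite F" "F \<subseteq> X"
    have "finite (inv_into X y ` F)" "inv_into X y ` F \<subseteq> X" using F Bij_inv_apply(1)[OF yB] by auto
    then obtain g where g: "g \<in> carrier G" "\<forall>C\<in>inv_into X y ` F. g <# C = y C"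
      using y unfolding sch_carrier_iff by blast
    have "inv g <# C = inv_into X y C" if C: "C \<in> F" for C
    proof -
      have CX: "C \<in> X" using C F by auto
      have "g <# inv_into X y C = C" using g(2) C Bij_inv_apply(2)[OF yB CX] by auto
      then have "inv g <# C = inv g <# (g <# inv_into X y C)" by simp
      then show ?thesis using g(1) Bij_inv_apply(1)[OF yB CX] by (simp add: act_assoc act_one)
    qed
    then show "\<exists>g\<in>carrier G. \<forall>C\<in>F. g <# C = restrict (inv_into X y) X C"
      using g(1) F by (intro bexI[of _ "inv g"]) auto
  qed
  fix z assume z: "z \<in> sch_carrier G H"
  then have zB: "z \<in> Bij X" by (simp add: sch_carrier_iff)
  have "compose X y z \<in> sch_carrier G H"
    unfolding sch_carrier_iff
  proof (intro conjI allI impI)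
    show "compose X y z \<in> Bij X" by (rule compose_Bij[OF yB zB])
    fix F assume F: "finite F" "F \<subseteq> X"
    obtain g where g: "g \<in> carrier G" "\<forall>C\<in>F. g <# C = z C" using z F unfolding sch_carrier_iff by blast
    have "finite (z ` F)" "z ` F \<subseteq> X" using F Bij_inv_apply(3)[OF zB] by auto
    then obtain g' where g': "g' \<in> carrier G" "\<forall>C\<in>z ` F. g' <# C = y C" using y unfolding sch_carrier_iff by blast
    have "(g' \<otimes> g) <# C = compose X y z C" if C: "C \<in> F" for C
    proof -
      have CX: "C \<in> X" using C F by auto
      have "(g' \<otimes> g) <# C = g' <# (g <# C)" using act_assoc[OF CX g'(1) g(1)] by simp
      also have "\<dots> = y (z C)" using g g' C by simp
      finally show ?thesis using CX by (simp add: compose_eq)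
    qed
    then show "\<exists>g\<in>carrier G. \<forall>C\<in>F. g <# C = compose X y z C" using g g' by (intro bexI[of _ "g' \<otimes> g"]) auto
  qed
  then show "y \<otimes>\<^bsub>BijGroup X\<^esub> z \<in> sch_carrier G H" using yB zB by (simp add: BijGroup_def)
qed

lemma group_L: "group L"
  unfolding sch_group_def by (rule subgroup.subgroup_is_group[OF subgroup_sch_carrier group_BijGroup])

sublocale L: plain_group L by (rule plain_group.intro[OF group_L])

lemma L_closed: "y \<in> carrier L \<Longrightarrow> C \<in> X \<Longrightarrow> y C \<in> X"
  using Bij_inv_apply(3)[OF L_Bij] .

lemma L_mult: "x \<in> carrier L \<Longrightarrow> y \<in> carrier L \<Longrightarrow> C \<in> X \<Longrightarrow> (x \<otimes>\<^bsub>L\<^esub> y) C = x (y C)"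
  using L_Bij[of x] L_Bij[of y] by (simp add: sch_group_def BijGroup_def compose_eq)

lemma L_one: "C \<in> X \<Longrightarrow> \<one>\<^bsub>L\<^esub> C = C" by (simp add: sch_group_def BijGroup_def)

lemma L_inv: assumes "y \<in> carrier L" "C \<in> X"
  shows "y ((inv\<^bsub>L\<^esub> y) C) = C" "(inv\<^bsub>L\<^esub> y) (y C) = C"
  using L_mult[of y "inv\<^bsub>L\<^esub> y" C] L_mult[of "inv\<^bsub>L\<^esub> y" y C] assms L_one by simp_all

lemma L_ext: assumes "x \<in> carrier L" "y \<in> carrier L" "\<And>C. C \<in> X \<Longrightarrow> x C = y C" shows "x = y"
  using Bij_imp_extensional[OF L_Bij[OF assms(1)]] Bij_imp_extensional[OF L_Bij[OF assms(2)]] assms(3)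
  by (rule extensionalityI)

lemma L_eq_iff: assumes "y \<in> carrier L" "C \<in> X" "D \<in> X" shows "y C = D \<longleftrightarrow> (inv\<^bsub>L\<^esub> y) D = C"
  using L_inv[OF assms(1)] assms by metis

lemma \<sigma>_L: "g \<in> carrier G \<Longrightarrow> \<sigma> g \<in> carrier L"
  using \<sigma>_Bij by (auto simp: carrier_L sch_carrier_iff \<sigma>_apply subset_iff)

lemma \<sigma>_hom: "\<sigma> \<in> hom G L"
proof (rule homI)
  fix g h assume g: "g \<in> carrier G" "h \<in> carrier G"
  show "\<sigma> (g \<otimes> h) = \<sigma> g \<otimes>\<^bsub>L\<^esub> \<sigma> h"
    using g by (intro L_ext) (auto simp: \<sigma>_L L_mult \<sigma>_apply act_closed act_assoc)
qed (rule \<sigma>_L)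

lemma K_approx: assumes y: "y \<in> K" and C: "C \<in> X" shows "\<exists>h\<in>H. h <# C = y C"
proof -
  have "\<forall>F. finite F \<longrightarrow> F \<subseteq> X \<longrightarrow> (\<exists>g\<in>H. \<forall>C\<in>F. g <# C = y C)"
    using y unfolding sch_sub_iff by (rule conjunct2)
  from this[rule_format, of "{C}"] C show ?thesis by simp
qed

text \<open>The closure of \<open>H\<close> is the stabiliser of the base point \<open>H\<close>: an
  element of \<open>G\<close> that approximates \<open>y\<close> on a finite set enlarged by that
  point must itself fix it, hence lies in \<open>H\<close>.\<close>

lemma K_iff: "y \<in> K \<longleftrightarrow> y \<in> carrier L \<and> y H = H"
proof
  assume y: "y \<in> K"
  obtain h where h: "h \<in> H" "h <# H = y H" using K_approx[OF y H_in_X] by blast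
  have "y H = H" using h act_H_iff[OF Hc[OF h(1)]] by simp
  moreover have "\<exists>g\<in>carrier G. \<forall>C\<in>F. g <# C = y C" if "finite F" "F \<subseteq> X" for F
  proof -
    have "\<exists>g\<in>H. \<forall>C\<in>F. g <# C = y C" using y that unfolding sch_sub_iff by simp
    then show ?thesis using Hc by blast
  qed
  ultimately show "y \<in> carrier L \<and> y H = H"
    using y unfolding carrier_L sch_carrier_iff sch_sub_iff by simp
next
  assume y: "y \<in> carrier L \<and> y H = H"
  show "y \<in> K"
    unfolding sch_sub_iff
  proof (intro conjI allI impI)
    fix F assume F: "finite F" "F \<subseteq> X"
    then obtain g where g: "g \<in> carrier G" "\<forall>C\<in>insert H F. g <# C = y C"
      using L_approx[of y "insert H F"] y H_in_X by auto
    then have "g \<in> H" using y act_H_iff by auto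
    then show "\<exists>g\<in>H. \<forall>C\<in>F. g <# C = y C" using g by blast
  qed (use y L_Bij in blast)
qed

text \<open>Pointwise stabilisers; those of finite sets form the neighbourhood base of open
  subgroups at the identity.\<close>

definition fixer :: "'a set set \<Rightarrow> ('a set \<Rightarrow> 'a set) set" where
  "fixer F = {y \<in> carrier L. \<forall>C\<in>F. y C = C}"

lemma subgroup_fixer: assumes "F \<subseteq> X" shows "subgroup (fixer F) L"
proof (rule L.subgroupI)
  show "fixer F \<noteq> {}" using L_one assms by (auto simp: fixer_def intro!: exI[of _ "\<one>\<^bsub>L\<^esub>"])
  fix a assume a: "a \<in> fixer F"
  show "inv\<^bsub>L\<^esub> a \<in> fixer F" using a assms L_eq_iff by (auto simp: fixer_def subset_iff)
  fix b assume b: "b \<in> fixer F"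
  show "a \<otimes>\<^bsub>L\<^esub> b \<in> fixer F" using a b assms L_mult by (auto simp: fixer_def subset_iff)
qed (auto simp: fixer_def)

lemma K_eq_fixer: "K = fixer {H}" using K_iff by (auto simp: fixer_def)

lemma openin_L:
  "openin (sch_top G H) W \<longleftrightarrow> W \<subseteq> carrier L \<and>
     (\<forall>y\<in>W. \<exists>F. finite F \<and> F \<subseteq> X \<and> (\<forall>z\<in>carrier L. (\<forall>C\<in>F. z C = y C) \<longrightarrow> z \<in> W))"
  (is "?l \<longleftrightarrow> ?r")
proof
  assume ?l
  then obtain V where V: "openin (perm_top X) V" "W = V \<inter> carrier L"
    unfolding sch_top_def openin_subtopology carrier_L by blast
  have "\<exists>F. finite F \<and> F \<subseteq> X \<and> (\<forall>z\<in>carrier L. (\<forall>C\<in>F. z C = y C) \<longrightarrow> z \<in> W)" if y: "y \<in> W" for y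
  proof -
    obtain F where "finite F" "F \<subseteq> X" "\<forall>z\<in>Bij X. (\<forall>C\<in>F. z C = y C) \<longrightarrow> z \<in> V"
      using V y unfolding openin_perm_top by blast
    then show ?thesis using V L_Bij by (intro exI[of _ F]) auto
  qed
  then show ?r using V by auto
next
  assume r: ?r
  then have "\<forall>y\<in>W. \<exists>F. finite F \<and> F \<subseteq> X \<and> (\<forall>z\<in>carrier L. (\<forall>C\<in>F. z C = y C) \<longrightarrow> z \<in> W)" by blast
  then obtain F where F: "\<And>y. y \<in> W \<Longrightarrow> finite (F y) \<and> F y \<subseteq> X \<and> (\<forall>z\<in>carrier L. (\<forall>C\<in>F y. z C = y C) \<longrightarrow> z \<in> W)"
    by metis
  define V where "V = {z \<in> Bij X. \<exists>y\<in>W. \<forall>C\<in>F y. z C = y C}"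
  have "openin (perm_top X) V"
    unfolding openin_perm_top
  proof (intro conjI ballI)
    fix z assume "z \<in> V"
    then obtain y where y: "y \<in> W" "\<forall>C\<in>F y. z C = y C" by (auto simp: V_def)
    then show "\<exists>F. finite F \<and> F \<subseteq> X \<and> (\<forall>z'\<in>Bij X. (\<forall>C\<in>F. z' C = z C) \<longrightarrow> z' \<in> V)"
      using F[OF y(1)] by (intro exI[of _ "F y"]) (auto simp: V_def)
  qed (auto simp: V_def)
  moreover have "W = V \<inter> carrier L"
  proof (intro equalityI subsetI)
    fix y assume "y \<in> W"
    then show "y \<in> V \<inter> carrier L" using r L_Bij by (auto simp: V_def)
  next
    fix z assume "z \<in> V \<inter> carrier L"
    then show "z \<in> W" using F by (auto simp: V_def)
  qed
  ultimately show ?l unfolding sch_top_def openin_subtopology carrier_L by blast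
qed

lemma openinD_L:
  assumes "openin (sch_top G H) W" "y \<in> W"
  obtains F where "finite F" "F \<subseteq> X" "\<And>z. z \<in> carrier L \<Longrightarrow> (\<And>C. C \<in> F \<Longrightarrow> z C = y C) \<Longrightarrow> z \<in> W"
  using assms unfolding openin_L by metis

lemma openinI_L:
  assumes "W \<subseteq> carrier L"
    "\<And>y. y \<in> W \<Longrightarrow> \<exists>F. finite F \<and> F \<subseteq> X \<and> (\<forall>z\<in>carrier L. (\<forall>C\<in>F. z C = y C) \<longrightarrow> z \<in> W)"
  shows "openin (sch_top G H) W"
  using assms unfolding openin_L by blast

lemma openin_fixer: assumes "finite F" "F \<subseteq> X" shows "openin (sch_top G H) (fixer F)"
  using assms by (intro openinI_L) (auto simp: fixer_def intro!: exI[of _ F])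

text \<open>Orbit-stabiliser: the stabiliser in \<open>H\<close> of the coset \<open>x H\<close> is
  \<open>H \<inter> x H inv x\<close>, which has finite index by the Hecke condition.\<close>

lemma H_orbit_finite: assumes "C \<in> X" shows "finite ((\<lambda>h. h <# C) ` H)"
proof -
  obtain x where x: "x \<in> carrier G" "C = x <# H" using assms by (auto simp: X_iff)
  let ?P = "H \<inter> ((x <# H) #> inv x)"
  have fin: "finite (lcosets\<^bsub>G\<lparr>carrier := H\<rparr>\<^esub> ?P)" using hecke x by (simp add: hecke_pair_def)
  have "h <# C = h' <# C" if h: "h \<in> H" "h' \<in> H" and eq: "h <# ?P = h' <# ?P" for h h'
  proof -
    have hc: "h \<in> carrier G" "h' \<in> carrier G" using h Hc by auto
    have "\<one> \<in> ?P"
    proof -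
      have "x \<otimes> \<one> \<otimes> inv x = \<one>" using x by simp
      moreover have "x \<otimes> \<one> \<otimes> inv x \<in> (x <# H) #> inv x"
        using subgroup.one_closed[OF H] unfolding l_coset_def r_coset_def by blast
      ultimately show ?thesis using subgroup.one_closed[OF H] by simp
    qed
    then have "h \<otimes> \<one> \<in> h <# ?P" unfolding l_coset_def by blast
    then have "h \<in> h' <# ?P" using eq hc by simp
    then obtain p where p: "p \<in> ?P" "h = h' \<otimes> p" unfolding l_coset_def by blast
    then obtain k where k: "k \<in> H" "p = x \<otimes> k \<otimes> inv x" unfolding l_coset_def r_coset_def by blast
    have kc: "k \<in> carrier G" "p \<in> carrier G" using k p Hc by auto
    have "p <# C = (p \<otimes> x) <# H" using x kc lcos_m_assoc[OF subgroup.subset[OF H]] by simp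
    also have "p \<otimes> x = x \<otimes> k" using k(2) kc x by (simp add: m_assoc)
    also have "(x \<otimes> k) <# H = x <# (k <# H)" using x kc lcos_m_assoc[OF subgroup.subset[OF H]] by simp
    also have "\<dots> = C" using act_H_iff[OF kc(1)] k x by simp
    finally have "p <# C = C" .
    then show ?thesis using p(2) act_assoc[OF assms hc(2) kc(2)] by simp
  qed
  then have "\<exists>\<psi>. \<forall>h\<in>H. h <# C = \<psi> (h <# ?P)"
    by (intro exI[of _ "\<lambda>D. (SOME h. h \<in> H \<and> h <# ?P = D) <# C"] ballI) (smt (verit, best) someI_ex)
  then obtain \<psi> where \<psi>: "\<And>h. h \<in> H \<Longrightarrow> h <# C = \<psi> (h <# ?P)" by blast
  have "(\<lambda>h. h <# C) ` H \<subseteq> \<psi> ` (lcosets\<^bsub>G\<lparr>carrier := H\<rparr>\<^esub> ?P)"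
    using \<psi> by (auto simp: LCOSETS_def)
  then show ?thesis using fin finite_surj by blast
qed

text \<open>Tychonoff applies to the product of the finite \<open>H\<close>-orbits, in which
  \<open>K\<close> is closed. The point at issue is that a pointwise limit of permutations need not
  be surjective; finiteness of the orbits prevents this.\<close>

lemma K_compact: "compactin (sch_top G H) K"
proof -
  let ?P = "product_topology (\<lambda>_. discrete_topology X) X"
  let ?O = "\<lambda>C. (\<lambda>h. h <# C) ` H"
  have OX: "?O C \<subseteq> X" if "C \<in> X" for C using act_closed[OF that] Hc by auto
  have box: "compactin ?P (Pi\<^sub>E X ?O)"
    using H_orbit_finite OX by (auto simp: compactin_PiE compactin_discrete_topology)
  define Z where "Z = {\<phi> \<in> Pi\<^sub>E X ?O. \<forall>F. finite F \<longrightarrow> F \<subseteq> X \<longrightarrow> (\<exists>h\<in>H. \<forall>C\<in>F. h <# C = \<phi> C)}"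
  have ZB: "\<phi> \<in> Bij X" if \<phi>: "\<phi> \<in> Z" for \<phi>
  proof -
    have app: "\<exists>h\<in>H. \<forall>C\<in>F. h <# C = \<phi> C" if "finite F" "F \<subseteq> X" for F using \<phi> that by (simp add: Z_def)
    have inj: "inj_on \<phi> X"
    proof (rule inj_onI)
      fix C D assume CD: "C \<in> X" "D \<in> X" "\<phi> C = \<phi> D"
      obtain h where h: "h \<in> H" "h <# C = \<phi> C" "h <# D = \<phi> D" using app[of "{C, D}"] CD by auto
      then have "inv h <# (h <# C) = inv h <# (h <# D)" using CD by simp
      then show "C = D" using CD h(1) Hc by (simp add: act_assoc act_one)
    qed
    \<comment> \<open>A limit maps each finite orbit into itself, and injectively, hence onto
      itself.\<close>
    have orb: "\<phi> ` ?O D \<subseteq> ?O D" if D: "D \<in> X" for D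
    proof clarify
      fix h assume h: "h \<in> H"
      obtain h' where h': "h' \<in> H" "h' <# (h <# D) = \<phi> (h <# D)"
        using app[of "{h <# D}"] act_closed[OF D] Hc[OF h] by auto
      have "\<phi> (h <# D) = (h' \<otimes> h) <# D" using h' act_assoc[OF D Hc[OF h'(1)] Hc[OF h]] by simp
      then show "\<phi> (h <# D) \<in> ?O D" using subgroup.m_closed[OF H h'(1) h] by blast
    qed
    have "\<phi> ` X = X"
    proof (intro equalityI subsetI)
      fix D assume "D \<in> \<phi> ` X"
      then obtain C where C: "C \<in> X" "D = \<phi> C" by blast
      have "\<phi> C \<in> ?O C" using \<phi> C(1) unfolding Z_def by (auto dest: PiE_mem)
      then show "D \<in> X" using OX[OF C(1)] C(2) by blast
    next
      fix D assume D: "D \<in> X"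
      have "\<phi> ` ?O D = ?O D"
        using H_orbit_finite[OF D] orb[OF D] inj_on_subset[OF inj OX[OF D]] by (rule endo_inj_surj)
      moreover have "D \<in> ?O D" using act_one[OF D, symmetric] subgroup.one_closed[OF H] by (rule image_eqI)
      ultimately have "D \<in> \<phi> ` ?O D" by (simp only:)
      then show "D \<in> \<phi> ` X" by (rule subsetD[OF image_mono[OF OX[OF D]]])
    qed
    moreover have "\<phi> \<in> extensional X" using \<phi> by (simp add: Z_def PiE_def)
    ultimately show ?thesis using inj by (simp add: Bij_def bij_betw_def)
  qed
  have ZK: "Z = K"
  proof (intro equalityI subsetI)
    fix \<phi> assume "\<phi> \<in> Z" then show "\<phi> \<in> K" using ZB unfolding sch_sub_iff by (simp add: Z_def)
  next
    fix y assume y: "y \<in> K"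
    have "y \<in> Pi\<^sub>E X ?O"
      using y K_approx[OF y] Bij_imp_extensional[of y X] unfolding sch_sub_iff
      by (auto simp: PiE_def image_iff) metis
    then show "y \<in> Z" using y unfolding sch_sub_iff by (simp add: Z_def)
  qed
  \<comment> \<open>Failure to be approximated by \<open>H\<close> is witnessed by a finite set
    \<open>F\<close>, and all functions that agree on \<open>F\<close> share it.\<close>
  have "closedin ?P Z"
  proof -
    have "openin ?P ((\<Pi>\<^sub>E i\<in>X. X) - Z)"
      unfolding openin_product_topology_alt
    proof (intro ballI)
      fix \<phi> assume \<phi>: "\<phi> \<in> (\<Pi>\<^sub>E i\<in>X. X) - Z"
      have "\<exists>F. finite F \<and> F \<subseteq> X \<and> \<not> (\<exists>h\<in>H. \<forall>C\<in>F. h <# C = \<phi> C)"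
      proof (rule ccontr)
        assume no: "\<not> ?thesis"
        have "\<phi> C \<in> ?O C" if C: "C \<in> X" for C
        proof -
          have "finite {C} \<and> {C} \<subseteq> X" using C by simp
          then have "\<exists>h\<in>H. \<forall>D\<in>{C}. h <# D = \<phi> D" using no by blast
          then show ?thesis by auto
        qed
        then have "\<phi> \<in> Pi\<^sub>E X ?O" using \<phi> by (auto simp: PiE_def)
        then show False using \<phi> no by (auto simp: Z_def)
      qed
      then obtain F where F: "finite F" "F \<subseteq> X" "\<not> (\<exists>h\<in>H. \<forall>C\<in>F. h <# C = \<phi> C)" by blast
      let ?U = "\<lambda>C. if C \<in> F then {\<phi> C} else X"
      have "finite {i \<in> X. ?U i \<noteq> X}" by (rule finite_subset[OF _ F(1)]) auto
      moreover have "\<phi> \<in> Pi\<^sub>E X ?U" "\<forall>i\<in>X. ?U i \<subseteq> X" using \<phi> by (auto simp: PiE_def Pi_def)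
      moreover have "Pi\<^sub>E X ?U \<subseteq> (\<Pi>\<^sub>E i\<in>X. X) - Z"
      proof
        fix \<psi> assume \<psi>: "\<psi> \<in> Pi\<^sub>E X ?U"
        then have "\<psi> C = \<phi> C" if "C \<in> F" for C using PiE_mem[OF \<psi>, of C] F(2) that by auto
        then have "\<not> (\<exists>h\<in>H. \<forall>C\<in>F. h <# C = \<psi> C)" using F(3) by simp
        then have "\<psi> \<notin> Z" using F(1,2) by (auto simp: Z_def)
        moreover have "\<psi> \<in> (\<Pi>\<^sub>E i\<in>X. X)" using \<psi> \<open>\<forall>i\<in>X. ?U i \<subseteq> X\<close> PiE_mono[of X ?U "\<lambda>_. X"] by blast
        ultimately show "\<psi> \<in> (\<Pi>\<^sub>E i\<in>X. X) - Z" by blast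
      qed
      ultimately show "\<exists>U. finite {i \<in> X. U i \<noteq> topspace (discrete_topology X)} \<and>
          (\<forall>i\<in>X. openin (discrete_topology X) (U i)) \<and> \<phi> \<in> Pi\<^sub>E X U \<and> Pi\<^sub>E X U \<subseteq> (\<Pi>\<^sub>E i\<in>X. X) - Z"
        by (intro exI[of _ ?U]) simp
    qed
    moreover have "Z \<subseteq> (\<Pi>\<^sub>E i\<in>X. X)"
    proof (rule subset_trans)
      show "Z \<subseteq> Pi\<^sub>E X ?O" unfolding Z_def by (rule Collect_restrict)
      show "Pi\<^sub>E X ?O \<subseteq> (\<Pi>\<^sub>E i\<in>X. X)" using OX by (rule PiE_mono)
    qed
    ultimately show ?thesis by (simp add: closedin_def)
  qed
  moreover have "Z \<subseteq> Pi\<^sub>E X ?O" unfolding Z_def by (rule Collect_restrict)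
  ultimately have "compactin ?P Z" using closed_compactin[OF box] by blast
  moreover have "K \<subseteq> Bij X" "K \<subseteq> sch_carrier G H" using K_iff L_Bij carrier_L by auto
  ultimately show ?thesis unfolding sch_top_def perm_top_def by (simp add: compactin_subtopology ZK)
qed

lemma topspace_L: "topspace (sch_top G H) = carrier L"
proof -
  have "sch_carrier G H \<subseteq> Bij X" using sch_carrier_iff by auto
  then show ?thesis by (auto simp: sch_top_def topspace_perm_top carrier_L)
qed

sublocale L: tdlc_group L "sch_top G H" K
proof (intro tdlc_group.intro tdlc_group_axioms.intro)
  show "plain_group L" by (rule L.plain_group_axioms)
  show "topspace (sch_top G H) = carrier L" by (rule topspace_L)
  show "subgroup K L" unfolding K_eq_fixer using H_in_X by (intro subgroup_fixer) simp
  show "openin (sch_top G H) K" unfolding K_eq_fixer using H_in_X by (intro openin_fixer) auto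
  show "compactin (sch_top G H) K" by (rule K_compact)
next
  fix A assume A: "openin (sch_top G H) A" "\<one>\<^bsub>L\<^esub> \<in> A"
  obtain F where F: "finite F" "F \<subseteq> X" "\<And>z. z \<in> carrier L \<Longrightarrow> (\<And>C. C \<in> F \<Longrightarrow> z C = \<one>\<^bsub>L\<^esub> C) \<Longrightarrow> z \<in> A"
    using openinD_L[OF A] by blast
  \<comment> \<open>Adding the point \<open>H\<close> to the finite set places the stabiliser inside
    \<open>K\<close>.\<close>
  have FX: "insert H F \<subseteq> X" "finite (insert H F)" using F H_in_X by auto
  have "fixer (insert H F) \<subseteq> A \<inter> K"
    using F(2,3) L_one by (auto simp: fixer_def K_iff subset_iff)
  then show "\<exists>U. subgroup U L \<and> openin (sch_top G H) U \<and> U \<subseteq> A \<inter> K"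
    using subgroup_fixer[OF FX(1)] openin_fixer[OF FX(2,1)] by blast
next
  fix g A assume g: "g \<in> carrier L" and A: "openin (sch_top G H) A"
  have Ac: "A \<subseteq> carrier L" using A by (simp add: openin_L)
  show "openin (sch_top G H) (g <#\<^bsub>L\<^esub> A)"
  proof (rule openinI_L)
    show "g <#\<^bsub>L\<^esub> A \<subseteq> carrier L" using L.l_coset_subset_G[OF Ac g] .
    fix x assume "x \<in> g <#\<^bsub>L\<^esub> A"
    then obtain y where y: "y \<in> A" "x = g \<otimes>\<^bsub>L\<^esub> y" by (auto simp: l_coset_def)
    have yc: "y \<in> carrier L" using y Ac by auto
    obtain F where F: "finite F" "F \<subseteq> X" "\<And>z. z \<in> carrier L \<Longrightarrow> (\<And>C. C \<in> F \<Longrightarrow> z C = y C) \<Longrightarrow> z \<in> A"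
      using openinD_L[OF A y(1)] by blast
    have "z \<in> g <#\<^bsub>L\<^esub> A" if z: "z \<in> carrier L" and eq: "\<forall>C\<in>F. z C = x C" for z
    proof -
      have "(inv\<^bsub>L\<^esub> g \<otimes>\<^bsub>L\<^esub> z) C = y C" if "C \<in> F" for C
        using that F(2) eq g z yc L_inv(2)[OF g, of "y C"] by (simp add: L_mult L_closed y(2) subset_iff)
      then have "inv\<^bsub>L\<^esub> g \<otimes>\<^bsub>L\<^esub> z \<in> A" using g z by (intro F(3)) auto
      moreover have "z = g \<otimes>\<^bsub>L\<^esub> (inv\<^bsub>L\<^esub> g \<otimes>\<^bsub>L\<^esub> z)" using g z by (simp add: L.inv_cancel)
      ultimately show ?thesis unfolding l_coset_def by blast
    qed
    then show "\<exists>F. finite F \<and> F \<subseteq> X \<and> (\<forall>z\<in>carrier L. (\<forall>C\<in>F. z C = x C) \<longrightarrow> z \<in> g <#\<^bsub>L\<^esub> A)"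
      using F(1,2) by (intro exI[of _ F]) simp
  qed
  show "openin (sch_top G H) (A #>\<^bsub>L\<^esub> g)"
  proof (rule openinI_L)
    show "A #>\<^bsub>L\<^esub> g \<subseteq> carrier L" using L.r_coset_subset_G[OF Ac g] .
    fix x assume "x \<in> A #>\<^bsub>L\<^esub> g"
    then obtain y where y: "y \<in> A" "x = y \<otimes>\<^bsub>L\<^esub> g" by (auto simp: r_coset_def)
    have yc: "y \<in> carrier L" using y Ac by auto
    obtain F where F: "finite F" "F \<subseteq> X" "\<And>z. z \<in> carrier L \<Longrightarrow> (\<And>C. C \<in> F \<Longrightarrow> z C = y C) \<Longrightarrow> z \<in> A"
      using openinD_L[OF A y(1)] by blast
    \<comment> \<open>Right multiplication by \<open>g\<close> moves the test points:
      \<open>z inv g\<close> agrees with \<open>y\<close> on \<open>F\<close> when \<open>z\<close>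
      agrees with \<open>y g\<close> on this set.\<close>
    let ?F = "(inv\<^bsub>L\<^esub> g) ` F"
    have FX: "?F \<subseteq> X" using F(2) L_closed g by auto
    have "z \<in> A #>\<^bsub>L\<^esub> g" if z: "z \<in> carrier L" and eq: "\<forall>C\<in>?F. z C = x C" for z
    proof -
      have "(z \<otimes>\<^bsub>L\<^esub> inv\<^bsub>L\<^esub> g) C = y C" if "C \<in> F" for C
        using that F(2) eq g z yc L_inv(1)[OF g, of C] by (simp add: L_mult L_closed y(2) subset_iff)
      then have "z \<otimes>\<^bsub>L\<^esub> inv\<^bsub>L\<^esub> g \<in> A" using g z by (intro F(3)) auto
      moreover have "z = (z \<otimes>\<^bsub>L\<^esub> inv\<^bsub>L\<^esub> g) \<otimes>\<^bsub>L\<^esub> g" using g z by (simp add: L.m_assoc)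
      ultimately show ?thesis unfolding r_coset_def by blast
    qed
    then show "\<exists>F. finite F \<and> F \<subseteq> X \<and> (\<forall>z\<in>carrier L. (\<forall>C\<in>F. z C = x C) \<longrightarrow> z \<in> A #>\<^bsub>L\<^esub> g)"
      using F(1) FX by (intro exI[of _ ?F]) simp
  qed
next
  fix A assume A: "openin (sch_top G H) A"
  show "openin (sch_top G H) {x \<in> carrier L. inv\<^bsub>L\<^esub> x \<in> A}"
  proof (rule openinI_L)
    fix x assume "x \<in> {x \<in> carrier L. inv\<^bsub>L\<^esub> x \<in> A}"
    then have x: "x \<in> carrier L" "inv\<^bsub>L\<^esub> x \<in> A" by auto
    obtain F where F: "finite F" "F \<subseteq> X" "\<And>z. z \<in> carrier L \<Longrightarrow> (\<And>C. C \<in> F \<Longrightarrow> z C = (inv\<^bsub>L\<^esub> x) C) \<Longrightarrow> z \<in> A"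
      using openinD_L[OF A x(2)] by blast
    let ?F = "(inv\<^bsub>L\<^esub> x) ` F"
    have FX: "?F \<subseteq> X" using F(2) L_closed x by auto
    have "inv\<^bsub>L\<^esub> z \<in> A" if z: "z \<in> carrier L" and eq: "\<forall>C\<in>?F. z C = x C" for z
    proof (rule F(3))
      fix C assume C: "C \<in> F"
      then have CX: "C \<in> X" "(inv\<^bsub>L\<^esub> x) C \<in> X" using F(2) FX by auto
      have "z ((inv\<^bsub>L\<^esub> x) C) = C" using eq C L_inv(1)[OF x(1) CX(1)] by simp
      then show "(inv\<^bsub>L\<^esub> z) C = (inv\<^bsub>L\<^esub> x) C" using L_eq_iff[OF z CX(2,1)] by simp
    qed (use z in simp)
    then show "\<exists>F. finite F \<and> F \<subseteq> X \<and> (\<forall>z\<in>carrier L. (\<forall>C\<in>F. z C = x C) \<longrightarrow> z \<in> {x \<in> carrier L. inv\<^bsub>L\<^esub> x \<in> A})"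
      using F(1) FX by (intro exI[of _ ?F]) simp
  qed auto
qed

sublocale hecke_hom G L H K \<sigma>
proof (intro hecke_hom.intro hecke_hom_axioms.intro)
  show "plain_group G" by (rule plain_group_axioms)
  show "plain_group L" by (rule L.plain_group_axioms)
  show "subgroup H G" by (rule H)
  show "subgroup K L" by (rule L.K(1))
  show "\<sigma> \<in> hom G L" by (rule \<sigma>_hom)
  show "\<sigma> x \<in> K \<longleftrightarrow> x \<in> H" if "x \<in> carrier G" for x
    using that \<sigma>_L act_H_iff by (simp add: K_iff \<sigma>_apply H_in_X)
next
  fix y assume y: "y \<in> carrier L"
  \<comment> \<open>One test point is enough: if \<open>x\<close> and \<open>y\<close> agree at the
    point that \<open>y\<close> maps to \<open>H\<close>, then \<open>y (inv (\<sigma> x))\<close>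
    fixes \<open>H\<close>.\<close>
  let ?C = "(inv\<^bsub>L\<^esub> y) H"
  have C: "?C \<in> X" using L_closed y H_in_X by simp
  obtain x where x: "x \<in> carrier G" "x <# ?C = y ?C" using L_approx[OF y, of "{?C}"] C by auto
  have "y \<otimes>\<^bsub>L\<^esub> inv\<^bsub>L\<^esub> \<sigma> x \<in> K"
  proof -
    have "\<sigma> x ?C = H" using x L_inv(1)[OF y H_in_X] \<sigma>_apply[OF C] by simp
    then have "(inv\<^bsub>L\<^esub> \<sigma> x) H = ?C" using L_eq_iff[OF \<sigma>_L[OF x(1)] C H_in_X] by simp
    then show ?thesis using y x \<sigma>_L L_inv(1)[OF y H_in_X] by (simp add: K_iff L_mult H_in_X)
  qed
  then have "y \<in> K #>\<^bsub>L\<^esub> \<sigma> x" using L.mem_r_coset_iff_inv[OF L.K(1) y \<sigma>_L[OF x(1)]] by simp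
  then show "\<exists>x\<in>carrier G. y \<in> K #>\<^bsub>L\<^esub> \<sigma> x" using x by blast
next
  fix x k assume x: "x \<in> carrier G" and k: "k \<in> K"
  have kc: "k \<in> carrier L" using k K_iff by blast
  \<comment> \<open>\<open>\<sigma> x\<close> maps \<open>?D\<close> to \<open>H\<close>, and
    \<open>k\<close> maps \<open>?C\<close> below to \<open>?D\<close>. An \<open>h\<close> in
    \<open>H\<close> that agrees with \<open>k\<close> at \<open>?C\<close> therefore makes
    \<open>\<sigma> (x h)\<close> and \<open>\<sigma> x k\<close> agree there, both with value
    \<open>H\<close>.\<close>
  let ?D = "inv x <# H"
  have D: "?D \<in> X" using x H_in_X act_closed by simp
  let ?C = "(inv\<^bsub>L\<^esub> k) ?D"
  have C: "?C \<in> X" using L_closed kc D by simp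
  have kC: "k ?C = ?D" by (rule L_inv(1)[OF kc D])
  obtain h where h: "h \<in> H" "h <# ?C = k ?C" using K_approx[OF k C] by blast
  have hc: "h \<in> carrier G" using h Hc by auto
  have xh: "\<sigma> (x \<otimes> h) \<in> carrier L" using \<sigma>_L x hc by simp
  have "\<sigma> (x \<otimes> h) ?C = x <# (h <# ?C)" using \<sigma>_apply[OF C] act_assoc[OF C x hc] by simp
  also have "\<dots> = H" using h(2) kC x H_in_X by (simp add: act_assoc act_one)
  finally have "(inv\<^bsub>L\<^esub> \<sigma> (x \<otimes> h)) H = ?C" using L_eq_iff[OF xh C H_in_X] by simp
  then have "(\<sigma> x \<otimes>\<^bsub>L\<^esub> k \<otimes>\<^bsub>L\<^esub> inv\<^bsub>L\<^esub> \<sigma> (x \<otimes> h)) H = \<sigma> x ?D"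
    using \<sigma>_L[OF x] kc xh C kC H_in_X by (simp add: L_mult L_closed)
  also have "\<dots> = H" using \<sigma>_apply[OF D] x H_in_X by (simp add: act_assoc act_one)
  finally have "\<sigma> x \<otimes>\<^bsub>L\<^esub> k \<otimes>\<^bsub>L\<^esub> inv\<^bsub>L\<^esub> \<sigma> (x \<otimes> h) \<in> K" using \<sigma>_L[OF x] kc xh by (simp add: K_iff)
  then have "\<sigma> x \<otimes>\<^bsub>L\<^esub> k \<in> K #>\<^bsub>L\<^esub> \<sigma> (x \<otimes> h)"
    using L.mem_r_coset_iff_inv[OF L.K(1) _ xh, of "\<sigma> x \<otimes>\<^bsub>L\<^esub> k"] \<sigma>_L[OF x] kc by simp
  then show "\<exists>h\<in>H. \<sigma> x \<otimes>\<^bsub>L\<^esub> k \<in> K #>\<^bsub>L\<^esub> \<sigma> (x \<otimes> h)" using h by blast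
qed

text \<open>\<open>a k\<close> lies in \<open>H (a inv h)\<close> exactly when \<open>h\<close> and
  \<open>inv k\<close> send the coset \<open>inv a H\<close> to the same point. So one
  \<open>h\<close> for each point of a finite orbit is enough.\<close>

lemma hecke_fin_H: "hecke_fin G H"
  unfolding hecke_fin_def
proof
  fix a assume a: "a \<in> carrier G"
  let ?C = "inv a <# H"
  have C: "?C \<in> X" using a H_in_X act_closed by simp
  have fin: "finite ((\<lambda>h. h <# ?C) ` H)" by (rule H_orbit_finite[OF C])
  obtain S where S: "S \<subseteq> H" "finite S" "(\<lambda>h. h <# ?C) ` S = (\<lambda>h. h <# ?C) ` H"
    using fin by (metis finite_subset_image order_refl)
  let ?F = "(\<lambda>h. a \<otimes> inv h) ` S"
  have "\<exists>b\<in>?F. a \<otimes> k \<in> H #> b" if k: "k \<in> H" for k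
  proof -
    have ik: "inv k \<in> H" "k \<in> carrier G" using k subgroup.m_inv_closed[OF H] Hc by auto
    then have "inv k <# ?C \<in> (\<lambda>h. h <# ?C) ` S" using S by blast
    then obtain h where h: "h \<in> S" "inv k <# ?C = h <# ?C" by blast
    have hc: "h \<in> carrier G" using h S Hc by blast
    have "(a \<otimes> k \<otimes> h \<otimes> inv a) <# H = a <# (k <# (h <# ?C))"
      using a ik hc H_in_X act_closed by (simp add: act_assoc m_assoc)
    also have "\<dots> = a <# (k <# (inv k <# ?C))" using h by simp
    also have "\<dots> = H" using a ik hc H_in_X act_closed by (simp add: act_assoc act_one inv_cancel)
    finally have "a \<otimes> k \<otimes> h \<otimes> inv a \<in> H" using act_H_iff a ik hc by simp
    then have "a \<otimes> k \<otimes> inv (a \<otimes> inv h) \<in> H" using a ik hc by (simp add: inv_mult_group m_assoc)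
    then have "a \<otimes> k \<in> H #> (a \<otimes> inv h)" using mem_r_coset_iff_inv[OF H] a ik hc by simp
    then show ?thesis using h by blast
  qed
  moreover have "?F \<subseteq> carrier G" using a S Hc by auto
  ultimately show "\<exists>F. finite F \<and> F \<subseteq> carrier G \<and> (\<forall>k\<in>H. \<exists>b\<in>F. a \<otimes> k \<in> H #> b)"
    using S(2) by (intro exI[of _ ?F]) simp
qed

lemma RD_pair_iff: "pair_RD G (discrete_topology (carrier G)) H (count_space (rcosets H)) \<longleftrightarrow>
    (\<exists>l s c. disc_RD G H l s c)"
proof -
  have op: "openin (discrete_topology (carrier G)) (H #> x)" if "x \<in> carrier G" for x
    using that r_coset_subset_G[OF subgroup.subset[OF H]] by simp
  show ?thesis
    using pair_RD_imp_disc_RD[OF H op hecke_fin_H] disc_RD_imp_pair_RD[OF H op] by auto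
qed

lemma RD_completion_iff: "pair_RD L (sch_top G H) K (count_space (rcosets\<^bsub>L\<^esub> K)) \<longleftrightarrow>
    (\<exists>l s c. disc_RD L K l s c)"
  using L.pair_RD_imp_disc_RD[OF L.K(1) L.opsub_coset_open[OF L.opsub_K] L.hecke_fin_K]
    L.disc_RD_imp_pair_RD[OF L.K(1) L.opsub_coset_open[OF L.opsub_K] topspace_L] by auto

text \<open>One direction works with whatever Haar measure (RD) provides; the other has to exhibit
  one and uses the constructed \<open>haar\<close>.\<close>

lemma RD_group_iff: "group_RD L (sch_top G H) \<longleftrightarrow> (\<exists>l s c. disc_RD L K l s c)"
proof
  assume "group_RD L (sch_top G H)"
  then obtain \<mu> where \<mu>: "right_haar L (sch_top G H) \<mu>"
    and RD: "pair_RD L (sch_top G H) {\<one>\<^bsub>L\<^esub>}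
      (distr \<mu> (borel_of (quot_top L (sch_top G H) {\<one>\<^bsub>L\<^esub>})) (\<lambda>x. {\<one>\<^bsub>L\<^esub>} #>\<^bsub>L\<^esub> x))"
    by (auto simp: group_RD_def)
  interpret haar: tdlc_haar L "sch_top G H" K \<mu> by unfold_locales (rule \<mu>)
  show "\<exists>l s c. disc_RD L K l s c" using haar.RD_one_imp_disc_RD RD by (simp add: haar.\<nu>_def)
next
  assume "\<exists>l s c. disc_RD L K l s c"
  then obtain l s c where RD: "disc_RD L K l s c" by blast
  interpret haar: tdlc_haar L "sch_top G H" K L.haar by unfold_locales (rule L.right_haar_haar)
  show "group_RD L (sch_top G H)"
    using haar.disc_RD_imp_RD_one[OF RD] L.right_haar_haar unfolding group_RD_def haar.\<nu>_def by blast
qed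

end

theorem theorem3p10:
  fixes G :: "'a monoid" and H :: "'a set"
  assumes "reduced_hecke_pair G H"
  shows "(pair_RD G (discrete_topology (carrier G)) H (count_space (rcosets\<^bsub>G\<^esub> H))
            \<longleftrightarrow> pair_RD (sch_group G H) (sch_top G H) (sch_sub G H)
                   (count_space (rcosets\<^bsub>sch_group G H\<^esub> (sch_sub G H))))
       \<and> (pair_RD (sch_group G H) (sch_top G H) (sch_sub G H)
                   (count_space (rcosets\<^bsub>sch_group G H\<^esub> (sch_sub G H)))
            \<longleftrightarrow> group_RD (sch_group G H) (sch_top G H))"
proof -
  have "hecke_pair G H" using assms by (simp add: reduced_hecke_pair_def)
  moreover from this have "plain_group G" by (simp add: hecke_pair_def plain_group_def)
  ultimately interpret schlichting G H by (simp add: schlichting_def schlichting_axioms_def)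
  show ?thesis
    unfolding RD_pair_iff RD_completion_iff RD_group_iff
    using disc_RD_extend disc_RD_restrict by blast
qed

end
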